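(* Let $d=2^t$ be a power of two. Let $m$ be a positive integer, and let $X = \{x_1, \dots, x_m\} \subset \mathbb{R}^{2d-2}$ be a set of $m$ points. For each $j\in[2d]$ let $A_1^{(j)}, \dots, A_m^{(j)} \subset S^d \times S^{d-1}$ be closed sets such that $A_i^{(j)} \cap g_1\cdot A_i^{(k)} = \emptyset$ and $A_i^{(j)} \cap g_2 \cdot A_i^{(k)} = \emptyset$ for all $i \in [m]$ and all $j \neq k \in [2d]$. Further assume that $\bigcup_i G\cdot A_i^{(j)} = S^d \times S^{d-1}$ for all $j\in [2d]$. Then there are disjoint subsets $S, T \subset [m]$, functions $\alpha\colon S \to \{g_1, g_2\}$ and $\beta \colon T\to \{1, g_1g_2\}$, and an injective function $\pi\colon S\cup T \to [2d]$ such that \[\operatorname{conv}\{x_i \mid i \in S\} \cap \operatorname{conv}\{x_i \mid i \in T\} \neq \emptyset \quad\text{and}\quad \bigcap_{i \in S} (\alpha(i)\cdot A_i^{(\pi(i))}) \cap \bigcap_{i \in T} (\beta(i)\cdot A_i^{(\pi(i))}) \neq \emptyset.\]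
   Context: $(\mathbb{Z}/2)^2$ with generators $g_1,g_2$ (identity $1$) acts on $S^d\times S^{d-1}$ by $g_1\cdot(x,y)=(-x,y)$ and $g_2\cdot(x,y)=(x,-y)$. For $A\subset S^d\times S^{d-1}$, $g\cdot A=\{g\cdot p \mid p\in A\}$ and $G\cdot A = A\cup g_1\cdot A\cup g_2\cdot A\cup g_1g_2\cdot A$. *)

theory Defs
  imports "HOL-Analysis.Analysis"
begin

text \<open>
  The group \<open>(\<int>/2)\<^sup>2\<close> is represented by the four transformations \<open>id\<close>, \<open>g1\<close>, \<open>g2\<close>, \<open>g1 \<circ> g2\<close>
  through which it acts (the action is faithful), so that \<open>g \<cdot> A\<close> is the image \<open>g ` A\<close>.
\<close>

definition g1 :: "'a::real_vector \<times> 'b::real_vector \<Rightarrow> 'a \<times> 'b" where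
  "g1 p = (- fst p, snd p)"

definition g2 :: "'a::real_vector \<times> 'b::real_vector \<Rightarrow> 'a \<times> 'b" where
  "g2 p = (fst p, - snd p)"

definition G_orbit :: "('a::real_vector \<times> 'b::real_vector) set \<Rightarrow> ('a \<times> 'b) set" where
  "G_orbit A = A \<union> g1 ` A \<union> g2 ` A \<union> (g1 \<circ> g2) ` A"

text \<open>
  The product of the unit spheres of \<open>'a\<close> and \<open>'b\<close>; it is \<open>S\<^sup>d \<times> S\<^bsup>d-1\<^esup>\<close> when
  \<open>DIM('a) = d + 1\<close> and \<open>DIM('b) = d\<close>.
\<close>

definition sphere_prod :: "('a::euclidean_space \<times> 'b::euclidean_space) set" where
  "sphere_prod = sphere 0 1 \<times> sphere 0 1"

end

theory Submission
  imports Defs "HOL-Library.Nat_Bijection"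
begin

text \<open>
  Put \<open>n = 2 d - 1\<close>. Triangulate \<open>S\<^sup>d \<times> S\<^bsup>d-1\<^esup>\<close> finely and equivariantly, such that each simplex has one
  vertex of each colour \<open>1, \<dots>, 2 d\<close>. A vertex of colour \<open>j\<close> lying in \<open>A\<^sub>i\<^sup>(\<^sup>j\<^sup>) \<union> g\<^sub>1 g\<^sub>2 \<cdot> A\<^sub>i\<^sup>(\<^sup>j\<^sup>)\<close> gets
  the label \<open>(x\<^sub>i, 1)\<close>, one lying in \<open>g\<^sub>1 \<cdot> A\<^sub>i\<^sup>(\<^sup>j\<^sup>) \<union> g\<^sub>2 \<cdot> A\<^sub>i\<^sup>(\<^sup>j\<^sup>)\<close> the label \<open>- (x\<^sub>i, 1)\<close>. This can be done
  such that both \<open>g\<^sub>1\<close> and \<open>g\<^sub>2\<close> negate labels. If the labels of some simplex have the origin in their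
  convex hull, then a limit over finer and finer triangulations yields the theorem.

  For labels in general position in an \<open>n\<close>-dimensional space, the number of simplices with the origin in
  the hull of their labels does not change modulo 8 when the labels of one orbit are moved: in the star of
  one vertex it changes by an even number, and an orbit has four vertices. So it is enough to find
  one odd labelling in general position for which the number is not divisible by 8. For the staircase
  triangulation of the product of two cross-polytope boundaries, labelling by the rank with a sign gives
  4 times the number of lattice paths from \<open>(0, 0)\<close> to \<open>(d, d - 1)\<close>, and \<open>(2 d - 1) choose d\<close> is odd
  since \<open>d\<close> is a power of two. Giving each face the label of its lowest vertex, one sees that
  barycentric subdivision preserves the number.
\<close>

section \<open>Balanced families of vectors\<close>


text \<open>The topology of the spheres enters only through compactness. A triangulation is used
  only through the parity of the number of simplices over a facet and through positions of its
  vertices with small mesh. The colours do two jobs. They keep two vertices of one orbit out of a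
  common simplex, so the four changes caused by moving an orbit are equal and add up; and they
  become the values of \<pi>. The counts are multiples of 4 by symmetry, and moving labels changes
  them by multiples of 8. So the starting count has to be 4 modulo 8, which is why the binomial
  coefficient has to be odd. As \<open>g1\<close> and \<open>g2\<close> both negate labels,
  \<open>g1 \<circ> g2\<close> fixes them. A label thus determines an element only up to a coset,
  whence the two pairs \<open>{g1, g2}\<close> for \<open>S\<close> and \<open>{1, g1 g2}\<close>
  for \<open>T\<close>. The last coordinate 1 of a label gives both signs the same total weight, so
  that a relation among labels becomes a pair of meeting hulls. The labelling obtained from the
  covering may be degenerate, so its simplices are not counted; it is approximated by labellings
  reached from the explicit one.\<close>

definition balanced :: "('v \<Rightarrow> 'w::real_vector) \<Rightarrow> 'v set \<Rightarrow> bool" where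
  "balanced z S \<longleftrightarrow>
     (\<exists>c. (\<forall>v\<in>S. 0 \<le> c v) \<and> (\<exists>v\<in>S. c v \<noteq> 0) \<and> (\<Sum>v\<in>S. c v *\<^sub>R z v) = 0)"

lemma balancedI:
  assumes "\<And>v. v \<in> S \<Longrightarrow> 0 \<le> c v" "u \<in> S" "c u \<noteq> 0" "(\<Sum>v\<in>S. c v *\<^sub>R z v) = 0"
  shows "balanced z S"
  using assms unfolding balanced_def by blast

lemma balanced_mono:
  assumes "balanced z S" "S \<subseteq> T" "finite T"
  shows "balanced z T"
proof -
  obtain c u where c: "\<forall>v\<in>S. 0 \<le> c v" "u \<in> S" "c u \<noteq> 0" "(\<Sum>v\<in>S. c v *\<^sub>R z v) = 0"
    using assms(1) unfolding balanced_def by blast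
  have "(\<Sum>v\<in>T. (if v \<in> S then c v else 0) *\<^sub>R z v) = (\<Sum>v\<in>S. c v *\<^sub>R z v)"
    using assms by (intro sum.mono_neutral_cong_right) auto
  then show ?thesis
    using c assms(2) by (intro balancedI[of T "\<lambda>v. if v \<in> S then c v else 0" u]) auto
qed

lemma balanced_cong:
  assumes "\<And>v. v \<in> S \<Longrightarrow> z v = z' v"
  shows "balanced z S \<longleftrightarrow> balanced z' S"
  using assms unfolding balanced_def by (metis (mono_tags, lifting) sum.cong)

lemma balanced_uminus: "balanced (\<lambda>v. - z v) S \<longleftrightarrow> balanced z S"
  unfolding balanced_def by (simp add: sum_negf)

text \<open>Coefficients are indexed by vertices, since several vertices may carry the same label.
  Identifying vertices adds the coefficients over each fibre; they are nonnegative, so nothing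
  cancels.\<close>

lemma balanced_image:
  assumes "finite S" "balanced (\<lambda>v. z (r v)) S"
  shows "balanced z (r ` S)"
proof -
  obtain c u where c: "\<forall>v\<in>S. 0 \<le> c v" "u \<in> S" "c u \<noteq> 0" "(\<Sum>v\<in>S. c v *\<^sub>R z (r v)) = 0"
    using assms(2) unfolding balanced_def by blast
  define k where "k y = (\<Sum>v\<in>{v\<in>S. r v = y}. c v)" for y
  have "(\<Sum>y\<in>r`S. k y *\<^sub>R z y) = (\<Sum>y\<in>r`S. \<Sum>v\<in>{v\<in>S. r v = y}. c v *\<^sub>R z (r v))"
    unfolding k_def by (auto simp: scaleR_sum_left intro!: sum.cong)
  also have "\<dots> = 0"
    using c(4) sum.image_gen[OF assms(1), of "\<lambda>v. c v *\<^sub>R z (r v)" r] by simp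
  finally have *: "(\<Sum>y\<in>r`S. k y *\<^sub>R z y) = 0" .
  have "k (r u) \<ge> c u"
    unfolding k_def using c assms(1) by (intro member_le_sum) auto
  moreover have "c u > 0" using c by force
  ultimately have "k (r u) \<noteq> 0" by linarith
  then show ?thesis
    using c * by (intro balancedI[of _ k "r u"]) (auto simp: k_def intro!: sum_nonneg)
qed

lemma balanced_image_iff:
  assumes "finite S" "inj_on r S"
  shows "balanced z (r ` S) \<longleftrightarrow> balanced (\<lambda>v. z (r v)) S"
proof
  assume "balanced z (r ` S)"
  then obtain c u where "\<forall>v\<in>r ` S. 0 \<le> c v" "u \<in> S" "c (r u) \<noteq> 0" "(\<Sum>v\<in>r ` S. c v *\<^sub>R z v) = 0"
    unfolding balanced_def by blast
  then show "balanced (\<lambda>v. z (r v)) S"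
    by (intro balancedI[of S "\<lambda>v. c (r v)" u]) (auto simp: sum.reindex[OF assms(2)])
qed (use assms balanced_image in blast)

text \<open>\<open>dependent\<close> concerns sets of vectors, so a repeated vector is a case of its
  own, with the relation 1, -1.\<close>

lemma family_dependent:
  fixes z :: "'v \<Rightarrow> 'w::euclidean_space"
  assumes "finite S" "z ` S \<subseteq> W" "dim W < card S"
  shows "\<exists>k. (\<exists>v\<in>S. k v \<noteq> 0) \<and> (\<Sum>v\<in>S. k v *\<^sub>R z v) = 0"
proof (cases "inj_on z S")
  case False
  then obtain a b where ab: "a \<in> S" "b \<in> S" "a \<noteq> b" "z a = z b" unfolding inj_on_def by blast
  define k :: "'v \<Rightarrow> real" where "k v = (if v = a then 1 else if v = b then -1 else 0)" for v
  have "(\<Sum>v\<in>S. k v *\<^sub>R z v) = (\<Sum>v\<in>{a,b}. k v *\<^sub>R z v)"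
    using assms(1) ab by (intro sum.mono_neutral_right) (auto simp: k_def)
  also have "\<dots> = 0" using ab by (simp add: k_def)
  finally show ?thesis using ab by (intro exI[of _ k]) (auto simp: k_def)
next
  case True
  have "dependent (z ` S)"
    using independent_card_le_dim[OF assms(2)] assms(3) True by (auto simp: card_image)
  then obtain k where "\<exists>v\<in>z ` S. k v \<noteq> 0" "(\<Sum>v\<in>z ` S. k v *\<^sub>R v) = 0"
    using dependent_finite[of "z ` S"] assms(1) by auto
  then show ?thesis
    by (intro exI[of _ "\<lambda>v. k (z v)"]) (auto simp: sum.reindex[OF True])
qed

text \<open>The nonnegative relations among the vectors, up to scaling, form a segment,
  and the balanced sets of size \<open>dim W + 1\<close> are the supports of its two end points.\<close>

lemma even_card_balanced:
  fixes z :: "'v \<Rightarrow> 'w::euclidean_space"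
  assumes fin: "finite U" and cU: "card U = dim W + 2" and zW: "z ` U \<subseteq> W"
    and nb: "\<And>a b. a \<in> U \<Longrightarrow> b \<in> U \<Longrightarrow> a \<noteq> b \<Longrightarrow> \<not> balanced z (U - {a, b})"
  shows "even (card {u\<in>U. balanced z (U - {u})})"
proof (cases "\<exists>u\<in>U. balanced z (U - {u})")
  case False
  then have "{u\<in>U. balanced z (U - {u})} = {}" by blast
  then show ?thesis by (metis card.empty even_zero)
next
  case True
  define ker where "ker c \<longleftrightarrow> (\<Sum>v\<in>U. c v *\<^sub>R z v) = 0" for c :: "'v \<Rightarrow> real"
  have ker_lin: "ker (\<lambda>v. p v + m * q v)" if "ker p" "ker q" for p q m
    using that unfolding ker_def
    by (simp add: scaleR_add_left sum.distrib flip: scaleR_scaleR scaleR_sum_right)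
  have ker_restr: "(\<Sum>v\<in>U-X. c v *\<^sub>R z v) = 0" if "ker c" "\<forall>v\<in>X. c v = 0" for c X
  proof -
    have "(\<Sum>v\<in>U-X. c v *\<^sub>R z v) = (\<Sum>v\<in>U. c v *\<^sub>R z v)"
      using fin that(2) by (intro sum.mono_neutral_left) auto
    then show ?thesis using that(1) by (simp add: ker_def)
  qed
  have ker_ext: "ker (\<lambda>v. if v \<in> X then 0 else c v)" if "(\<Sum>v\<in>U-X. c v *\<^sub>R z v) = 0" for c X
  proof -
    have "(\<Sum>v\<in>U. (if v \<in> X then 0 else c v) *\<^sub>R z v) = (\<Sum>v\<in>U-X. c v *\<^sub>R z v)"
      using fin by (intro sum.mono_neutral_cong_right) auto
    then show ?thesis using that by (simp add: ker_def)
  qed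
  \<comment> \<open>A nonnegative nontrivial relation has at most one zero: two zeros would leave a
    balanced set excluded by \<open>nb\<close>.\<close>
  have P: "a = b" if prem: "ker c" "\<forall>v\<in>U. 0 \<le> c v" "\<exists>v\<in>U. c v \<noteq> 0" "a \<in> U" "b \<in> U" "c a = 0" "c b = 0"
    for c a b
  proof (rule ccontr)
    assume "a \<noteq> b"
    obtain w where "w \<in> U" "c w \<noteq> 0" using prem(3) by blast
    then have "balanced z (U - {a,b})"
      using prem ker_restr[of c "{a,b}"] by (intro balancedI[of _ c w]) auto
    then show False using nb prem \<open>a \<noteq> b\<close> by blast
  qed
  obtain u where u: "u \<in> U" "balanced z (U - {u})" using True by blast
  then obtain c0 w where c0: "\<forall>v\<in>U-{u}. 0 \<le> c0 v" "w \<in> U - {u}" "c0 w \<noteq> 0"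
      "(\<Sum>v\<in>U-{u}. c0 v *\<^sub>R z v) = 0"
    unfolding balanced_def by blast
  define c where "c v = (if v \<in> {u} then 0 else c0 v)" for v
  have c: "ker c" "\<forall>v\<in>U. 0 \<le> c v" "c u = 0" "\<exists>v\<in>U. c v \<noteq> 0"
    using c0 ker_ext[of c0 "{u}"] by (auto simp: c_def[abs_def])
  have cpos: "c v > 0" if "v \<in> U" "v \<noteq> u" for v
    using P[OF c(1,2,4) that(1) u(1)] c that by (metis order_less_le)
  have fU: "finite (U - {u})" "U - {u} \<noteq> {}" using fin c0 by auto
  \<comment> \<open>The relations vanishing at \<open>u\<close> are the multiples of
    \<open>c\<close>: subtracting the least ratio times \<open>c\<close> leaves a nonnegative
    relation with zeros at \<open>u\<close> and at the minimiser \<open>v1\<close>, which is trivial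
    by \<open>P\<close>.\<close>
  have M: "\<exists>l. \<forall>v\<in>U. k v = l * c v" if k: "ker k" "k u = 0" for k
  proof -
    define l where "l = Min ((\<lambda>v. k v / c v) ` (U - {u}))"
    have "l \<in> (\<lambda>v. k v / c v) ` (U - {u})" unfolding l_def using fU by (intro Min_in) auto
    then obtain v1 where v1: "v1 \<in> U" "v1 \<noteq> u" "l = k v1 / c v1" by auto
    have le: "l \<le> k v / c v" if "v \<in> U" "v \<noteq> u" for v
      unfolding l_def using fU that by (intro Min_le) auto
    have "ker (\<lambda>v. k v + (-l) * c v)" using ker_lin[OF k(1) c(1)] .
    moreover have "\<forall>v\<in>U. 0 \<le> k v + (-l) * c v"
    proof
      fix v assume "v \<in> U"
      show "0 \<le> k v + (-l) * c v"
        using le[of v] cpos[of v] \<open>v \<in> U\<close> k c by (cases "v = u") (auto simp: field_simps)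
    qed
    ultimately have "\<not> (\<exists>v\<in>U. k v + (-l) * c v \<noteq> 0)"
      using P[of "\<lambda>v. k v + (-l) * c v" u v1] u v1 k c cpos[of v1] by fastforce
    then show ?thesis by (intro exI[of _ l]) auto
  qed
  \<comment> \<open>A dimension count gives a nontrivial relation vanishing at \<open>w\<close>. It
    is no multiple of \<open>c\<close>, since \<open>c w > 0\<close>, and so cannot vanish at
    \<open>u\<close>.\<close>
  have "card (U - {w}) = dim W + 1" using cU c0(2) fin by simp
  then obtain k0 w' where k0: "w' \<in> U - {w}" "k0 w' \<noteq> 0" "(\<Sum>v\<in>U-{w}. k0 v *\<^sub>R z v) = 0"
    using family_dependent[of "U - {w}" z W] fin zW by auto
  define k1 where "k1 v = (if v \<in> {w} then 0 else k0 v)" for v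
  have k1: "ker k1" "k1 w = 0" "k1 w' \<noteq> 0" "w' \<in> U" "w \<in> U"
    using k0 c0 ker_ext[of k0 "{w}"] by (auto simp: k1_def[abs_def])
  have "k1 u \<noteq> 0"
  proof
    assume "k1 u = 0"
    then obtain l where l: "\<forall>v\<in>U. k1 v = l * c v" using M k1 by blast
    then have "l = 0" using k1 cpos[of w] c0 by force
    then show False using l k1 by auto
  qed
  define k where "k v = 0 + (1 / k1 u) * k1 v" for v
  have k: "ker k" "k u = 1"
    using ker_lin[of "\<lambda>_. 0" k1 "1 / k1 u"] k1 \<open>k1 u \<noteq> 0\<close> by (auto simp: k_def[abs_def] ker_def)
  \<comment> \<open>The least \<open>l\<close> that makes \<open>k + l c\<close> nonnegative. This
    gives the other end point \<open>e\<close> of the segment, and \<open>i\<close> is where it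
    vanishes.\<close>
  define l where "l = Max ((\<lambda>v. - k v / c v) ` (U - {u}))"
  have "l \<in> (\<lambda>v. - k v / c v) ` (U - {u})" unfolding l_def using fU by (intro Max_in) auto
  then obtain i where i: "i \<in> U" "i \<noteq> u" "l = - k i / c i" by auto
  have le: "- k v / c v \<le> l" if "v \<in> U" "v \<noteq> u" for v
    unfolding l_def using fU that by (intro Max_ge) auto
  define e where "e v = k v + l * c v" for v
  have eker: "ker e" unfolding e_def[abs_def] by (rule ker_lin[OF k(1) c(1)])
  have e0: "\<forall>v\<in>U. 0 \<le> e v"
  proof
    fix v assume "v \<in> U"
    show "0 \<le> e v"
    proof (cases "v = u")
      case False
      then have "- k v \<le> l * c v" using le[of v] cpos[of v] \<open>v \<in> U\<close> by (simp add: field_simps)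
      then show ?thesis by (simp add: e_def)
    qed (simp add: e_def k c)
  qed
  have e: "e u = 1" "e i = 0" using k c i cpos[of i] by (auto simp: e_def)
  have balI: "balanced z (U - {i})"
    using ker_restr[OF eker, of "{i}"] e e0 i u by (intro balancedI[of _ e u]) auto
  \<comment> \<open>Take a relation \<open>f\<close> supported off \<open>u'\<close>. Subtracting
    \<open>f u\<close> times \<open>e\<close> leaves a multiple \<open>m\<close> of
    \<open>c\<close>. Evaluation at \<open>i\<close> gives \<open>m \<ge> 0\<close>, and evaluation
    at \<open>u'\<close> then gives \<open>e u' \<le> 0\<close>, so \<open>u'\<close> is the zero of
    \<open>e\<close>.\<close>
  have "u' = i" if u': "u' \<in> U" "balanced z (U - {u'})" "u' \<noteq> u" for u'
  proof -
    obtain f0 x where f0: "\<forall>v\<in>U-{u'}. 0 \<le> f0 v" "x \<in> U - {u'}" "f0 x \<noteq> 0"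
      "(\<Sum>v\<in>U-{u'}. f0 v *\<^sub>R z v) = 0"
      using u'(2) unfolding balanced_def by blast
    define f where "f v = (if v \<in> {u'} then 0 else f0 v)" for v
    have f: "ker f" "\<forall>v\<in>U. 0 \<le> f v" "f u' = 0" "\<exists>v\<in>U. f v \<noteq> 0"
      using f0 ker_ext[of f0 "{u'}"] by (auto simp: f_def[abs_def])
    have fu: "f u > 0" using P[OF f(1,2,4) u'(1) u(1) f(3)] u' u f(2) by (metis order_less_le)
    have "ker (\<lambda>v. f v + (- f u) * e v)" using ker_lin[OF f(1) eker] .
    then obtain m where m: "\<forall>v\<in>U. f v + (- f u) * e v = m * c v"
      using M[of "\<lambda>v. f v + (- f u) * e v"] e by auto
    have "f i = m * c i" using m i e by auto
    then have "m \<ge> 0" using f(2) i cpos[of i] by (metis zero_le_mult_iff linorder_not_le)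
    moreover have "- f u * e u' = m * c u'" using m u' f by auto
    ultimately have "f u * e u' \<le> 0" using cpos[of u'] u'
      by (metis minus_mult_left neg_le_0_iff_le minus_minus less_imp_le mult_nonneg_nonneg)
    then have "e u' = 0" using fu e0 u'(1) by (metis mult_pos_pos order_le_less linorder_not_le)
    then show ?thesis using P[OF eker e0 _ u'(1) i(1)] e u by force
  qed
  then have "{u\<in>U. balanced z (U - {u})} = {u, i}" using u i balI by blast
  then show ?thesis using i by simp
qed

section \<open>Counting balanced simplices modulo 8\<close>


lemma balanced_remove_generic:
  assumes "balanced z (insert p S)" "p \<notin> S" "finite S" "z p \<notin> span (z ` S)"
  shows "balanced z S"
proof -
  obtain c u where c: "\<forall>v\<in>insert p S. 0 \<le> c v" "u \<in> insert p S" "c u \<noteq> 0"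
      "(\<Sum>v\<in>insert p S. c v *\<^sub>R z v) = 0"
    using assms(1) unfolding balanced_def by blast
  have sum: "c p *\<^sub>R z p + (\<Sum>v\<in>S. c v *\<^sub>R z v) = 0" using c(4) assms by simp
  have in_span: "(\<Sum>v\<in>S. c v *\<^sub>R z v) \<in> span (z ` S)"
    by (intro span_sum span_scale span_base) auto
  have "c p = 0"
  proof (rule ccontr)
    assume "c p \<noteq> 0"
    have "c p *\<^sub>R z p = - (\<Sum>v\<in>S. c v *\<^sub>R z v)" using sum by (simp add: eq_neg_iff_add_eq_0)
    then have "(1 / c p) *\<^sub>R c p *\<^sub>R z p \<in> span (z ` S)"
      using in_span by (metis span_scale span_neg)
    then show False using assms(4) \<open>c p \<noteq> 0\<close> by simp
  qed
  then show ?thesis using c sum by (intro balancedI[of S c u]) auto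
qed

definition odd_labelling ::
  "nat set set \<Rightarrow> (nat \<Rightarrow> nat) \<Rightarrow> (nat \<Rightarrow> nat) \<Rightarrow> (nat \<Rightarrow> 'w::real_vector) \<Rightarrow> bool" where
  "odd_labelling F g h z \<longleftrightarrow> (\<forall>v\<in>\<Union>F. z (g v) = - z v \<and> z (h v) = - z v)"

text \<open>It is enough to test facets: by \<open>balanced_mono\<close> a smaller balanced face
  would make a facet balanced.\<close>

definition generic_labelling :: "nat set set \<Rightarrow> (nat \<Rightarrow> 'w::real_vector) \<Rightarrow> bool" where
  "generic_labelling F z \<longleftrightarrow> (\<forall>s\<in>F. \<forall>v\<in>s. \<not> balanced z (s - {v}))"

definition num_balanced :: "nat set set \<Rightarrow> (nat \<Rightarrow> 'w::real_vector) \<Rightarrow> nat" where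
  "num_balanced F z = card {s\<in>F. balanced z s}"

definition relabel_orbit ::
  "(nat \<Rightarrow> nat) \<Rightarrow> (nat \<Rightarrow> nat) \<Rightarrow> nat \<Rightarrow> 'w \<Rightarrow> (nat \<Rightarrow> 'w::real_vector) \<Rightarrow> nat \<Rightarrow> 'w" where
  "relabel_orbit g h p w z v =
     (if v \<in> {p, g (h p)} then w else if v \<in> {g p, h p} then - w else z v)"

text \<open>Only the top-dimensional simplices are recorded. \<open>rk\<close> is a proper colouring
  preserved by the action, and \<open>even_facet\<close> says that the simplices form a cycle modulo
  2. Vertices are natural numbers so that a subdivision is a complex of the same type.\<close>

locale graded_complex =
  fixes n :: nat and F :: "nat set set" and g h rk :: "nat \<Rightarrow> nat"
  assumes n_pos: "0 < n"
    and finite_F: "finite F"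
    and rk_bij: "s \<in> F \<Longrightarrow> bij_betw rk s {..n}"
    and even_facet: "s \<in> F \<Longrightarrow> v \<in> s \<Longrightarrow> even (card {t\<in>F. s - {v} \<subseteq> t})"
    and gg [simp]: "g (g v) = v" and hh [simp]: "h (h v) = v" and gh: "g (h v) = h (g v)"
    and rk_g [simp]: "rk (g v) = rk v" and rk_h [simp]: "rk (h v) = rk v"
    and g_F: "s \<in> F \<Longrightarrow> g ` s \<in> F" and h_F: "s \<in> F \<Longrightarrow> h ` s \<in> F"
    and free: "v \<in> \<Union>F \<Longrightarrow> g v \<noteq> v \<and> h v \<noteq> v \<and> g (h v) \<noteq> v"
begin

lemma finite_simplex: "s \<in> F \<Longrightarrow> finite s"
  using rk_bij bij_betw_finite by blast

lemma card_simplex: "s \<in> F \<Longrightarrow> card s = n + 1"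
  using rk_bij bij_betw_same_card by fastforce

lemma finite_verts: "finite (\<Union>F)"
  using finite_F finite_simplex by blast

lemma rk_inj: "s \<in> F \<Longrightarrow> u \<in> s \<Longrightarrow> v \<in> s \<Longrightarrow> rk u = rk v \<Longrightarrow> u = v"
  using rk_bij by (meson bij_betw_def inj_onD)

lemma inj_g: "inj_on g S" and inj_h: "inj_on h S"
  by (metis gg inj_onI) (metis hh inj_onI)

lemma g_verts: "v \<in> \<Union>F \<Longrightarrow> g v \<in> \<Union>F" and h_verts: "v \<in> \<Union>F \<Longrightarrow> h v \<in> \<Union>F"
  using g_F h_F by blast+

lemma card_balanced_symmetric:
  assumes f: "\<And>v. f (f v) = v" "\<And>s. s \<in> F \<Longrightarrow> f ` s \<in> F" and z: "\<And>v. v \<in> \<Union>F \<Longrightarrow> z (f v) = - z v"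
  shows "card {s\<in>F. f v \<in> s \<and> balanced z s} = card {s\<in>F. v \<in> s \<and> balanced z s}"
proof -
  have bal: "balanced z (f ` s) \<longleftrightarrow> balanced z s" if "s \<in> F" for s
  proof -
    have "balanced z (f ` s) \<longleftrightarrow> balanced (\<lambda>v. z (f v)) s"
      using that by (intro balanced_image_iff finite_simplex inj_on_inverseI[of _ f] f(1))
    also have "\<dots> \<longleftrightarrow> balanced (\<lambda>v. - z v) s"
      using z that by (intro balanced_cong) blast
    finally show ?thesis by (simp add: balanced_uminus)
  qed
  have "bij_betw ((`) f) {s\<in>F. f v \<in> s \<and> balanced z s} {s\<in>F. v \<in> s \<and> balanced z s}"
    by (rule bij_betwI[where g = "(`) f"]) (auto simp: bal f image_image image_iff intro: f(1)[symmetric])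
  then show ?thesis by (rule bij_betw_same_card)
qed

lemma orbit_distinct:
  assumes "p \<in> \<Union>F"
  shows "g p \<noteq> p" "h p \<noteq> p" "g (h p) \<noteq> p" "g p \<noteq> h p" "g p \<noteq> g (h p)" "h p \<noteq> g (h p)"
proof -
  show "g p \<noteq> p" "h p \<noteq> p" "g (h p) \<noteq> p" using free[OF assms] by auto
  show "g p \<noteq> h p" using \<open>g (h p) \<noteq> p\<close> gg by metis
  show "g p \<noteq> g (h p)" using \<open>h p \<noteq> p\<close> gg by metis
  show "h p \<noteq> g (h p)" using free[OF h_verts[OF assms]] by auto
qed

text \<open>The four vertices of an orbit have the same rank, so a simplex contains at most one of
  them; the symmetries make the four counts equal.\<close>

lemma num_balanced_orbit:
  assumes "odd_labelling F g h z" "p \<in> \<Union>F"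
  shows "num_balanced F z =
           card {s\<in>F. s \<inter> {p, g p, h p, g (h p)} = {} \<and> balanced z s} +
           4 * card {s\<in>F. p \<in> s \<and> balanced z s}"
proof -
  define N where "N v = {s\<in>F. v \<in> s \<and> balanced z s}" for v
  define Z where "Z = {s\<in>F. s \<inter> {p, g p, h p, g (h p)} = {} \<and> balanced z s}"
  have fin: "finite (N v)" "finite Z" for v unfolding N_def Z_def using finite_F by auto
  have disj: "N u \<inter> N v = {}" if "u \<noteq> v" "rk u = rk v" for u v
    unfolding N_def using rk_inj that by blast
  note ne = orbit_distinct[OF assms(2)]
  have "{s\<in>F. balanced z s} = Z \<union> (N p \<union> (N (g p) \<union> (N (h p) \<union> N (g (h p)))))"
    unfolding N_def Z_def by auto
  moreover have "Z \<inter> (N p \<union> (N (g p) \<union> (N (h p) \<union> N (g (h p))))) = {}"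
    unfolding N_def Z_def by auto
  moreover have "N p \<inter> (N (g p) \<union> (N (h p) \<union> N (g (h p)))) = {}"
    "N (g p) \<inter> (N (h p) \<union> N (g (h p))) = {}" "N (h p) \<inter> N (g (h p)) = {}"
    using disj[of p] disj[of "g p"] disj[of "h p" "g (h p)"] ne by (simp_all add: Int_Un_distrib)
  ultimately have "num_balanced F z = card Z + (card (N p) + (card (N (g p)) + (card (N (h p)) + card (N (g (h p))))))"
    unfolding num_balanced_def using fin by (simp add: card_Un_disjoint)
  moreover have "card (N (g p)) = card (N p)" "card (N (h p)) = card (N p)" "card (N (g (h p))) = card (N p)"
    using card_balanced_symmetric[of g z] card_balanced_symmetric[of h z] assms(1) g_F h_F
    unfolding N_def odd_labelling_def by auto
  ultimately show ?thesis unfolding Z_def N_def by simp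
qed

text \<open>Join every simplex of the star of \<open>p\<close> with a new vertex labelled \<open>w\<close>. By the parity of
  balanced facets of these joins, the two numbers of balanced simplices differ modulo 2 by the number of
  balanced cones over the facets containing \<open>p\<close>, and each facet lies in evenly many simplices.\<close>

lemma even_star_change:
  fixes z :: "nat \<Rightarrow> 'w::euclidean_space"
  assumes gen: "generic_labelling F z" and W: "dim W = n" "z ` \<Union>F \<subseteq> W" "w \<in> W"
    and w: "\<And>s a b. s \<in> F \<Longrightarrow> a \<in> s \<Longrightarrow> b \<in> s \<Longrightarrow> a \<noteq> b \<Longrightarrow> w \<notin> span (z ` (s - {a, b}))"
  shows "even (card {s\<in>F. p \<in> s \<and> balanced z s} + card {s\<in>F. p \<in> s \<and> balanced (z(p := w)) s})"
proof -
  \<comment> \<open>The extra vertex \<open>q\<close> carries the new label, so that the old and the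
    new label of \<open>p\<close> occur in one family.\<close>
  obtain q where q: "q \<notin> \<Union>F" using finite_verts ex_new_if_finite infinite_UNIV_nat by blast
  define y where "y = z(q := w)"
  define Fp where "Fp = {s\<in>F. p \<in> s}"
  have finFp: "finite Fp" using finite_F by (simp add: Fp_def)
  have y_old: "balanced y S \<longleftrightarrow> balanced z S" if "S \<subseteq> s" "s \<in> F" for S s
    using that q by (intro balanced_cong) (auto simp: y_def)
  have star: "even (card {u\<in>insert q s. balanced y (insert q s - {u})})" if s: "s \<in> F" for s
  proof (rule even_card_balanced[where W = W])
    have qs: "q \<notin> s" using q s by blast
    show "finite (insert q s)" using finite_simplex s by simp
    show "card (insert q s) = dim W + 2" using qs finite_simplex card_simplex s W by simp
    show "y ` insert q s \<subseteq> W" using W s by (auto simp: y_def)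
    have old: "\<not> balanced y (s - {a})" if "a \<in> s" for a
      using gen s that y_old[of "s - {a}" s] by (auto simp: generic_labelling_def)
    \<comment> \<open>If \<open>q\<close> is removed, a facet of \<open>s\<close> is left, which is
      unbalanced by genericity. Otherwise the position of \<open>w\<close> forces the coefficient 0
      at \<open>q\<close>, and a face of \<open>s\<close> would be balanced.\<close>
    fix a b assume ab: "a \<in> insert q s" "b \<in> insert q s" "a \<noteq> b"
    show "\<not> balanced y (insert q s - {a, b})"
    proof (cases "q \<in> {a, b}")
      case True
      then obtain e where "e \<in> s" "insert q s - {a, b} = s - {e}" using ab qs by auto
      then show ?thesis using old by simp
    next
      case False
      then have ab': "a \<in> s" "b \<in> s" using ab by auto
      have *: "insert q s - {a, b} = insert q (s - {a, b})" using False by auto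
      have im: "y ` (s - {a, b}) = z ` (s - {a, b})" using qs by (auto simp: y_def)
      have "y q \<notin> span (y ` (s - {a, b}))"
        unfolding im using w[OF s ab' ab(3)] by (simp add: y_def)
      then have "balanced y (s - {a, b})" if "balanced y (insert q (s - {a, b}))"
        using balanced_remove_generic[OF that] finite_simplex s qs by simp
      moreover have "balanced y (s - {a})" if "balanced y (s - {a, b})"
        using balanced_mono[OF that, of "s - {a}"] finite_simplex s by blast
      ultimately show ?thesis using old ab' * by auto
    qed
  qed
  define Q where "Q f \<longleftrightarrow> balanced y (insert q f)" for f
  \<comment> \<open>Removing \<open>q\<close> leaves \<open>s\<close> with its old labels; removing
    \<open>p\<close> leaves \<open>s\<close> with \<open>q\<close> in the place of \<open>p\<close>,
    that is, with the new labels; every other removal leaves a cone from \<open>q\<close> over a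
    facet containing \<open>p\<close>.\<close>
  have count: "card {u\<in>insert q s. balanced y (insert q s - {u})} =
      of_bool (balanced z s) + of_bool (balanced (z(p := w)) s) + card {u\<in>s - {p}. Q (s - {u})}"
    if s: "s \<in> Fp" for s
  proof -
    have sF: "s \<in> F" "p \<in> s" "q \<notin> s" "finite s" using s q finite_simplex by (auto simp: Fp_def)
    define r where "r v = (if v = p then q else v)" for v
    have r: "inj_on r s" "r ` s = insert q (s - {p})" using sF by (auto simp: inj_on_def r_def)
    have bq: "balanced y (insert q s - {q}) \<longleftrightarrow> balanced z s"
      using sF y_old[of s s] by simp
    have "balanced y (insert q (s - {p})) \<longleftrightarrow> balanced (\<lambda>v. y (r v)) s"
      using balanced_image_iff[OF sF(4) r(1), of y] r(2) by simp
    also have "\<dots> \<longleftrightarrow> balanced (z(p := w)) s"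
      using sF by (intro balanced_cong) (auto simp: y_def r_def)
    finally have bp: "balanced y (insert q (s - {p})) \<longleftrightarrow> balanced (z(p := w)) s" .
    have "{u\<in>insert q s. balanced y (insert q s - {u})} =
        {u\<in>{q}. balanced z s} \<union> ({u\<in>{p}. balanced (z(p := w)) s} \<union> {u\<in>s - {p}. Q (s - {u})})"
    proof -
      have "balanced y (insert q s - {u}) \<longleftrightarrow> Q (s - {u})" if "u \<in> s" for u
        using that sF by (auto simp: Q_def insert_Diff_if)
      moreover have "Q (s - {p}) \<longleftrightarrow> balanced (z(p := w)) s" using bp by (simp add: Q_def)
      ultimately show ?thesis using bq sF by auto
    qed
    moreover have "card ({u\<in>{q}. balanced z s} \<union> ({u\<in>{p}. balanced (z(p := w)) s} \<union> {u\<in>s - {p}. Q (s - {u})}))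
        = card {u\<in>{q}. balanced z s} + (card {u\<in>{p}. balanced (z(p := w)) s} + card {u\<in>s - {p}. Q (s - {u})})"
      using sF by (subst card_Un_disjoint, auto, subst card_Un_disjoint, auto)
    ultimately show ?thesis by auto
  qed
  \<comment> \<open>Grouped by the facet \<open>s - {u}\<close>, these pairs fall into groups of
    even size, by \<open>even_facet\<close>.\<close>
  define D where "D = (SIGMA s:Fp. {u\<in>s - {p}. Q (s - {u})})"
  have finD: "finite D" unfolding D_def using finFp finite_simplex by (auto simp: Fp_def)
  have "even (\<Sum>x\<in>{x\<in>D. (\<lambda>(s,u). s - {u}) x = f}. 1 :: nat)" if f: "f \<in> (\<lambda>(s,u). s - {u}) ` D" for f
  proof -
    obtain s u where su: "s \<in> F" "p \<in> s" "u \<in> s" "u \<noteq> p" "Q f" "f = s - {u}"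
      using f by (auto simp: D_def Fp_def)
    have "bij_betw fst {x\<in>D. (\<lambda>(s,u). s - {u}) x = f} {t\<in>F. f \<subseteq> t}"
      unfolding bij_betw_def
    proof
      show "inj_on fst {x\<in>D. (\<lambda>(s,u). s - {u}) x = f}"
        by (rule inj_onI) (auto simp: D_def)
      show "fst ` {x\<in>D. (\<lambda>(s,u). s - {u}) x = f} = {t\<in>F. f \<subseteq> t}"
      proof (intro equalityI subsetI)
        fix t assume "t \<in> {t\<in>F. f \<subseteq> t}"
        then have t: "t \<in> F" "f \<subseteq> t" by auto
        have "card f = n" using su card_simplex finite_simplex by simp
        then have "card (t - f) = 1"
          using t card_simplex finite_simplex by (simp add: card_Diff_subset finite_subset)
        then obtain u' where u': "t - f = {u'}" by (auto simp: card_1_singleton_iff)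
        then have "t - {u'} = f" "u' \<in> t" "u' \<noteq> p" using t su by auto
        then have "(t, u') \<in> {x\<in>D. (\<lambda>(s,u). s - {u}) x = f}"
          using t su by (auto simp: D_def Fp_def)
        then show "t \<in> fst ` {x\<in>D. (\<lambda>(s,u). s - {u}) x = f}" by force
      qed (auto simp: D_def Fp_def)
    qed
    then have "card {x\<in>D. (\<lambda>(s,u). s - {u}) x = f} = card {t\<in>F. f \<subseteq> t}"
      by (rule bij_betw_same_card)
    then show ?thesis using even_facet[OF su(1,3)] su(6) by simp
  qed
  then have "even (\<Sum>f\<in>(\<lambda>(s,u). s - {u}) ` D. \<Sum>x\<in>{x\<in>D. (\<lambda>(s,u). s - {u}) x = f}. 1 :: nat)"
    by (rule dvd_sum)
  then have "even (\<Sum>x\<in>D. 1 :: nat)"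
    using sum.image_gen[OF finD, of "\<lambda>_. 1 :: nat" "\<lambda>(s,u). s - {u}"] by simp
  then have evD: "even (\<Sum>s\<in>Fp. card {u\<in>s - {p}. Q (s - {u})})"
    unfolding D_def using finFp finite_simplex by (simp add: Fp_def)
  have "even (\<Sum>s\<in>Fp. card {u\<in>insert q s. balanced y (insert q s - {u})})"
    using star by (intro dvd_sum) (auto simp: Fp_def)
  then have "even ((\<Sum>s\<in>Fp. of_bool (balanced z s)) + (\<Sum>s\<in>Fp. of_bool (balanced (z(p := w)) s)) +
      (\<Sum>s\<in>Fp. card {u\<in>s - {p}. Q (s - {u})}))"
    unfolding sum.distrib[symmetric] by (subst sum.cong[OF refl count[symmetric]]) auto
  then have "even ((\<Sum>s\<in>Fp. of_bool (balanced z s)) + (\<Sum>s\<in>Fp. of_bool (balanced (z(p := w)) s) :: nat))"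
    using evD by simp
  moreover have "(\<Sum>s\<in>Fp. of_bool (P s) :: nat) = card {s\<in>F. p \<in> s \<and> P s}" for P
    using finFp by (simp add: Fp_def sum_of_bool_eq Int_def conj_assoc)
  ultimately show ?thesis by simp
qed

text \<open>After the move, a facet through the moved vertex consists of that vertex and a simplex
  with two vertices removed. Since \<open>w\<close> avoids the span of the latter's labels, the
  facet stays unbalanced. The count changes by four times the even change at
  \<open>p\<close>.\<close>

lemma relabel_orbit:
  fixes z :: "nat \<Rightarrow> 'w::euclidean_space"
  assumes odd: "odd_labelling F g h z" and gen: "generic_labelling F z"
    and W: "dim W = n" "z ` \<Union>F \<subseteq> W" "w \<in> W" and p: "p \<in> \<Union>F"
    and w: "\<And>s a b. s \<in> F \<Longrightarrow> a \<in> s \<Longrightarrow> b \<in> s \<Longrightarrow> a \<noteq> b \<Longrightarrow> w \<notin> span (z ` (s - {a, b}))"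
  shows "odd_labelling F g h (relabel_orbit g h p w z)"
    and "generic_labelling F (relabel_orbit g h p w z)"
    and "num_balanced F (relabel_orbit g h p w z) mod 8 = num_balanced F z mod 8"
proof -
  define y where "y = relabel_orbit g h p w z"
  define Orb where "Orb = {p, g p, h p, g (h p)}"
  note ne = orbit_distinct[OF p]
  have y: "y p = w" "y (g p) = - w" "y (h p) = - w" "y (g (h p)) = w"
    and y_old: "v \<notin> Orb \<Longrightarrow> y v = z v" for v
    using ne by (auto simp: y_def relabel_orbit_def Orb_def)
  have "g v \<in> Orb \<and> h v \<in> Orb" if "v \<in> Orb" for v
    using that unfolding Orb_def by (auto simp flip: gh)
  then have Orb_iff: "g v \<in> Orb \<longleftrightarrow> v \<in> Orb" "h v \<in> Orb \<longleftrightarrow> v \<in> Orb" for v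
    by (metis gg, metis hh)
  show y_odd: "odd_labelling F g h (relabel_orbit g h p w z)"
    unfolding odd_labelling_def y_def[symmetric]
  proof (intro ballI)
    fix v assume v: "v \<in> \<Union>F"
    show "y (g v) = - y v \<and> y (h v) = - y v"
    proof (cases "v \<in> Orb")
      case True
      have "g (g (h p)) = h p" "h (g (h p)) = g p" "h (g p) = g (h p)"
        by (metis gh gg hh)+
      then show ?thesis using True y unfolding Orb_def by auto
    next
      case False
      then show ?thesis using odd v y_old Orb_iff by (auto simp: odd_labelling_def)
    qed
  qed
  have Orb_unique: "u = v" if "u \<in> Orb" "v \<in> Orb" "u \<in> s" "v \<in> s" "s \<in> F" for u v s
    using that rk_inj[of s u v] unfolding Orb_def by auto
  show "generic_labelling F (relabel_orbit g h p w z)"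
    unfolding generic_labelling_def y_def[symmetric]
  proof (intro ballI notI)
    fix s a assume s: "s \<in> F" "a \<in> s" and bal: "balanced y (s - {a})"
    have zbal: "\<not> balanced z (s - {a})" using gen s by (simp add: generic_labelling_def)
    show False
    proof (cases "Orb \<inter> (s - {a}) = {}")
      case True
      then have "balanced y (s - {a}) \<longleftrightarrow> balanced z (s - {a})"
        by (intro balanced_cong y_old) auto
      then show False using bal zbal by simp
    next
      case False
      then obtain b where b: "b \<in> Orb" "b \<in> s" "b \<noteq> a" by auto
      have rest: "y v = z v" if "v \<in> s - {a, b}" for v
        using that b Orb_unique s y_old by (metis Diff_iff insertCI)
      then have im: "y ` (s - {a, b}) = z ` (s - {a, b})" by (intro image_cong) auto
      \<comment> \<open>A span contains \<open>- w\<close> exactly if it contains \<open>w\<close>,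
        so the same condition serves all four vertices of the orbit.\<close>
      have "y b = w \<or> y b = - w" using b y unfolding Orb_def by auto
      then have "y b \<notin> span (y ` (s - {a, b}))"
        unfolding im using w[OF s b(2)] b(3) span_neg by (metis minus_minus)
      moreover have "s - {a} = insert b (s - {a, b})" using b by auto
      ultimately have "balanced y (s - {a, b})"
        using balanced_remove_generic[of y b "s - {a, b}"] bal finite_simplex s by simp
      then have "balanced z (s - {a, b})"
        using balanced_cong[of "s - {a, b}" y z] rest by blast
      then show False using zbal balanced_mono[of z "s - {a, b}" "s - {a}"] finite_simplex s by blast
    qed
  qed
  have "balanced y s \<longleftrightarrow> balanced z s" if "s \<inter> Orb = {}" for s
    using that by (intro balanced_cong y_old) auto
  then have Z: "{s\<in>F. s \<inter> Orb = {} \<and> balanced y s} = {s\<in>F. s \<inter> Orb = {} \<and> balanced z s}" by auto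
  have "balanced y s \<longleftrightarrow> balanced (z(p := w)) s" if "s \<in> F" "p \<in> s" for s
  proof (rule balanced_cong)
    fix v assume "v \<in> s"
    then show "y v = (z(p := w)) v"
      using that Orb_unique[of v p s] y y_old[of v] by (auto simp: Orb_def)
  qed
  then have P: "{s\<in>F. p \<in> s \<and> balanced y s} = {s\<in>F. p \<in> s \<and> balanced (z(p := w)) s}" by auto
  have A: "num_balanced F y = card {s\<in>F. s \<inter> Orb = {} \<and> balanced z s} +
      4 * card {s\<in>F. p \<in> s \<and> balanced (z(p := w)) s}"
    using num_balanced_orbit[OF y_odd[folded y_def] p] Z P by (simp add: Orb_def)
  have B: "num_balanced F z = card {s\<in>F. s \<inter> Orb = {} \<and> balanced z s} +
      4 * card {s\<in>F. p \<in> s \<and> balanced z s}"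
    using num_balanced_orbit[OF odd p] by (simp add: Orb_def)
  have C: "even (card {s\<in>F. p \<in> s \<and> balanced z s} + card {s\<in>F. p \<in> s \<and> balanced (z(p := w)) s})"
    by (rule even_star_change[OF gen W w])
  have mod8: "(a + 4 * b) mod 8 = (a + 4 * c) mod 8" if ev: "even (c + b)" for a b c :: nat
  proof (cases "even b")
    case True
    then obtain i j where "b = 2 * i" "c = 2 * j" using ev by (auto elim!: evenE)
    then have "a + 4 * b = a + i * 8" "a + 4 * c = a + j * 8" by auto
    then show ?thesis by (simp only: mod_mult_self1)
  next
    case False
    then obtain i j where "b = 2 * i + 1" "c = 2 * j + 1" using ev by (auto elim!: oddE)
    then have "a + 4 * b = (a + 4) + i * 8" "a + 4 * c = (a + 4) + j * 8" by auto
    then show ?thesis by (simp only: mod_mult_self1)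
  qed
  show "num_balanced F (relabel_orbit g h p w z) mod 8 = num_balanced F z mod 8"
    unfolding y_def[symmetric] A B by (rule mod8[OF C])
qed

end


section \<open>Perturbation to general position\<close>

lemma balanced_iff_0_in_hull:
  fixes y :: "'v \<Rightarrow> 'w::real_vector"
  assumes "finite S"
  shows "balanced y S \<longleftrightarrow> 0 \<in> convex hull (y ` S)"
proof
  assume "balanced y S"
  then obtain c u where c: "\<forall>v\<in>S. 0 \<le> c v" "u \<in> S" "c u \<noteq> 0" "(\<Sum>v\<in>S. c v *\<^sub>R y v) = 0"
    unfolding balanced_def by blast
  define t where "t = (\<Sum>v\<in>S. c v)"
  have "c u > 0" using c by force
  then have "t > 0" unfolding t_def using assms c by (intro sum_pos2) auto
  have "(\<Sum>v\<in>S. (c v / t) *\<^sub>R y v) \<in> convex hull (y ` S)"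
  proof (rule convex_sum[OF assms convex_convex_hull])
    show "(\<Sum>v\<in>S. c v / t) = 1" using \<open>t > 0\<close> by (simp add: t_def flip: sum_divide_distrib)
    show "c v / t \<ge> 0" if "v \<in> S" for v using c that \<open>t > 0\<close> by simp
    show "y v \<in> convex hull (y ` S)" if "v \<in> S" for v using that by (intro hull_inc) simp
  qed
  moreover have "(\<Sum>v\<in>S. (c v / t) *\<^sub>R y v) = (1 / t) *\<^sub>R (\<Sum>v\<in>S. c v *\<^sub>R y v)"
    by (simp add: scaleR_right.sum)
  ultimately show "0 \<in> convex hull (y ` S)" using c(4) by simp
next
  assume "0 \<in> convex hull (y ` S)"
  then obtain c where c: "\<forall>x\<in>y ` S. 0 \<le> c x" "sum c (y ` S) = 1" "(\<Sum>x\<in>y ` S. c x *\<^sub>R x) = 0"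
    using assms by (auto simp: convex_hull_finite)
  then obtain x where "x \<in> y ` S" "c x \<noteq> 0" by (metis sum.neutral zero_neq_one)
  then have bal: "balanced (\<lambda>x. x) (y ` S)" using c by (intro balancedI[of _ c x]) auto
  obtain S' where S': "S' \<subseteq> S" "inj_on y S'" "y ` S = y ` S'"
    using subset_image_inj[of "y ` S" y S] by auto
  then have "balanced y S'"
    using bal balanced_image_iff[of S' y "\<lambda>x. x"] assms finite_subset by fastforce
  then show "balanced y S" using balanced_mono S' assms by blast
qed

text \<open>The hull of the labels is compact and has a positive distance \<open>e\<close> from the
  origin. The coefficients of a relation for \<open>z\<close>, divided by their sum, would give a
  point of the hull for \<open>y\<close> of norm less than \<open>e\<close>.\<close>

lemma not_balanced_open:
  fixes y :: "'v \<Rightarrow> 'w::euclidean_space"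
  assumes "finite S" "\<not> balanced y S"
  shows "\<exists>e>0. \<forall>z. (\<forall>v\<in>S. dist (z v) (y v) < e) \<longrightarrow> \<not> balanced z S"
proof -
  have "closed (convex hull (y ` S))"
    using assms(1) by (intro compact_imp_closed finite_imp_compact_convex_hull) auto
  moreover have "0 \<notin> convex hull (y ` S)" using assms balanced_iff_0_in_hull by blast
  ultimately obtain e where e: "e > 0" "\<forall>q\<in>convex hull (y ` S). e \<le> dist 0 q"
    using separate_point_closed by blast
  have False if z: "\<forall>v\<in>S. dist (z v) (y v) < e" "balanced z S" for z
  proof -
    obtain c u where c: "\<forall>v\<in>S. 0 \<le> c v" "u \<in> S" "c u \<noteq> 0" "(\<Sum>v\<in>S. c v *\<^sub>R z v) = 0"
      using z(2) unfolding balanced_def by blast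
    define t where "t = (\<Sum>v\<in>S. c v)"
    have "c u > 0" using c by force
    then have "t > 0" unfolding t_def using assms c by (intro sum_pos2) auto
    have "(\<Sum>v\<in>S. (c v / t) *\<^sub>R y v) \<in> convex hull (y ` S)"
    proof (rule convex_sum[OF assms(1) convex_convex_hull])
      show "(\<Sum>v\<in>S. c v / t) = 1" using \<open>t > 0\<close> by (simp add: t_def flip: sum_divide_distrib)
      show "c v / t \<ge> 0" if "v \<in> S" for v using c that \<open>t > 0\<close> by simp
      show "y v \<in> convex hull (y ` S)" if "v \<in> S" for v using that by (intro hull_inc) simp
    qed
    then have "e \<le> norm (\<Sum>v\<in>S. (c v / t) *\<^sub>R y v)" using e by auto
    moreover have "(\<Sum>v\<in>S. (c v / t) *\<^sub>R y v) = (1 / t) *\<^sub>R (\<Sum>v\<in>S. c v *\<^sub>R y v)"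
      by (simp add: scaleR_right.sum)
    ultimately have "e * t \<le> norm (\<Sum>v\<in>S. c v *\<^sub>R y v)"
      using \<open>t > 0\<close> by (simp add: field_simps)
    also have "(\<Sum>v\<in>S. c v *\<^sub>R y v) = (\<Sum>v\<in>S. c v *\<^sub>R (y v - z v))"
      using c(4) by (simp add: scaleR_diff_right sum_subtractf)
    also have "norm \<dots> \<le> (\<Sum>v\<in>S. c v * dist (z v) (y v))"
      using c by (intro sum_norm_le) (auto simp: dist_norm norm_minus_commute)
    also have "\<dots> < (\<Sum>v\<in>S. c v * e)"
    proof (rule sum_strict_mono_ex1[OF assms(1)])
      show "\<forall>v\<in>S. c v * dist (z v) (y v) \<le> c v * e"
        using c z by (intro ballI mult_left_mono) auto
      show "\<exists>v\<in>S. c v * dist (z v) (y v) < c v * e"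
        using c(2) z(1) \<open>c u > 0\<close> by (intro bexI[of _ u] mult_strict_left_mono) auto
    qed
    also have "\<dots> = e * t" by (simp add: t_def sum_distrib_left mult.commute)
    finally show False by simp
  qed
  then show ?thesis using e(1) by blast
qed

text \<open>Induction on the number of subspaces: a point lying in the new one is moved a little in
  a direction of \<open>W\<close> outside it. The complements of the earlier ones are open, so a
  small move stays in them.\<close>

lemma near_point_avoiding_subspaces:
  fixes y :: "'w::euclidean_space"
  assumes W: "subspace W" "y \<in> W" and "finite \<U>" and "e > 0"
    and U: "\<And>U. U \<in> \<U> \<Longrightarrow> subspace U \<and> \<not> W \<subseteq> U"
  shows "\<exists>w\<in>W. dist w y < e \<and> (\<forall>U\<in>\<U>. w \<notin> U)"
  using \<open>finite \<U>\<close> U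
proof (induction \<U>)
  case empty
  then show ?case using W \<open>e > 0\<close> by (intro bexI[of _ y]) auto
next
  case (insert U \<U>)
  then obtain w where w: "w \<in> W" "dist w y < e" "\<forall>U\<in>\<U>. w \<notin> U" by auto
  show ?case
  proof (cases "w \<in> U")
    case False
    then show ?thesis using w by auto
  next
    case True
    have Uq: "subspace U" "\<not> W \<subseteq> U" using insert.prems[of U] by simp_all
    then obtain q where q: "q \<in> W" "q \<notin> U" by blast
    define N where "N = ball y e \<inter> (\<Inter>U\<in>\<U>. - U)"
    have "open (- U')" if "U' \<in> \<U>" for U'
      using insert.prems[of U'] that closed_subspace[of U'] by blast
    then have "open N" unfolding N_def
      by (intro open_Int open_ball open_INT insert.hyps(1) ballI)
    have "((\<lambda>r. w + r *\<^sub>R q) \<longlongrightarrow> w + 0 *\<^sub>R q) (at_right (0::real))"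
      by (intro tendsto_intros)
    moreover have "w + 0 *\<^sub>R q \<in> N" using w by (auto simp: N_def dist_commute)
    ultimately have "\<forall>\<^sub>F r in at_right (0::real). w + r *\<^sub>R q \<in> N"
      using \<open>open N\<close> topological_tendstoD by blast
    moreover have "\<forall>\<^sub>F r in at_right (0::real). r > 0" by (rule eventually_at_right_less)
    ultimately have "\<forall>\<^sub>F r in at_right (0::real). w + r *\<^sub>R q \<in> N \<and> r > 0"
      by (rule eventually_conj)
    then obtain r :: real where r: "w + r *\<^sub>R q \<in> N" "r > 0"
      using eventually_happens' trivial_limit_at_right_real by blast
    have "w + r *\<^sub>R q \<notin> U"
    proof
      assume "w + r *\<^sub>R q \<in> U"
      then have "(w + r *\<^sub>R q) - w \<in> U" using True subspace_diff Uq(1) by blast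
      then have "(1 / r) *\<^sub>R (r *\<^sub>R q) \<in> U" using subspace_scale Uq(1) by (metis add_diff_cancel_left')
      then show False using q r by simp
    qed
    moreover have "w + r *\<^sub>R q \<in> W" using W w q subspace_add subspace_scale by blast
    ultimately show ?thesis using r by (intro bexI[of _ "w + r *\<^sub>R q"]) (auto simp: N_def dist_commute)
  qed
qed

context graded_complex
begin

text \<open>The target \<open>y\<close> may be degenerate. Moving the labels of \<open>z\<close>
  close to those of \<open>y\<close>, orbit by orbit, keeps the labelling generic and its count
  modulo 8.\<close>

lemma approximate_labelling:
  fixes y z :: "nat \<Rightarrow> 'w::euclidean_space"
  assumes W: "subspace W" "dim W = n" and y: "odd_labelling F g h y" "y ` \<Union>F \<subseteq> W"
    and z: "odd_labelling F g h z" "generic_labelling F z" "z ` \<Union>F \<subseteq> W"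
    and "e > 0"
  shows "\<exists>z'. odd_labelling F g h z' \<and> generic_labelling F z' \<and> z' ` \<Union>F \<subseteq> W \<and>
           num_balanced F z' mod 8 = num_balanced F z mod 8 \<and> (\<forall>v\<in>\<Union>F. dist (z' v) (y v) < e)"
proof -
  have "\<exists>z'. odd_labelling F g h z' \<and> generic_labelling F z' \<and> z' ` \<Union>F \<subseteq> W \<and>
           num_balanced F z' mod 8 = num_balanced F z mod 8 \<and> (\<forall>v\<in>P. dist (z' v) (y v) < e)"
    if "finite P" "P \<subseteq> \<Union>F" for P
    using that
  proof (induction P)
    case empty
    then show ?case using z by auto
  next
    case (insert p P)
    then obtain x where x: "odd_labelling F g h x" "generic_labelling F x" "x ` \<Union>F \<subseteq> W"
        "num_balanced F x mod 8 = num_balanced F z mod 8" "\<forall>v\<in>P. dist (x v) (y v) < e" by auto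
    have p: "p \<in> \<Union>F" using insert.prems by auto
    \<comment> \<open>The subspaces to avoid come from the current labelling \<open>x\<close>. Each
      is spanned by at most \<open>n - 1\<close> vectors and so cannot contain
      \<open>W\<close>.\<close>
    define \<U> where "\<U> = (\<lambda>(s, a, b). span (x ` (s - {a, b}))) `
        (SIGMA s:F. SIGMA a:s. {b\<in>s. a \<noteq> b})"
    have "finite \<U>" unfolding \<U>_def
      using finite_F finite_simplex by (intro finite_imageI finite_SigmaI) auto
    moreover have "subspace U \<and> \<not> W \<subseteq> U" if "U \<in> \<U>" for U
    proof
      obtain s a b where sab: "s \<in> F" "a \<in> s" "b \<in> s" "a \<noteq> b" "U = span (x ` (s - {a, b}))"
        using \<open>U \<in> \<U>\<close> by (auto simp: \<U>_def)
      show "subspace U" using sab by simp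
      have "dim U \<le> card (x ` (s - {a, b}))" unfolding sab(5) dim_span
        using sab finite_simplex by (intro dim_le_card') auto
      also have "\<dots> \<le> card (s - {a, b})" using sab finite_simplex by (intro card_image_le) auto
      also have "\<dots> = n - 1"
        using sab finite_simplex card_simplex by (simp add: card_Diff_subset)
      finally show "\<not> W \<subseteq> U" using dim_subset[of W U] W n_pos by linarith
    qed
    moreover have "y p \<in> W" using y p by auto
    ultimately obtain w where w: "w \<in> W" "dist w (y p) < e" "\<forall>U\<in>\<U>. w \<notin> U"
      using near_point_avoiding_subspaces[of W "y p" \<U> e] W \<open>e > 0\<close> by blast
    have gen: "w \<notin> span (x ` (s - {a, b}))" if "s \<in> F" "a \<in> s" "b \<in> s" "a \<noteq> b" for s a b
      using w(3) that by (auto simp: \<U>_def)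
    define z' where "z' = relabel_orbit g h p w x"
    note z' = relabel_orbit[OF x(1,2) W(2) x(3) w(1) p gen, folded z'_def]
    have "- w \<in> W" using w(1) W(1) subspace_neg by blast
    then have z'W: "z' ` \<Union>F \<subseteq> W" using w(1) x(3) by (auto simp: z'_def relabel_orbit_def)
    \<comment> \<open>As \<open>y\<close> is odd, the whole orbit of \<open>p\<close> comes within
      \<open>e\<close> of its targets at once; a vertex of this orbit treated earlier therefore
      stays close.\<close>
    have yo: "y (g p) = - y p" "y (h p) = - y p" "y (g (h p)) = y p"
      using y(1) p h_verts[OF p] by (auto simp: odd_labelling_def)
    have "\<forall>v\<in>insert p P. dist (z' v) (y v) < e"
      using x(5) w(2) yo by (auto simp: z'_def relabel_orbit_def dist_minus)
    then show ?case using z' z'W x(4) by (intro exI[of _ z']) auto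
  qed
  then show ?thesis using finite_verts by blast
qed

text \<open>If no simplex were balanced for \<open>y\<close>, none would be for a generic labelling
  close enough to \<open>y\<close>. Its count would be 0, but it agrees modulo 8 with the count for
  \<open>z\<close>.\<close>

theorem exists_balanced_simplex:
  fixes y z :: "nat \<Rightarrow> 'w::euclidean_space"
  assumes W: "subspace W" "dim W = n" and y: "odd_labelling F g h y" "y ` \<Union>F \<subseteq> W"
    and z: "odd_labelling F g h z" "generic_labelling F z" "z ` \<Union>F \<subseteq> W"
    and N: "num_balanced F z mod 8 \<noteq> 0"
  shows "\<exists>s\<in>F. balanced y s"
proof (rule ccontr)
  assume "\<not> (\<exists>s\<in>F. balanced y s)"
  then have "\<forall>s\<in>F. \<exists>e>0. \<forall>x. (\<forall>v\<in>s. dist (x v) (y v) < e) \<longrightarrow> \<not> balanced x s"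
    using not_balanced_open finite_simplex by blast
  then obtain e where e: "\<And>s. s \<in> F \<Longrightarrow> e s > 0"
      "\<And>s x. s \<in> F \<Longrightarrow> (\<forall>v\<in>s. dist (x v) (y v) < e s) \<Longrightarrow> \<not> balanced x s"
    by metis
  define d where "d = Min (insert 1 (e ` F))"
  have "d > 0" unfolding d_def using finite_F e(1) by auto
  obtain z' where z': "num_balanced F z' mod 8 = num_balanced F z mod 8"
      "\<forall>v\<in>\<Union>F. dist (z' v) (y v) < d"
    using approximate_labelling[OF W y z \<open>d > 0\<close>] by (elim exE conjE) (rule that)
  have "\<not> balanced z' s" if "s \<in> F" for s
  proof (rule e(2)[OF that])
    have "d \<le> e s" unfolding d_def using finite_F that by (intro Min_le) auto
    then show "\<forall>v\<in>s. dist (z' v) (y v) < e s" using z'(2) that by fastforce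
  qed
  then have "num_balanced F z' = 0" unfolding num_balanced_def by (metis (no_types, lifting) card.empty empty_Collect_eq)
  then show False using z'(1) N by simp
qed

end

section \<open>Complexes of chains and barycentric subdivision\<close>


text \<open>A common form for the staircase and for barycentric subdivisions. \<open>R\<close> is
  tested on consecutive ranks only, because \<open>base_step\<close> is a covering relation and not
  transitive.\<close>

definition graded_chains :: "nat \<Rightarrow> nat set \<Rightarrow> (nat \<Rightarrow> nat) \<Rightarrow> (nat \<Rightarrow> nat \<Rightarrow> bool) \<Rightarrow> nat set set" where
  "graded_chains n P rk R =
     {s. s \<subseteq> P \<and> bij_betw rk s {..n} \<and> (\<forall>u\<in>s. \<forall>v\<in>s. rk v = Suc (rk u) \<longrightarrow> R u v)}"

lemma graded_chainsD:
  assumes "s \<in> graded_chains n P rk R"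
  shows "s \<subseteq> P" "bij_betw rk s {..n}" "\<And>u v. u \<in> s \<Longrightarrow> v \<in> s \<Longrightarrow> rk v = Suc (rk u) \<Longrightarrow> R u v"
    "\<And>u v. u \<in> s \<Longrightarrow> v \<in> s \<Longrightarrow> rk u = rk v \<Longrightarrow> u = v"
    "\<And>u. u \<in> s \<Longrightarrow> rk u \<le> n" "\<And>i. i \<le> n \<Longrightarrow> \<exists>u\<in>s. rk u = i"
    "finite s" "card s = n + 1"
proof -
  show "s \<subseteq> P" and bij: "bij_betw rk s {..n}" using assms by (auto simp: graded_chains_def)
  show "R u v" if "u \<in> s" "v \<in> s" "rk v = Suc (rk u)" for u v
    using assms that by (auto simp: graded_chains_def)
  show "u = v" if "u \<in> s" "v \<in> s" "rk u = rk v" for u v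
    using bij that by (meson bij_betw_def inj_onD)
  show "rk u \<le> n" if "u \<in> s" for u using bij that by (auto simp: bij_betw_def)
  show "\<exists>u\<in>s. rk u = i" if "i \<le> n" for i using bij that by (metis atMost_iff bij_betw_iff_bijections)
  show "finite s" using bij bij_betw_finite by blast
  show "card s = n + 1" using bij_betw_same_card[OF bij] by simp
qed

lemma graded_chains_image:
  assumes "s \<in> graded_chains n P rk R" "inj_on f s" "f ` P \<subseteq> P" "\<And>v. v \<in> P \<Longrightarrow> rk (f v) = rk v"
    and "\<And>u v. u \<in> P \<Longrightarrow> v \<in> P \<Longrightarrow> R u v \<Longrightarrow> R (f u) (f v)"
  shows "f ` s \<in> graded_chains n P rk R"
proof -
  note s = graded_chainsD[OF assms(1)]
  have "bij_betw (rk \<circ> f) s {..n}"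
    using s(2) bij_betw_cong[of s "rk \<circ> f" rk "{..n}"] assms(4) s(1) by auto
  then have "bij_betw rk (f ` s) {..n}"
    using assms(2) by (metis bij_betw_comp_iff bij_betw_imageI)
  moreover have "R (f u) (f v)" if "u \<in> s" "v \<in> s" "rk (f v) = Suc (rk (f u))" for u v
  proof -
    have "u \<in> P" "v \<in> P" using s(1) that by auto
    then have "R u v" using s(3) that assms(4) by simp
    then show ?thesis using assms(5) \<open>u \<in> P\<close> \<open>v \<in> P\<close> by blast
  qed
  moreover have "f ` s \<subseteq> P" using s(1) assms(3) by blast
  ultimately show ?thesis by (auto simp: graded_chains_def)
qed

text \<open>The simplices over a facet correspond to the elements that fill its gap, and these are
  constrained only by the neighbouring ranks: one neighbour at the bottom and at the top, two in
  between.\<close>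

lemma even_card_graded_chains_facet:
  assumes n: "0 < n" and s: "s \<in> graded_chains n P rk R" and v: "v \<in> s"
    and low: "\<And>u w. u \<in> P \<Longrightarrow> w \<in> P \<Longrightarrow> rk u = 0 \<Longrightarrow> rk w = 1 \<Longrightarrow> R u w \<Longrightarrow>
        even (card {u\<in>P. rk u = 0 \<and> R u w})"
    and mid: "\<And>u v w. u \<in> P \<Longrightarrow> v \<in> P \<Longrightarrow> w \<in> P \<Longrightarrow> rk v = Suc (rk u) \<Longrightarrow> rk w = Suc (rk v) \<Longrightarrow>
        R u v \<Longrightarrow> R v w \<Longrightarrow> even (card {v'\<in>P. rk v' = rk v \<and> R u v' \<and> R v' w})"
    and top: "\<And>u w. u \<in> P \<Longrightarrow> w \<in> P \<Longrightarrow> rk w = n \<Longrightarrow> Suc (rk u) = n \<Longrightarrow> R u w \<Longrightarrow>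
        even (card {w\<in>P. rk w = n \<and> R u w})"
  shows "even (card {t\<in>graded_chains n P rk R. s - {v} \<subseteq> t})"
proof -
  note sD = graded_chainsD[OF s]
  define V where "V = {v'\<in>P. rk v' = rk v \<and> (\<forall>u\<in>s. rk v = Suc (rk u) \<longrightarrow> R u v') \<and>
      (\<forall>w\<in>s. rk w = Suc (rk v) \<longrightarrow> R v' w)}"
  have "bij_betw (\<lambda>v'. insert v' (s - {v})) V {t\<in>graded_chains n P rk R. s - {v} \<subseteq> t}"
    unfolding bij_betw_def
  proof
    have notin: "v' \<notin> s - {v}" if "v' \<in> V" for v'
      using that sD(4) v by (auto simp: V_def)
    then show "inj_on (\<lambda>v'. insert v' (s - {v})) V"
      by (intro inj_onI) (metis insert_iff)
    show "(\<lambda>v'. insert v' (s - {v})) ` V = {t\<in>graded_chains n P rk R. s - {v} \<subseteq> t}"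
    proof (intro equalityI subsetI)
      fix t assume "t \<in> (\<lambda>v'. insert v' (s - {v})) ` V"
      then obtain v' where v': "v' \<in> V" "t = insert v' (s - {v})" by blast
      have "bij_betw rk (s - {v}) ({..n} - {rk v})"
        using sD(2) v by (metis bij_betw_DiffI bij_betw_singletonI singletonD subsetI atMost_iff
            bij_betwE empty_subsetI insert_subset)
      then have "bij_betw rk (insert v' (s - {v})) (insert (rk v') ({..n} - {rk v}))"
        using notin[OF v'(1)] v'(1) notIn_Un_bij_betw3[of v' "s - {v}" rk "{..n} - {rk v}"]
        by (auto simp: V_def)
      moreover have "insert (rk v') ({..n} - {rk v}) = {..n}" using v' v sD(5) by (auto simp: V_def)
      ultimately show "t \<in> {t\<in>graded_chains n P rk R. s - {v} \<subseteq> t}"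
        using v' sD(1,3) v by (auto simp: graded_chains_def V_def)
    next
      fix t assume "t \<in> {t\<in>graded_chains n P rk R. s - {v} \<subseteq> t}"
      then have t: "t \<in> graded_chains n P rk R" "s - {v} \<subseteq> t" by auto
      note tD = graded_chainsD[OF t(1)]
      obtain v' where v': "v' \<in> t" "rk v' = rk v" using tD(6)[of "rk v"] sD(5) v by auto
      have "x \<in> s - {v}" if "x \<in> t" "x \<noteq> v'" for x
      proof -
        obtain y where y: "y \<in> s" "rk y = rk x" using sD(6)[of "rk x"] tD(5) \<open>x \<in> t\<close> by auto
        have "rk x \<noteq> rk v" using v' that tD(4) by metis
        then have "y \<in> s - {v}" using y by auto
        then show ?thesis using y t(2) tD(4) \<open>x \<in> t\<close> by (metis subsetD)
      qed
      then have "t = insert v' (s - {v})" using v' t(2) by auto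
      moreover have "v' \<in> V"
      proof -
        have "R u v'" if "u \<in> s" "rk v = Suc (rk u)" for u
        proof -
          have "u \<in> s - {v}" using that by auto
          then show ?thesis using tD(3)[of u v'] v' that t(2) by auto
        qed
        moreover have "R v' w" if "w \<in> s" "rk w = Suc (rk v)" for w
        proof -
          have "w \<in> s - {v}" using that by auto
          then show ?thesis using tD(3)[of v' w] v' that t(2) by auto
        qed
        ultimately show ?thesis unfolding V_def using v' tD(1) by auto
      qed
      ultimately show "t \<in> (\<lambda>v'. insert v' (s - {v})) ` V" by blast
    qed
  qed
  then have "card {t\<in>graded_chains n P rk R. s - {v} \<subseteq> t} = card V" using bij_betw_same_card by force
  moreover have "even (card V)"
  proof -
    have pred: "(\<forall>x\<in>s. rk v = Suc (rk x) \<longrightarrow> Q x) \<longleftrightarrow> Q u" if "u \<in> s" "rk v = Suc (rk u)" for u Q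
      using that sD(4) by (metis Suc_inject)
    have succ: "(\<forall>x\<in>s. rk x = Suc (rk v) \<longrightarrow> Q x) \<longleftrightarrow> Q w" if "w \<in> s" "rk w = Suc (rk v)" for w Q
      using that sD(4) by metis
    have vn: "rk v \<le> n" using sD(5) v .
    consider "rk v = 0" | "rk v = n" "rk v \<noteq> 0" | "0 < rk v" "rk v < n" using vn by linarith
    then show ?thesis
    proof cases
      case 1
      obtain w where w: "w \<in> s" "rk w = 1" using sD(6)[of 1] n by auto
      then have "V = {u\<in>P. rk u = 0 \<and> R u w}"
        unfolding V_def using 1 succ[of w] w by auto
      then show ?thesis using low[of v w] 1 w v sD(1,3) by auto
    next
      case 2
      obtain u where "u \<in> s" "rk u = n - 1" using sD(6)[of "n - 1"] by auto
      then have u: "u \<in> s" "Suc (rk u) = n" using n by auto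
      have "rk w \<noteq> Suc n" if "w \<in> s" for w using sD(5)[OF that] by simp
      then have "V = {w\<in>P. rk w = n \<and> R u w}"
        unfolding V_def using 2 u pred[of u] by auto
      then show ?thesis using top[of u v] 2 u v sD(1,3) by auto
    next
      case 3
      obtain u where "u \<in> s" "rk u = rk v - 1" using sD(6)[of "rk v - 1"] vn by (meson diff_le_self order_trans)
      then have u: "u \<in> s" "Suc (rk u) = rk v" using 3 by auto
      obtain w where w: "w \<in> s" "rk w = Suc (rk v)" using sD(6)[of "Suc (rk v)"] 3 by auto
      have "V = {v'\<in>P. rk v' = rk v \<and> R u v' \<and> R v' w}"
        unfolding V_def using pred[OF u(1) u(2)[symmetric]] succ[OF w] by auto
      then show ?thesis using mid[of u v w] u w v sD(1,3) by auto
    qed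
  qed
  ultimately show ?thesis by simp
qed

lemma finite_graded_chains: "finite P \<Longrightarrow> finite (graded_chains n P rk R)"
  by (rule finite_subset[of _ "Pow P"]) (auto simp: graded_chains_def)

section \<open>Barycentric subdivision\<close>

definition lift_map :: "(nat \<Rightarrow> nat) \<Rightarrow> nat \<Rightarrow> nat" where
  "lift_map f v = set_encode (f ` set_decode v)"

definition sd_rk :: "nat \<Rightarrow> nat" where
  "sd_rk v = card (set_decode v) - 1"

definition sd_verts :: "nat set set \<Rightarrow> nat set" where
  "sd_verts F = set_encode ` {X. X \<noteq> {} \<and> (\<exists>s\<in>F. X \<subseteq> s)}"

text \<open>Simplices are complete flags of faces. A face is coded by \<open>set_encode\<close> as a
  natural number, so that the construction can be iterated.\<close>

definition sd :: "nat \<Rightarrow> nat set set \<Rightarrow> nat set set" where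
  "sd n F = graded_chains n (sd_verts F) sd_rk (\<lambda>u w. set_decode u \<subseteq> set_decode w)"

lemma set_decode_lift_map: "set_decode (lift_map f v) = f ` set_decode v"
  by (simp add: lift_map_def)

lemma even_card_doubleton: "V = {x, y} \<Longrightarrow> x \<noteq> y \<Longrightarrow> even (card V)"
  by simp

declare set_encode_insert [simp del]

lemma set_decode_eq_iff: "set_decode u = set_decode v \<longleftrightarrow> u = v"
  by (metis set_decode_inverse)

lemma sd_nested:
  assumes "\<sigma> \<in> sd n F" "u \<in> \<sigma>" "w \<in> \<sigma>" "sd_rk u \<le> sd_rk w"
  shows "set_decode u \<subseteq> set_decode w"
proof -
  note D = graded_chainsD[OF assms(1)[unfolded sd_def]]
  have "set_decode u \<subseteq> set_decode w" if "w \<in> \<sigma>" "sd_rk w = sd_rk u + k" for w k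
    using that
  proof (induction k arbitrary: w)
    case 0
    then show ?case using D(4)[OF assms(2)] by (metis add_0_right order_refl)
  next
    case (Suc k)
    have "sd_rk w \<le> n" using D(5) Suc.prems by blast
    then obtain x where x: "x \<in> \<sigma>" "sd_rk x = sd_rk u + k" using D(6)[of "sd_rk u + k"] Suc.prems by auto
    then have "set_decode x \<subseteq> set_decode w" using D(3)[of x w] Suc.prems by simp
    then show ?case using Suc.IH[OF x] by blast
  qed
  from this[OF assms(3), of "sd_rk w - sd_rk u"] show ?thesis using assms(4) by simp
qed

context graded_complex
begin

lemma sd_verts_iff: "v \<in> sd_verts F \<longleftrightarrow> set_decode v \<noteq> {} \<and> (\<exists>s\<in>F. set_decode v \<subseteq> s)"
proof
  assume "v \<in> sd_verts F"
  then obtain X s where "v = set_encode X" "X \<noteq> {}" "s \<in> F" "X \<subseteq> s" by (auto simp: sd_verts_def)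
  moreover from this have "finite X" using finite_simplex finite_subset by blast
  ultimately show "set_decode v \<noteq> {} \<and> (\<exists>s\<in>F. set_decode v \<subseteq> s)" by auto
next
  assume "set_decode v \<noteq> {} \<and> (\<exists>s\<in>F. set_decode v \<subseteq> s)"
  then show "v \<in> sd_verts F" unfolding sd_verts_def
    by (intro image_eqI[of _ _ "set_decode v"]) auto
qed

lemma finite_sd_verts: "finite (sd_verts F)"
proof -
  have "{X. X \<noteq> {} \<and> (\<exists>s\<in>F. X \<subseteq> s)} \<subseteq> Pow (\<Union>F)" by auto
  then show ?thesis unfolding sd_verts_def using finite_verts by (meson finite_Pow_iff finite_imageI finite_subset)
qed

lemma card_sd_vert: "v \<in> sd_verts F \<Longrightarrow> card (set_decode v) = Suc (sd_rk v)"
  by (simp add: sd_verts_iff sd_rk_def card_gt_0_iff)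

lemma encode_sd_vert:
  "X \<noteq> {} \<Longrightarrow> X \<subseteq> s \<Longrightarrow> s \<in> F \<Longrightarrow> set_encode X \<in> sd_verts F \<and> set_decode (set_encode X) = X"
  using finite_subset[OF _ finite_simplex] unfolding sd_verts_def by (intro conjI imageI) auto

text \<open>A gap in a flag is filled by the two ends of an edge at the bottom and by the two faces
  strictly between faces of dimensions differing by two in the middle. At the top it is filled by
  the simplices over a facet, whose number is even in \<open>F\<close>.\<close>

lemma graded_complex_sd: "graded_complex n (sd n F) (lift_map g) (lift_map h) sd_rk"
proof
  let ?d = set_decode
  show "0 < n" by (rule n_pos)
  show "finite (sd n F)" unfolding sd_def by (intro finite_graded_chains finite_sd_verts)
  show "bij_betw sd_rk s {..n}" if "s \<in> sd n F" for s using that graded_chainsD(2) unfolding sd_def by blast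
  show "even (card {t\<in>sd n F. s - {v} \<subseteq> t})" if "s \<in> sd n F" "v \<in> s" for s v
    unfolding sd_def
  proof (rule even_card_graded_chains_facet[OF n_pos that(1)[unfolded sd_def] that(2)])
    fix u w assume uw: "u \<in> sd_verts F" "w \<in> sd_verts F" "sd_rk u = 0" "sd_rk w = 1" "?d u \<subseteq> ?d w"
    have "card (?d w) = 2" using uw card_sd_vert by simp
    then obtain x y where xy: "?d w = {x, y}" "x \<noteq> y" by (auto simp: card_2_iff)
    obtain t where t: "t \<in> F" "?d w \<subseteq> t" using uw sd_verts_iff by auto
    have enc: "set_encode {a} \<in> sd_verts F \<and> ?d (set_encode {a}) = {a}" if "a \<in> ?d w" for a
      using encode_sd_vert[of "{a}" t] that t by auto
    show "even (card {u \<in> sd_verts F. sd_rk u = 0 \<and> ?d u \<subseteq> ?d w})"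
    proof (rule even_card_doubleton[of _ "set_encode {x}" "set_encode {y}"])
      show "{u \<in> sd_verts F. sd_rk u = 0 \<and> ?d u \<subseteq> ?d w} = {set_encode {x}, set_encode {y}}"
      proof (intro equalityI subsetI)
        fix u assume u: "u \<in> {u \<in> sd_verts F. sd_rk u = 0 \<and> ?d u \<subseteq> ?d w}"
        then have "card (?d u) = 1" using card_sd_vert by simp
        then obtain a where a: "?d u = {a}" by (auto simp: card_1_singleton_iff)
        then have "a = x \<or> a = y" using u xy by auto
        moreover have "u = set_encode {a}" by (metis a set_decode_inverse)
        ultimately show "u \<in> {set_encode {x}, set_encode {y}}" by blast
      next
        fix u assume "u \<in> {set_encode {x}, set_encode {y}}"
        then obtain a where a: "a \<in> ?d w" "u = set_encode {a}" using xy(1) by blast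
        have u: "?d u = {a}" "u \<in> sd_verts F" using enc[OF a(1)] unfolding a(2) by blast+
        then show "u \<in> {u \<in> sd_verts F. sd_rk u = 0 \<and> ?d u \<subseteq> ?d w}"
          using a(1) by (simp add: sd_rk_def)
      qed
      show "set_encode {x} \<noteq> set_encode {y}" using enc[of x] enc[of y] xy by (metis insertI1 insertI2 singleton_inject)
    qed
  next
    fix u v w assume uw: "u \<in> sd_verts F" "v \<in> sd_verts F" "w \<in> sd_verts F"
      "sd_rk v = Suc (sd_rk u)" "sd_rk w = Suc (sd_rk v)" "?d u \<subseteq> ?d v" "?d v \<subseteq> ?d w"
    have sub: "?d u \<subseteq> ?d w" using uw by blast
    have "card (?d w - ?d u) = 2" using uw card_sd_vert sub by (simp add: card_Diff_subset)
    then obtain x y where xy: "?d w - ?d u = {x, y}" "x \<noteq> y" by (auto simp: card_2_iff)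
    obtain t where t: "t \<in> F" "?d w \<subseteq> t" using uw sd_verts_iff by auto
    have enc: "set_encode (insert a (?d u)) \<in> sd_verts F \<and> ?d (set_encode (insert a (?d u))) = insert a (?d u)"
      if "a \<in> ?d w - ?d u" for a
      using encode_sd_vert[of "insert a (?d u)" t] that t sub by auto
    show "even (card {v' \<in> sd_verts F. sd_rk v' = sd_rk v \<and> ?d u \<subseteq> ?d v' \<and> ?d v' \<subseteq> ?d w})"
    proof (rule even_card_doubleton[of _ "set_encode (insert x (?d u))" "set_encode (insert y (?d u))"])
      show "{v' \<in> sd_verts F. sd_rk v' = sd_rk v \<and> ?d u \<subseteq> ?d v' \<and> ?d v' \<subseteq> ?d w} =
          {set_encode (insert x (?d u)), set_encode (insert y (?d u))}"
      proof (intro equalityI subsetI)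
        fix v' assume v': "v' \<in> {v' \<in> sd_verts F. sd_rk v' = sd_rk v \<and> ?d u \<subseteq> ?d v' \<and> ?d v' \<subseteq> ?d w}"
        then have "card (?d v' - ?d u) = 1" using card_sd_vert uw by (simp add: card_Diff_subset)
        then obtain a where a: "?d v' - ?d u = {a}" by (auto simp: card_1_singleton_iff)
        then have "a \<in> {x, y}" using v' xy by blast
        moreover have "?d v' = insert a (?d u)" using a v' by auto
        then have "v' = set_encode (insert a (?d u))" by (metis set_decode_inverse)
        ultimately show "v' \<in> {set_encode (insert x (?d u)), set_encode (insert y (?d u))}" by blast
      next
        fix v' assume "v' \<in> {set_encode (insert x (?d u)), set_encode (insert y (?d u))}"
        then obtain a where a: "a \<in> ?d w - ?d u" "v' = set_encode (insert a (?d u))" using xy(1) by blast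
        have v': "?d v' = insert a (?d u)" "v' \<in> sd_verts F" using enc[OF a(1)] unfolding a(2) by blast+
        then have "sd_rk v' = sd_rk v"
          using a(1) uw(4) card_sd_vert[OF uw(1)] card_sd_vert[OF v'(2)] by simp
        moreover have "?d u \<subseteq> ?d v'" "?d v' \<subseteq> ?d w" unfolding v'(1) using a(1) sub by auto
        ultimately show "v' \<in> {v' \<in> sd_verts F. sd_rk v' = sd_rk v \<and> ?d u \<subseteq> ?d v' \<and> ?d v' \<subseteq> ?d w}"
          using v'(2) by simp
      qed
      have "insert x (?d u) \<noteq> insert y (?d u)" using xy by auto
      then show "set_encode (insert x (?d u)) \<noteq> set_encode (insert y (?d u))"
        using enc[of x] enc[of y] xy by (metis insertCI)
    qed
  next
    fix u w assume uw: "u \<in> sd_verts F" "w \<in> sd_verts F" "sd_rk w = n" "Suc (sd_rk u) = n" "?d u \<subseteq> ?d w"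
    have full: "?d w \<in> F" if w: "w \<in> sd_verts F" "sd_rk w = n" for w
    proof -
      obtain t where t: "t \<in> F" "?d w \<subseteq> t" using w sd_verts_iff by auto
      then have "?d w = t" using card_sd_vert[OF w(1)] w(2) card_simplex[of t] finite_simplex[of t]
        by (simp add: card_subset_eq)
      then show ?thesis using t by simp
    qed
    have "bij_betw ?d {w \<in> sd_verts F. sd_rk w = n \<and> ?d u \<subseteq> ?d w} {t\<in>F. ?d u \<subseteq> t}"
    proof (rule bij_betwI[where g = set_encode])
      show "set_encode \<in> {t\<in>F. ?d u \<subseteq> t} \<rightarrow> {w \<in> sd_verts F. sd_rk w = n \<and> ?d u \<subseteq> ?d w}"
      proof
        fix t assume t: "t \<in> {t\<in>F. ?d u \<subseteq> t}"
        then have "t \<noteq> {}" using card_simplex[of t] by auto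
        then show "set_encode t \<in> {w \<in> sd_verts F. sd_rk w = n \<and> ?d u \<subseteq> ?d w}"
          using encode_sd_vert[of t t] t card_simplex[of t] by (auto simp: sd_rk_def)
      qed
    qed (auto simp: full finite_simplex)
    then have *: "card {w \<in> sd_verts F. sd_rk w = n \<and> ?d u \<subseteq> ?d w} = card {t\<in>F. ?d u \<subseteq> t}"
      by (rule bij_betw_same_card)
    have "card (?d w - ?d u) = 1" using uw card_sd_vert by (simp add: card_Diff_subset)
    then obtain a where a: "?d w - ?d u = {a}" by (auto simp: card_1_singleton_iff)
    then have "?d u = ?d w - {a}" "a \<in> ?d w" using uw by auto
    then show "even (card {w \<in> sd_verts F. sd_rk w = n \<and> ?d u \<subseteq> ?d w})"
      using even_facet[OF full[OF uw(2,3)], of a] * by simp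
  qed
  show "lift_map g (lift_map g v) = v" "lift_map h (lift_map h v) = v" for v
    by (simp_all add: set_decode_lift_map image_image flip: set_decode_eq_iff)
  show "lift_map g (lift_map h v) = lift_map h (lift_map g v)" for v
    by (simp add: set_decode_lift_map image_image gh flip: set_decode_eq_iff)
  show "sd_rk (lift_map g v) = sd_rk v" "sd_rk (lift_map h v) = sd_rk v" for v
    by (simp_all add: sd_rk_def set_decode_lift_map card_image inj_g inj_h)
  note rk' = this
  have inj: "inj_on (lift_map g) S" "inj_on (lift_map h) S" for S
    by (rule inj_on_inverseI[where g = "lift_map g"], simp add: set_decode_lift_map image_image flip: set_decode_eq_iff)
       (rule inj_on_inverseI[where g = "lift_map h"], simp add: set_decode_lift_map image_image flip: set_decode_eq_iff)
  have "lift_map g v \<in> sd_verts F" "lift_map h v \<in> sd_verts F" if "v \<in> sd_verts F" for v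
    using that g_F h_F unfolding sd_verts_iff set_decode_lift_map by (metis image_is_empty image_mono)+
  then show "lift_map g ` s \<in> sd n F" "lift_map h ` s \<in> sd n F" if "s \<in> sd n F" for s
    using that unfolding sd_def
    by (intro graded_chains_image inj image_subsetI; simp add: rk' set_decode_lift_map image_mono)+
  show "lift_map g v \<noteq> v \<and> lift_map h v \<noteq> v \<and> lift_map g (lift_map h v) \<noteq> v" if v: "v \<in> \<Union> (sd n F)" for v
  proof -
    have "v \<in> sd_verts F" using v graded_chainsD(1) unfolding sd_def by blast
    then obtain x s where x: "x \<in> ?d v" "s \<in> F" "?d v \<subseteq> s" using sd_verts_iff by auto
    \<comment> \<open>A rank-preserving map that fixes a face as a set fixes each of its vertices,
      so freeness passes from vertices to faces.\<close>
    have "f x = x" if "f ` ?d v = ?d v" "rk (f x) = rk x" for f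
      using that x rk_inj[of s "f x" x] by blast
    moreover have "g x \<noteq> x \<and> h x \<noteq> x \<and> g (h x) \<noteq> x" using free x by blast
    ultimately show ?thesis
      by (auto simp: set_decode_lift_map image_image simp flip: set_decode_eq_iff) 
        (metis rk_g rk_h)+
  qed
qed

end


section \<open>Labels of the subdivision from minimal vertices\<close>

definition min_vertex :: "(nat \<Rightarrow> nat) \<Rightarrow> nat \<Rightarrow> nat" where
  "min_vertex rk v = arg_min_on rk (set_decode v)"

context graded_complex
begin

lemma min_vertex:
  assumes "v \<in> sd_verts F"
  shows "min_vertex rk v \<in> set_decode v" "x \<in> set_decode v \<Longrightarrow> rk (min_vertex rk v) \<le> rk x"
  using arg_min_if_finite[of "set_decode v" rk] assms unfolding sd_verts_iff min_vertex_def
  by (auto simp: not_less)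

lemma min_vertex_eqI:
  assumes "v \<in> sd_verts F" "x \<in> set_decode v" "\<And>y. y \<in> set_decode v \<Longrightarrow> rk x \<le> rk y"
  shows "min_vertex rk v = x"
proof -
  obtain s where "s \<in> F" "set_decode v \<subseteq> s" using assms(1) sd_verts_iff by auto
  then show ?thesis
    using rk_inj[of s "min_vertex rk v" x] min_vertex[OF assms(1)] assms(2,3) by (meson order_antisym subsetD)
qed

lemma lift_map_sd_verts:
  assumes "v \<in> sd_verts F"
  shows "lift_map g v \<in> sd_verts F" "lift_map h v \<in> sd_verts F"
  using assms g_F h_F unfolding sd_verts_iff set_decode_lift_map by (metis image_is_empty image_mono)+

lemma min_vertex_lift:
  assumes "v \<in> sd_verts F"
  shows "min_vertex rk (lift_map g v) = g (min_vertex rk v)"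
    "min_vertex rk (lift_map h v) = h (min_vertex rk v)"
  using assms min_vertex[OF assms]
  by (auto intro!: min_vertex_eqI lift_map_sd_verts simp: set_decode_lift_map)

lemma sd_subset_verts: "\<sigma> \<in> sd n F \<Longrightarrow> \<sigma> \<subseteq> sd_verts F"
  unfolding sd_def by (rule graded_chainsD(1))

lemma sd_top:
  assumes "\<sigma> \<in> sd n F"
  shows "\<exists>s\<in>F. \<forall>v\<in>\<sigma>. set_decode v \<subseteq> s"
proof -
  note D = graded_chainsD[OF assms[unfolded sd_def]]
  obtain w where w: "w \<in> \<sigma>" "sd_rk w = n" using D(6) by auto
  obtain s where s: "s \<in> F" "set_decode w \<subseteq> s" using w D(1) sd_verts_iff by blast
  have "card (set_decode w) = n + 1" using w D(1) card_sd_vert by auto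
  then have "set_decode w = s" using s card_simplex finite_simplex by (simp add: card_subset_eq)
  have "\<forall>v\<in>\<sigma>. set_decode v \<subseteq> s"
    using sd_nested[OF assms _ w(1)] D(5) w \<open>set_decode w = s\<close> by simp
  then show ?thesis using s(1) by blast
qed

definition upper :: "nat set \<Rightarrow> nat \<Rightarrow> nat set" where
  "upper s j = {x\<in>s. j \<le> rk x}"

text \<open>Among the complete flags in the subdivision of \<open>s\<close> this is the only one
  whose minimal vertices exhaust \<open>s\<close>, by \<open>min_flag_unique\<close>.\<close>

definition min_flag :: "nat set \<Rightarrow> nat set" where
  "min_flag s = (\<lambda>j. set_encode (upper s j)) ` {..n}"

lemma card_upper:
  assumes "s \<in> F" "j \<le> n"
  shows "card (upper s j) = n - j + 1"
proof -
  have "rk ` upper s j = {j..n}"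
    using bij_betw_imp_surj_on[OF rk_bij[OF assms(1)]] unfolding upper_def by (fastforce simp: image_iff)
  moreover have "inj_on rk (upper s j)"
    using rk_bij[OF assms(1)] by (auto simp: upper_def bij_betw_def inj_on_def)
  ultimately show ?thesis using card_image[of rk "upper s j"] assms(2) by simp
qed

lemma upper_vert:
  assumes "s \<in> F" "j \<le> n"
  shows "set_encode (upper s j) \<in> sd_verts F" "set_decode (set_encode (upper s j)) = upper s j"
    "sd_rk (set_encode (upper s j)) = n - j" "rk (min_vertex rk (set_encode (upper s j))) = j"
proof -
  have ne: "upper s j \<noteq> {}" using card_upper[OF assms] by auto
  then show 1: "set_encode (upper s j) \<in> sd_verts F" "set_decode (set_encode (upper s j)) = upper s j"
    using encode_sd_vert[of "upper s j" s] assms(1) by (auto simp: upper_def)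
  then show "sd_rk (set_encode (upper s j)) = n - j" using card_upper[OF assms] by (simp add: sd_rk_def)
  obtain x where x: "x \<in> s" "rk x = j"
    using bij_betw_imp_surj_on[OF rk_bij[OF assms(1)]] assms(2) by (metis atMost_iff imageE)
  have "min_vertex rk (set_encode (upper s j)) = x"
  proof (rule min_vertex_eqI[OF 1(1)], unfold 1(2))
    show "x \<in> upper s j" "\<And>y. y \<in> upper s j \<Longrightarrow> rk x \<le> rk y"
      using x by (auto simp: upper_def)
  qed
  then show "rk (min_vertex rk (set_encode (upper s j))) = j" using x by simp
qed

lemma min_flag_in_sd:
  assumes "s \<in> F"
  shows "min_flag s \<in> sd n F"
proof -
  have "bij_betw sd_rk (min_flag s) {..n}"
    unfolding bij_betw_def min_flag_def
  proof
    show "inj_on sd_rk ((\<lambda>j. set_encode (upper s j)) ` {..n})"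
      using upper_vert(3)[OF assms]
      by (intro inj_onI) (metis (no_types, lifting) atMost_iff diff_diff_cancel imageE)
    have "sd_rk ` (\<lambda>j. set_encode (upper s j)) ` {..n} = (\<lambda>j. n - j) ` {..n}"
      unfolding image_image using upper_vert(3)[OF assms] by (intro image_cong) auto
    also have "\<dots> = {..n}" by (auto simp: image_iff) (metis atMost_iff diff_diff_cancel diff_le_self)
    finally show "sd_rk ` (\<lambda>j. set_encode (upper s j)) ` {..n} = {..n}" .
  qed
  moreover have "set_decode u \<subseteq> set_decode v"
    if uv: "u \<in> min_flag s" "v \<in> min_flag s" "sd_rk v = Suc (sd_rk u)" for u v
  proof -
    obtain i j where ij: "i \<le> n" "j \<le> n" "u = set_encode (upper s i)" "v = set_encode (upper s j)"
      using uv by (auto simp: min_flag_def)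
    then have "j \<le> i" using uv(3) upper_vert(3)[OF assms] by simp
    then show ?thesis using ij upper_vert(2)[OF assms] by (auto simp: upper_def)
  qed
  moreover have "min_flag s \<subseteq> sd_verts F" using upper_vert(1)[OF assms] by (auto simp: min_flag_def)
  ultimately show ?thesis by (auto simp: sd_def graded_chains_def)
qed

lemma inj_on_min_flag:
  assumes "s \<in> F"
  shows "inj_on (min_vertex rk) (min_flag s)" "min_vertex rk ` min_flag s = s"
proof -
  show inj: "inj_on (min_vertex rk) (min_flag s)"
    using upper_vert(4)[OF assms] unfolding min_flag_def by (auto intro!: inj_onI) (metis)
  have "min_vertex rk ` min_flag s \<subseteq> s"
    using upper_vert(1,2)[OF assms] min_vertex(1) by (force simp: min_flag_def upper_def)
  moreover have "card (min_vertex rk ` min_flag s) = card s"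
    using card_image[OF inj] card_simplex[OF assms]
      graded_chainsD(8)[OF min_flag_in_sd[OF assms, unfolded sd_def]] by simp
  ultimately show "min_vertex rk ` min_flag s = s"
    using finite_simplex[OF assms] by (simp add: card_subset_eq)
qed

text \<open>The rank of the minimal vertex of a face of dimension \<open>i\<close> is at most \<open>n - i\<close>; if the
  minimal vertices exhaust \<open>s\<close>, summing over the chain forces equality.\<close>

lemma min_flag_unique:
  assumes \<sigma>: "\<sigma> \<in> sd n F" and s: "s \<in> F" "\<forall>v\<in>\<sigma>. set_decode v \<subseteq> s"
    and im: "min_vertex rk ` \<sigma> = s"
  shows "\<sigma> = min_flag s"
proof -
  note D = graded_chainsD[OF \<sigma>[unfolded sd_def]]
  have fin: "finite \<sigma>" by (rule D(7))
  have inj: "inj_on (min_vertex rk) \<sigma>"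
    using im D(8) card_simplex[OF s(1)] fin by (intro eq_card_imp_inj_on) auto
  have sub: "set_decode v \<subseteq> upper s (rk (min_vertex rk v))" if "v \<in> \<sigma>" for v
    using s(2) min_vertex(2) D(1) that by (auto simp: upper_def)
  have rkle: "rk (min_vertex rk v) \<le> n" if "v \<in> \<sigma>" for v
    using rk_bij[OF s(1)] im that by (auto simp: bij_betw_def)
  have le: "rk (min_vertex rk v) \<le> n - sd_rk v" if "v \<in> \<sigma>" for v
  proof -
    have "card (set_decode v) \<le> card (upper s (rk (min_vertex rk v)))"
      using sub[OF that] finite_simplex[OF s(1)] by (intro card_mono) (auto simp: upper_def)
    moreover have "card (set_decode v) = Suc (sd_rk v)" using that D(1) card_sd_vert by blast
    ultimately show ?thesis using card_upper[OF s(1) rkle[OF that]] rkle[OF that] by linarith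
  qed
  have "(\<Sum>v\<in>\<sigma>. rk (min_vertex rk v)) = (\<Sum>x\<in>s. rk x)"
    using sum.reindex[OF inj, of rk] im by simp
  also have "\<dots> = (\<Sum>j\<le>n. j)"
    using sum.reindex_bij_betw[OF rk_bij[OF s(1)], of "\<lambda>j. j"] by simp
  also have "\<dots> = (\<Sum>j\<le>n. n - j)"
    by (rule sum.reindex_bij_witness[of _ "\<lambda>j. n - j" "\<lambda>j. n - j"]) auto
  also have "\<dots> = (\<Sum>v\<in>\<sigma>. n - sd_rk v)"
    using sum.reindex_bij_betw[OF D(2), of "\<lambda>j. n - j"] by simp
  finally have eq: "rk (min_vertex rk v) = n - sd_rk v" if "v \<in> \<sigma>" for v
    using sum_mono_inv[of "\<lambda>v. rk (min_vertex rk v)" \<sigma> "\<lambda>v. n - sd_rk v" v] le that fin by auto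
  have "v \<in> min_flag s" if v: "v \<in> \<sigma>" for v
  proof -
    have "card (set_decode v) = card (upper s (n - sd_rk v))"
      using card_upper[OF s(1), of "n - sd_rk v"] card_sd_vert D(1,5) v by auto
    moreover have "set_decode v \<subseteq> upper s (n - sd_rk v)" using sub[OF v] eq[OF v] by simp
    moreover have "finite (upper s (n - sd_rk v))" using finite_simplex[OF s(1)] by (simp add: upper_def)
    ultimately have "set_decode v = upper s (n - sd_rk v)" by (simp add: card_subset_eq)
    then have "v = set_encode (upper s (n - sd_rk v))" by (metis set_decode_inverse)
    then show ?thesis unfolding min_flag_def by (metis atMost_iff diff_le_self imageI)
  qed
  then show ?thesis
    using D(8) graded_chainsD(7,8)[OF min_flag_in_sd[OF s(1), unfolded sd_def]]
    by (intro card_subset_eq) auto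
qed

text \<open>A flag inside \<open>s\<close> carries labels of vertices of \<open>s\<close>. If some
  vertex of \<open>s\<close> is missing among the minimal vertices, genericity of \<open>z\<close>
  excludes balance; if none is, the flag is \<open>min_flag s\<close> and carries the labels of
  \<open>s\<close>. So balanced simplices correspond one to one.\<close>

lemma sd_labelling:
  fixes z :: "nat \<Rightarrow> 'w::euclidean_space"
  assumes odd: "odd_labelling F g h z" and gen: "generic_labelling F z" and W: "z ` \<Union>F \<subseteq> W"
  defines "y \<equiv> \<lambda>v. z (min_vertex rk v)"
  shows "odd_labelling (sd n F) (lift_map g) (lift_map h) y" "generic_labelling (sd n F) y"
    "y ` \<Union>(sd n F) \<subseteq> W" "num_balanced (sd n F) y = num_balanced F z"
proof -
  have vert: "v \<in> sd_verts F" if "v \<in> \<Union>(sd n F)" for v using that sd_subset_verts by blast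
  have mv: "min_vertex rk v \<in> \<Union>F" if "v \<in> sd_verts F" for v
    using min_vertex(1)[OF that] that sd_verts_iff by blast
  show "odd_labelling (sd n F) (lift_map g) (lift_map h) y"
    using odd vert mv min_vertex_lift unfolding odd_labelling_def y_def by metis
  show "y ` \<Union>(sd n F) \<subseteq> W"
  proof
    fix x assume "x \<in> y ` \<Union>(sd n F)"
    then obtain v where "v \<in> \<Union>(sd n F)" "x = z (min_vertex rk v)" by (auto simp: y_def)
    then show "x \<in> W" using vert mv W by blast
  qed
  have small: "\<not> balanced y \<tau>" if hyp: "\<sigma> \<in> sd n F" "\<tau> \<subseteq> \<sigma>" "s \<in> F" "\<forall>v\<in>\<sigma>. set_decode v \<subseteq> s"
      "min_vertex rk ` \<tau> \<noteq> s" for \<sigma> \<tau> s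
  proof
    assume bal: "balanced y \<tau>"
    have "finite \<sigma>" using graded_chainsD(7) hyp(1) unfolding sd_def by blast
    then have "balanced z (min_vertex rk ` \<tau>)"
      using bal balanced_image[of \<tau> z "min_vertex rk"] hyp(2) finite_subset unfolding y_def by blast
    moreover have "min_vertex rk ` \<tau> \<subseteq> s"
      using hyp(1,2,4) min_vertex(1) sd_subset_verts by blast
    ultimately obtain x where "x \<in> s" "min_vertex rk ` \<tau> \<subseteq> s - {x}" using hyp(5) by blast
    then have "balanced z (s - {x})"
      using \<open>balanced z _\<close> balanced_mono finite_simplex[OF hyp(3)] by blast
    then show False using gen \<open>x \<in> s\<close> hyp(3) by (auto simp: generic_labelling_def)
  qed
  show "generic_labelling (sd n F) y"
    unfolding generic_labelling_def
  proof (intro ballI)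
    fix \<sigma> v assume \<sigma>: "\<sigma> \<in> sd n F" "v \<in> \<sigma>"
    obtain s where s: "s \<in> F" "\<forall>v\<in>\<sigma>. set_decode v \<subseteq> s" using sd_top[OF \<sigma>(1)] by blast
    note D = graded_chainsD[OF \<sigma>(1)[unfolded sd_def]]
    \<comment> \<open>A facet of a flag has only \<open>n\<close> vertices, so its minimal vertices
      cannot exhaust \<open>s\<close>.\<close>
    have "card (min_vertex rk ` (\<sigma> - {v})) \<le> card (\<sigma> - {v})" using D(7) by (intro card_image_le) auto
    also have "\<dots> < card s" using D(7,8) \<sigma>(2) card_simplex[OF s(1)] by simp
    finally have "min_vertex rk ` (\<sigma> - {v}) \<noteq> s" by auto
    then show "\<not> balanced y (\<sigma> - {v})" by (intro small[OF \<sigma>(1) _ s]) auto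
  qed
  have flag: "balanced y (min_flag s) \<longleftrightarrow> balanced z s" if "s \<in> F" for s
    using balanced_image_iff[OF _ inj_on_min_flag(1)[OF that], of z] inj_on_min_flag(2)[OF that]
      graded_chainsD(7)[OF min_flag_in_sd[OF that, unfolded sd_def]] by (simp add: y_def)
  have "{\<sigma>\<in>sd n F. balanced y \<sigma>} = min_flag ` {s\<in>F. balanced z s}"
  proof (intro equalityI subsetI)
    fix \<sigma> assume "\<sigma> \<in> {\<sigma>\<in>sd n F. balanced y \<sigma>}"
    then have \<sigma>: "\<sigma> \<in> sd n F" "balanced y \<sigma>" by auto
    obtain s where s: "s \<in> F" "\<forall>v\<in>\<sigma>. set_decode v \<subseteq> s" using sd_top[OF \<sigma>(1)] by blast
    have "min_vertex rk ` \<sigma> = s" using small[OF \<sigma>(1) order_refl s] \<sigma>(2) by blast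
    then have "\<sigma> = min_flag s" using min_flag_unique[OF \<sigma>(1) s] by blast
    then show "\<sigma> \<in> min_flag ` {s\<in>F. balanced z s}" using flag[OF s(1)] \<sigma>(2) s(1) by blast
  qed (auto simp: flag min_flag_in_sd)
  moreover have "inj_on min_flag {s\<in>F. balanced z s}"
    using inj_on_min_flag(2) by (metis (no_types, lifting) inj_onI mem_Collect_eq)
  ultimately show "num_balanced (sd n F) y = num_balanced F z"
    unfolding num_balanced_def by (simp add: card_image)
qed

end

section \<open>The staircase triangulation\<close>


abbreviation cx :: "nat \<Rightarrow> nat" where "cx v \<equiv> fst (prod_decode v)"
abbreviation cy :: "nat \<Rightarrow> nat" where "cy v \<equiv> snd (prod_decode v)"

definition flip_sign :: "nat \<Rightarrow> nat" where
  "flip_sign a = (if even a then a + 1 else a - 1)"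

definition base_g :: "nat \<Rightarrow> nat" where "base_g v = prod_encode (flip_sign (cx v), cy v)"
definition base_h :: "nat \<Rightarrow> nat" where "base_h v = prod_encode (cx v, flip_sign (cy v))"
definition base_rk :: "nat \<Rightarrow> nat" where "base_rk v = cx v div 2 + cy v div 2"

definition base_verts :: "nat \<Rightarrow> nat set" where
  "base_verts d = {v. cx v < 2 * d + 2 \<and> cy v < 2 * d}"

text \<open>One coordinate moves to the next axis with either sign, while the other keeps both axis
  and sign. Hence a chain meets each axis with a single sign, and its projections are faces of the
  two cross-polytopes.\<close>

definition base_step :: "nat \<Rightarrow> nat \<Rightarrow> bool" where
  "base_step u w \<longleftrightarrow> cx w div 2 = Suc (cx u div 2) \<and> cy w = cy u \<or>
                 cx w = cx u \<and> cy w div 2 = Suc (cy u div 2)"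

text \<open>The staircase triangulation of the product of the boundaries of the cross-polytopes with
  vertices \<open>\<plusminus>e\<^sub>0, \<dots>, \<plusminus>e\<^sub>d\<close> and \<open>\<plusminus>f\<^sub>0, \<dots>, \<plusminus>f\<^bsub>d-1\<^esub>\<close>. The number \<open>2 k + r\<close> with \<open>r \<in> {0, 1}\<close>
  stands for \<open>(-1)\<^sup>r e\<^sub>k\<close> in the first and for \<open>(-1)\<^sup>r f\<^sub>k\<close> in the second coordinate.\<close>

definition base_complex :: "nat \<Rightarrow> nat set set" where
  "base_complex d = graded_chains (2 * d - 1) (base_verts d) base_rk base_step"

lemma vertex_eqI: "cx u = cx v \<Longrightarrow> cy u = cy v \<Longrightarrow> u = v"
  by (metis prod_decode_inverse prod.collapse)

lemma vertex_eq_encode: "u = prod_encode (a, b) \<longleftrightarrow> cx u = a \<and> cy u = b"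
  by (metis fst_conv snd_conv prod_encode_inverse prod_decode_inverse prod.collapse)

lemma flip_sign [simp]: "flip_sign (flip_sign a) = a" "flip_sign a div 2 = a div 2" "flip_sign a \<noteq> a"
    "even (flip_sign a) \<longleftrightarrow> odd a"
  unfolding flip_sign_def by auto presburger+

lemma flip_sign_less: "flip_sign a < 2 * k \<longleftrightarrow> a < 2 * k"
  unfolding flip_sign_def by (auto elim!: evenE oddE)

lemma base_action [simp]:
  "cx (base_g v) = flip_sign (cx v)" "cy (base_g v) = cy v"
  "cx (base_h v) = cx v" "cy (base_h v) = flip_sign (cy v)"
  by (simp_all add: base_g_def base_h_def)

lemma finite_base_verts: "finite (base_verts d)"
proof (rule finite_subset)
  show "base_verts d \<subseteq> prod_encode ` ({..<2 * d + 2} \<times> {..<2 * d})"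
  proof
    fix v assume "v \<in> base_verts d"
    then show "v \<in> prod_encode ` ({..<2 * d + 2} \<times> {..<2 * d})"
      by (intro image_eqI[of _ _ "prod_decode v"]) (auto simp: base_verts_def mem_Times_iff)
  qed
qed auto

lemma even_card_two_vertices:
  assumes "\<And>u. u \<in> V \<longleftrightarrow> (cx u = a \<and> cy u = b) \<or> (cx u = a' \<and> cy u = b')" "a \<noteq> a' \<or> b \<noteq> b'"
  shows "even (card V)"
proof -
  have "V = {prod_encode (a, b), prod_encode (a', b')}"
    by (rule set_eqI) (simp only: assms(1) insert_iff empty_iff vertex_eq_encode simp_thms)
  moreover have "prod_encode (a, b) \<noteq> prod_encode (a', b')" using assms(2) by simp
  ultimately show ?thesis by simp
qed

text \<open>The vertices that fill a gap come in pairs: the two signs on an axis, or the two ways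
  round a corner of the path.\<close>

lemma graded_complex_base:
  assumes "0 < d"
  shows "graded_complex (2 * d - 1) (base_complex d) base_g base_h base_rk"
proof
  have half: "x div 2 = Suc k \<longleftrightarrow> x = 2 * k + 2 \<or> x = 2 * k + 3" for x k :: nat by auto
  show "0 < 2 * d - 1" using assms by simp
  show "finite (base_complex d)" unfolding base_complex_def by (intro finite_graded_chains finite_base_verts)
  show "bij_betw base_rk s {..2 * d - 1}" if "s \<in> base_complex d" for s
    using that graded_chainsD(2) unfolding base_complex_def by blast
  show "even (card {t \<in> base_complex d. s - {v} \<subseteq> t})" if "s \<in> base_complex d" "v \<in> s" for s v
    unfolding base_complex_def
  proof (rule even_card_graded_chains_facet[OF \<open>0 < 2 * d - 1\<close> that(1)[unfolded base_complex_def] that(2)])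
    fix u w assume uw: "u \<in> base_verts d" "w \<in> base_verts d" "base_rk u = 0" "base_rk w = 1" "base_step u w"
    let ?V = "{u \<in> base_verts d. base_rk u = 0 \<and> base_step u w}"
    have rk: "cx w div 2 + cy w div 2 = 1" using uw(4) by (simp add: base_rk_def)
    show "even (card ?V)"
    proof (cases "cx w div 2 = 1")
      case True
      then have w: "cx w div 2 = 1" "cy w < 2" using rk by auto
      have *: "(a < 2*d+2 \<and> b < 2*d) \<and> a div 2 + b div 2 = 0 \<and>
          (c div 2 = Suc (a div 2) \<and> e = b \<or> c = a \<and> e div 2 = Suc (b div 2)) \<longleftrightarrow>
          (a = 0 \<and> b = e) \<or> (a = 1 \<and> b = e)" if "c div 2 = 1" "e < 2" for a b c e :: nat
        using that assms by auto
      show ?thesis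
      proof (rule even_card_two_vertices)
        show "v' \<in> ?V \<longleftrightarrow> (cx v' = 0 \<and> cy v' = cy w) \<or> (cx v' = 1 \<and> cy v' = cy w)" for v'
          using *[OF w, of "cx v'" "cy v'"] unfolding base_verts_def base_rk_def base_step_def by simp
      qed simp
    next
      case False
      then have w: "cx w < 2" "cy w div 2 = 1" using rk by auto
      have *: "(a < 2*d+2 \<and> b < 2*d) \<and> a div 2 + b div 2 = 0 \<and>
          (c div 2 = Suc (a div 2) \<and> e = b \<or> c = a \<and> e div 2 = Suc (b div 2)) \<longleftrightarrow>
          (a = c \<and> b = 0) \<or> (a = c \<and> b = 1)" if "c < 2" "e div 2 = 1" for a b c e :: nat
        using that assms by auto
      show ?thesis
      proof (rule even_card_two_vertices)
        show "v' \<in> ?V \<longleftrightarrow> (cx v' = cx w \<and> cy v' = 0) \<or> (cx v' = cx w \<and> cy v' = 1)" for v'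
          using *[OF w, of "cx v'" "cy v'"] unfolding base_verts_def base_rk_def base_step_def by simp
      qed simp
    qed
  next
    fix u v w assume uw: "u \<in> base_verts d" "v \<in> base_verts d" "w \<in> base_verts d"
      "base_rk v = Suc (base_rk u)" "base_rk w = Suc (base_rk v)" "base_step u v" "base_step v w"
    let ?V = "{v' \<in> base_verts d. base_rk v' = base_rk v \<and> base_step u v' \<and> base_step v' w}"
    \<comment> \<open>In the straight cases \<open>xx\<close> and \<open>yy\<close> the sign on the
      middle axis is free. In \<open>xy\<close> the two steps can be made in either order, and all
      signs are prescribed by \<open>u\<close> and \<open>w\<close>.\<close>
    consider (xx) "cx w div 2 = cx u div 2 + 2" "cy w = cy u"
      | (xy) "cx w div 2 = Suc (cx u div 2)" "cy w div 2 = Suc (cy u div 2)"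
      | (yy) "cx w = cx u" "cy w div 2 = cy u div 2 + 2"
      using uw(6,7) unfolding base_step_def by auto
    then show "even (card ?V)"
    proof cases
      case xx
      have "v' \<in> ?V \<longleftrightarrow> cx v' div 2 = Suc (cx u div 2) \<and> cy v' = cy u" for v'
      proof
        assume "v' \<in> ?V"
        then have "base_step u v'" "base_step v' w" by auto
        then show "cx v' div 2 = Suc (cx u div 2) \<and> cy v' = cy u"
          unfolding base_step_def using xx by (elim disjE conjE) simp_all
      next
        assume v': "cx v' div 2 = Suc (cx u div 2) \<and> cy v' = cy u"
        then have "cx v' div 2 < cx w div 2" using xx by simp
        then have "cx v' < cx w" using div_le_mono leD leI by metis
        then show "v' \<in> ?V"
          using v' xx uw(1,3,4) unfolding base_verts_def base_rk_def base_step_def by simp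
      qed
      then show ?thesis
        by (intro even_card_two_vertices[of _ "2 * (cx u div 2) + 2" "cy u" "2 * (cx u div 2) + 3" "cy u"])
          (simp_all only: half, auto)
    next
      case xy
      have "v' \<in> ?V \<longleftrightarrow> (cx v' = cx w \<and> cy v' = cy u) \<or> (cx v' = cx u \<and> cy v' = cy w)" for v'
      proof
        assume "v' \<in> ?V"
        then have "base_step u v'" "base_step v' w" by auto
        then show "(cx v' = cx w \<and> cy v' = cy u) \<or> (cx v' = cx u \<and> cy v' = cy w)"
          unfolding base_step_def using xy by (elim disjE conjE) simp_all
      next
        assume "(cx v' = cx w \<and> cy v' = cy u) \<or> (cx v' = cx u \<and> cy v' = cy w)"
        then show "v' \<in> ?V"
          using xy uw(1,3,4) unfolding base_verts_def base_rk_def base_step_def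
          by (elim disjE conjE) simp_all
      qed
      moreover have "cx w \<noteq> cx u" using xy by auto
      ultimately show ?thesis by (intro even_card_two_vertices) auto
    next
      case yy
      have "v' \<in> ?V \<longleftrightarrow> cx v' = cx u \<and> cy v' div 2 = Suc (cy u div 2)" for v'
      proof
        assume "v' \<in> ?V"
        then have "base_step u v'" "base_step v' w" by auto
        then show "cx v' = cx u \<and> cy v' div 2 = Suc (cy u div 2)"
          unfolding base_step_def using yy by (elim disjE conjE) simp_all
      next
        assume v': "cx v' = cx u \<and> cy v' div 2 = Suc (cy u div 2)"
        then have "cy v' div 2 < cy w div 2" using yy by simp
        then have "cy v' < cy w" using div_le_mono leD leI by metis
        then show "v' \<in> ?V"
          using v' yy uw(1,3,4) unfolding base_verts_def base_rk_def base_step_def by simp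
      qed
      then show ?thesis
        by (intro even_card_two_vertices[of _ "cx u" "2 * (cy u div 2) + 2" "cx u" "2 * (cy u div 2) + 3"])
          (simp_all only: half, auto)
    qed
  next
    fix u w assume uw: "u \<in> base_verts d" "w \<in> base_verts d" "base_rk w = 2 * d - 1"
      "Suc (base_rk u) = 2 * d - 1" "base_step u w"
    let ?V = "{w \<in> base_verts d. base_rk w = 2 * d - 1 \<and> base_step u w}"
    have bd: "cx u < 2 * d + 2" "cy u < 2 * d" using uw(1) by (auto simp: base_verts_def)
    have rk: "Suc (cx u div 2 + cy u div 2) = 2 * d - 1" using uw(4) by (simp add: base_rk_def)
    \<comment> \<open>A vertex of rank \<open>2 * d - 2\<close> lies on the axes \<open>d\<close>
      and \<open>d - 2\<close> or on \<open>d - 1\<close> and \<open>d - 1\<close>. In both cases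
      only one coordinate has a further axis to move to.\<close>
    show "even (card ?V)"
    proof (cases "cx u div 2 = d")
      case True
      have "v' \<in> ?V \<longleftrightarrow> cx v' = cx u \<and> cy v' div 2 = Suc (cy u div 2)" for v'
      proof
        assume v': "v' \<in> ?V"
        then have "cx v' div 2 \<le> d" by (auto simp: base_verts_def)
        then show "cx v' = cx u \<and> cy v' div 2 = Suc (cy u div 2)"
          using v' True by (auto simp: base_step_def)
      next
        assume v': "cx v' = cx u \<and> cy v' div 2 = Suc (cy u div 2)"
        then have "cy v' div 2 < d" using rk True by linarith
        then show "v' \<in> ?V"
          using v' rk bd unfolding base_verts_def base_rk_def base_step_def by auto
      qed
      then show ?thesis
        by (intro even_card_two_vertices[of _ "cx u" "2 * (cy u div 2) + 2" "cx u" "2 * (cy u div 2) + 3"])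
          (simp_all only: half, auto)
    next
      case False
      then have "cx u div 2 < d" "cy u div 2 < d" using bd by auto
      then have u: "cx u div 2 = d - 1" "cy u div 2 = d - 1" using rk by linarith+
      have "v' \<in> ?V \<longleftrightarrow> cx v' div 2 = Suc (cx u div 2) \<and> cy v' = cy u" for v'
      proof
        assume v': "v' \<in> ?V"
        then have "cy v' div 2 < d" by (auto simp: base_verts_def)
        then show "cx v' div 2 = Suc (cx u div 2) \<and> cy v' = cy u"
          using v' u by (auto simp: base_step_def)
      next
        assume v': "cx v' div 2 = Suc (cx u div 2) \<and> cy v' = cy u"
        then have "cx v' div 2 < d + 1" using u assms by simp
        then show "v' \<in> ?V"
          using v' rk bd unfolding base_verts_def base_rk_def base_step_def by auto
      qed
      then show ?thesis
        by (intro even_card_two_vertices[of _ "2 * (cx u div 2) + 2" "cy u" "2 * (cx u div 2) + 3" "cy u"])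
          (simp_all only: half, auto)
    qed
  qed
  show gg: "base_g (base_g v) = v" "base_h (base_h v) = v" "base_g (base_h v) = base_h (base_g v)" for v
    by (rule vertex_eqI; simp)+
  show "base_rk (base_g v) = base_rk v" "base_rk (base_h v) = base_rk v" for v
    by (simp_all add: base_rk_def)
  have step: "base_step (base_g u) (base_g w)" "base_step (base_h u) (base_h w)" if "base_step u w" for u w
    using that by (auto simp: base_step_def)
  have inv: "base_g v \<in> base_verts d" "base_h v \<in> base_verts d" if "v \<in> base_verts d" for v
    using that flip_sign_less[of _ d] flip_sign_less[of _ "d + 1"] by (auto simp: base_verts_def)
  show "base_g ` s \<in> base_complex d" if "s \<in> base_complex d" for s
    using that unfolding base_complex_def
    by (rule graded_chains_image) (auto intro: step inv inj_on_inverseI gg simp: base_rk_def)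
  show "base_h ` s \<in> base_complex d" if "s \<in> base_complex d" for s
    using that unfolding base_complex_def
    by (rule graded_chains_image) (auto intro: step inv inj_on_inverseI gg simp: base_rk_def)
  show "base_g v \<noteq> v \<and> base_h v \<noteq> v \<and> base_g (base_h v) \<noteq> v" if "v \<in> \<Union> (base_complex d)" for v
    by (metis base_action flip_sign(3))
qed


section \<open>A labelling of the staircase whose count is 4 modulo 8\<close>

lemma ex_simplex_vectors:
  fixes W :: "'w::euclidean_space set"
  assumes "subspace W" "dim W = n"
  obtains \<beta> :: "nat \<Rightarrow> 'w" where "\<And>j. \<beta> j \<in> W" "(\<Sum>j\<le>n. \<beta> j) = 0"
    "\<And>c. (\<Sum>j\<le>n. c j *\<^sub>R \<beta> j) = 0 \<Longrightarrow> \<forall>j\<le>n. c j = c n"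
proof -
  obtain B where B: "B \<subseteq> W" "independent B" "card B = n"
    using basis_exists[of W] assms(2) by metis
  have finB: "finite B" using B(2) by (rule finiteI_independent)
  obtain e where e: "bij_betw e {..<n} B"
    using ex_bij_betw_nat_finite[OF finB] B(3) by (auto simp: atLeast0LessThan)
  \<comment> \<open>A basis together with the negative of its sum: the vertices of a simplex around
    the origin, whose only relations are the constant ones.\<close>
  define \<beta> where "\<beta> j = (if j < n then e j else - (\<Sum>i<n. e i))" for j
  have eW: "e i \<in> W" if "i < n" for i using that e B(1) by (auto simp: bij_betw_def)
  have split: "(\<Sum>j\<le>n. c j *\<^sub>R \<beta> j) = (\<Sum>j<n. (c j - c n) *\<^sub>R e j)" for c
  proof -
    have "{..n} = insert n {..<n}" by auto
    then have "(\<Sum>j\<le>n. c j *\<^sub>R \<beta> j) = (\<Sum>j<n. c j *\<^sub>R e j) - c n *\<^sub>R (\<Sum>i<n. e i)"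
      by (simp add: \<beta>_def)
    then show ?thesis by (simp add: scaleR_diff_left sum_subtractf scaleR_sum_right)
  qed
  show thesis
  proof
    have "(\<Sum>i<n. e i) \<in> W" using eW assms(1) by (intro subspace_sum) auto
    then show "\<beta> j \<in> W" for j using eW subspace_neg[OF assms(1)] by (auto simp: \<beta>_def)
    show "(\<Sum>j\<le>n. \<beta> j) = 0" using split[of "\<lambda>_. 1"] by simp
    fix c assume "(\<Sum>j\<le>n. c j *\<^sub>R \<beta> j) = 0"
    then have 0: "(\<Sum>j<n. (c j - c n) *\<^sub>R e j) = 0" using split by simp
    define k where "k x = c (the_inv_into {..<n} e x) - c n" for x
    have inv: "the_inv_into {..<n} e (e j) = j" if "j < n" for j
      using that e by (intro the_inv_into_f_f) (auto simp: bij_betw_def)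
    have "(\<Sum>x\<in>B. k x *\<^sub>R x) = (\<Sum>j<n. k (e j) *\<^sub>R e j)"
      by (rule sum.reindex_bij_betw[OF e, symmetric])
    also have "\<dots> = 0" using 0 inv by (simp add: k_def)
    finally have "\<forall>x\<in>B. k x = 0" using B(2) finB independentD by (metis order_refl)
    then have "k (e j) = 0" if "j < n" for j using that e by (auto simp: bij_betw_def)
    then show "\<forall>j\<le>n. c j = c n" using inv by (auto simp: k_def le_less)
  qed
qed

text \<open>For a relation \<open>c\<close> among the labels, \<open>c v * \<epsilon> v\<close> does
  not depend on \<open>v\<close>. So a nontrivial relation has no zero coefficient, and its
  coefficients have a common sign exactly if the \<epsilon> do.\<close>

lemma simplex_vectors_balanced:
  fixes \<beta> :: "nat \<Rightarrow> 'w::real_vector" and \<epsilon> :: "nat \<Rightarrow> real"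
  assumes ker: "\<And>c. (\<Sum>j\<le>n. c j *\<^sub>R \<beta> j) = 0 \<Longrightarrow> \<forall>j\<le>n. c j = c n" and sum0: "(\<Sum>j\<le>n. \<beta> j) = 0"
    and bij: "bij_betw rk s {..n}" and \<epsilon>: "\<And>v. v \<in> s \<Longrightarrow> \<epsilon> v = 1 \<or> \<epsilon> v = -1"
  defines "z \<equiv> \<lambda>v. \<epsilon> v *\<^sub>R \<beta> (rk v)"
  shows "v \<in> s \<Longrightarrow> \<not> balanced z (s - {v})"
    and "balanced z s \<longleftrightarrow> (\<forall>u\<in>s. \<forall>v\<in>s. \<epsilon> u = \<epsilon> v)"
proof -
  have fin: "finite s" using bij bij_betw_finite by blast
  have const: "c u * \<epsilon> u = c v * \<epsilon> v" if "(\<Sum>v\<in>s. c v *\<^sub>R z v) = 0" "u \<in> s" "v \<in> s" for c u v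
  proof -
    define p where "p = the_inv_into s rk"
    have p: "p (rk v) = v" if "v \<in> s" for v
      unfolding p_def using that bij by (intro the_inv_into_f_f) (auto simp: bij_betw_def)
    have "(\<Sum>j\<le>n. (c (p j) * \<epsilon> (p j)) *\<^sub>R \<beta> j) = (\<Sum>v\<in>s. (c (p (rk v)) * \<epsilon> (p (rk v))) *\<^sub>R \<beta> (rk v))"
      by (rule sum.reindex_bij_betw[OF bij, symmetric])
    also have "\<dots> = (\<Sum>v\<in>s. c v *\<^sub>R z v)" using p by (intro sum.cong) (auto simp: z_def)
    finally have "\<forall>j\<le>n. c (p j) * \<epsilon> (p j) = c (p n) * \<epsilon> (p n)" using ker that(1) by simp
    moreover have "rk u \<le> n" "rk v \<le> n" using bij that by (auto simp: bij_betw_def)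
    ultimately show ?thesis using p that by metis
  qed
  show "\<not> balanced z (s - {v})" if v: "v \<in> s"
  proof
    assume "balanced z (s - {v})"
    then obtain c u where c: "u \<in> s - {v}" "c u \<noteq> 0" "(\<Sum>v\<in>s-{v}. c v *\<^sub>R z v) = 0"
      unfolding balanced_def by blast
    have "(\<Sum>x\<in>s. (c(v := 0)) x *\<^sub>R z x) = (\<Sum>x\<in>s-{v}. c x *\<^sub>R z x)"
      using fin by (intro sum.mono_neutral_cong_right) auto
    then have "(c(v := 0)) u * \<epsilon> u = (c(v := 0)) v * \<epsilon> v" using const[of "c(v := 0)" u v] c v by auto
    then show False using c \<epsilon>[of u] by auto
  qed
  show "balanced z s \<longleftrightarrow> (\<forall>u\<in>s. \<forall>v\<in>s. \<epsilon> u = \<epsilon> v)"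
  proof
    assume "balanced z s"
    then obtain c u where c: "\<forall>v\<in>s. 0 \<le> c v" "u \<in> s" "c u \<noteq> 0" "(\<Sum>v\<in>s. c v *\<^sub>R z v) = 0"
      unfolding balanced_def by blast
    have "\<epsilon> v = \<epsilon> u" if "v \<in> s" for v
    proof -
      have "c v \<ge> 0" "c u > 0" using c that by force+
      then show ?thesis using const[OF c(4) that c(2)] \<epsilon>[OF that] \<epsilon>[OF c(2)] by auto
    qed
    then show "\<forall>u\<in>s. \<forall>v\<in>s. \<epsilon> u = \<epsilon> v" by simp
  next
    assume eq: "\<forall>u\<in>s. \<forall>v\<in>s. \<epsilon> u = \<epsilon> v"
    obtain u where u: "u \<in> s" using bij by (metis atMost_iff bij_betw_iff_bijections order_refl)
    have "(\<Sum>v\<in>s. 1 *\<^sub>R z v) = (\<Sum>v\<in>s. \<epsilon> u *\<^sub>R \<beta> (rk v))"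
      unfolding z_def scaleR_one
    proof (rule sum.cong)
      fix x assume "x \<in> s"
      then have "\<epsilon> x = \<epsilon> u" using eq u by blast
      then show "\<epsilon> x *\<^sub>R \<beta> (rk x) = \<epsilon> u *\<^sub>R \<beta> (rk x)" by simp
    qed simp
    also have "\<dots> = \<epsilon> u *\<^sub>R (\<Sum>v\<in>s. \<beta> (rk v))" by (simp add: scaleR_sum_right)
    also have "\<dots> = 0" using sum.reindex_bij_betw[OF bij, of \<beta>] sum0 by simp
    finally show "balanced z s" using u by (intro balancedI[of s "\<lambda>_. 1" u]) auto
  qed
qed

text \<open>If \<open>cx + cy\<close> has constant parity on a chain, each coordinate keeps its
  sign. The chain is then given by the two signs \<sigma>, \<tau> and the set \<open>D\<close> of
  the steps made in the first coordinate.\<close>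

definition lattice_path :: "nat \<Rightarrow> nat \<Rightarrow> nat set \<Rightarrow> nat \<Rightarrow> nat" where
  "lattice_path \<sigma> \<tau> D i = prod_encode (2 * card (D \<inter> {..<i}) + \<sigma>, 2 * card ({..<i} - D) + \<tau>)"

lemma lattice_path_coords:
  "cx (lattice_path \<sigma> \<tau> D i) = 2 * card (D \<inter> {..<i}) + \<sigma>"
  "cy (lattice_path \<sigma> \<tau> D i) = 2 * card ({..<i} - D) + \<tau>"
  by (simp_all add: lattice_path_def)

lemma lattice_path_rk:
  assumes "\<sigma> < 2" "\<tau> < 2"
  shows "base_rk (lattice_path \<sigma> \<tau> D i) = i"
proof -
  have "card (D \<inter> {..<i}) + card ({..<i} - D) = card {..<i}"
    using card_Int_Diff[of "{..<i}" D] by (simp add: Int_commute)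
  then show ?thesis using assms by (simp add: base_rk_def lattice_path_coords)
qed

lemma lattice_path_0: "lattice_path \<sigma> \<tau> D 0 = prod_encode (\<sigma>, \<tau>)"
  by (simp add: lattice_path_def)

lemma lattice_path_Suc:
  "cx (lattice_path \<sigma> \<tau> D (Suc i)) = cx (lattice_path \<sigma> \<tau> D i) + (if i \<in> D then 2 else 0)"
  "cy (lattice_path \<sigma> \<tau> D (Suc i)) = cy (lattice_path \<sigma> \<tau> D i) + (if i \<in> D then 0 else 2)"
  by (simp_all add: lattice_path_coords lessThan_Suc Int_insert_right insert_Diff_if)

lemma lattice_path_in_base:
  assumes "0 < d" "\<sigma> < 2" "\<tau> < 2" "D \<subseteq> {..<2*d-1}" "card D = d"
  shows "lattice_path \<sigma> \<tau> D ` {..2*d-1} \<in> base_complex d"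
proof -
  let ?p = "lattice_path \<sigma> \<tau> D"
  note rk = lattice_path_rk[OF assms(2,3)]
  have "?p i \<in> base_verts d" if "i \<le> 2*d-1" for i
  proof -
    have finD: "finite D" using assms(4) finite_subset by blast
    have "card (D \<inter> {..<i}) \<le> card D" using finD by (intro card_mono) auto
    moreover have "card ({..<i} - D) \<le> card ({..<2*d-1} - D)" using that by (intro card_mono) auto
    moreover have "card ({..<2*d-1} - D) = 2*d-1 - d" using assms(4,5) finD by (simp add: card_Diff_subset)
    ultimately show ?thesis using assms by (simp add: base_verts_def lattice_path_coords)
  qed
  moreover have "bij_betw base_rk (?p ` {..2*d-1}) {..2*d-1}"
    by (rule bij_betw_byWitness[of _ ?p]) (auto simp: rk)
  moreover have "base_step (?p i) (?p (Suc i))" for i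
    by (simp add: base_step_def lattice_path_Suc)
  ultimately show ?thesis unfolding base_complex_def graded_chains_def by (auto simp: rk)
qed

text \<open>The factor 4 counts the pairs of signs; for given signs a path is determined by which
  \<open>d\<close> of its \<open>2 * d - 1\<close> steps are made in the first coordinate.\<close>

lemma card_balanced_base:
  assumes d: "0 < d"
  shows "card {s \<in> base_complex d. \<forall>u\<in>s. \<forall>v\<in>s. even (cx u + cy u) = even (cx v + cy v)} =
           4 * ((2*d-1) choose d)"
proof -
  define n where "n = 2*d-1"
  define X where "X = {..<2::nat} \<times> {..<2::nat} \<times> {D. D \<subseteq> {..<n} \<and> card D = d}"
  define \<Psi> where "\<Psi> = (\<lambda>(\<sigma>, \<tau>, D). lattice_path \<sigma> \<tau> D ` {..n})"
  have "inj_on \<Psi> X"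
  proof (rule inj_onI)
    fix x x' assume x: "x \<in> X" "x' \<in> X" "\<Psi> x = \<Psi> x'"
    obtain \<sigma> \<tau> D \<sigma>' \<tau>' D' where xs: "x = (\<sigma>, \<tau>, D)" "x' = (\<sigma>', \<tau>', D')" by (metis prod_cases3)
    have lt: "\<sigma> < 2" "\<tau> < 2" "\<sigma>' < 2" "\<tau>' < 2" "D \<subseteq> {..<n}" "D' \<subseteq> {..<n}"
      using x xs by (auto simp: X_def)
    have eq: "lattice_path \<sigma> \<tau> D i = lattice_path \<sigma>' \<tau>' D' i" if "i \<le> n" for i
    proof -
      have "lattice_path \<sigma> \<tau> D i \<in> lattice_path \<sigma>' \<tau>' D' ` {..n}"
        using x(3) that unfolding \<Psi>_def xs by auto
      then obtain j where "lattice_path \<sigma> \<tau> D i = lattice_path \<sigma>' \<tau>' D' j" by blast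
      moreover from this have "i = j" using lattice_path_rk lt by metis
      ultimately show ?thesis by simp
    qed
    have "\<sigma> = \<sigma>'" "\<tau> = \<tau>'" using eq[of 0] lt by (simp_all add: lattice_path_0)
    moreover have "i \<in> D \<longleftrightarrow> i \<in> D'" if "i < n" for i
      using lattice_path_Suc(1)[of \<sigma> \<tau> D i] lattice_path_Suc(1)[of \<sigma>' \<tau>' D' i] eq[of i] eq[of "Suc i"] that
      by (auto split: if_splits)
    then have "D = D'" using lt by blast
    ultimately show "x = x'" using xs by simp
  qed
  moreover have "\<Psi> ` X = {s \<in> base_complex d. \<forall>u\<in>s. \<forall>v\<in>s. even (cx u + cy u) = even (cx v + cy v)}"
  proof (intro equalityI subsetI)
    fix s assume "s \<in> \<Psi> ` X"
    then obtain \<sigma> \<tau> D where s: "\<sigma> < 2" "\<tau> < 2" "D \<subseteq> {..<n}" "card D = d" "s = lattice_path \<sigma> \<tau> D ` {..n}"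
      by (auto simp: X_def \<Psi>_def)
    then show "s \<in> {s \<in> base_complex d. \<forall>u\<in>s. \<forall>v\<in>s. even (cx u + cy u) = even (cx v + cy v)}"
      using lattice_path_in_base[OF d s(1,2), of D] by (auto simp: n_def lattice_path_coords)
  next
    fix s assume "s \<in> {s \<in> base_complex d. \<forall>u\<in>s. \<forall>v\<in>s. even (cx u + cy u) = even (cx v + cy v)}"
    then have s: "s \<in> base_complex d" and ev: "\<And>u v. u \<in> s \<Longrightarrow> v \<in> s \<Longrightarrow> even (cx u + cy u) = even (cx v + cy v)"
      by blast+
    note D = graded_chainsD[OF s[unfolded base_complex_def], folded n_def]
    obtain p where p: "\<And>i. i \<le> n \<Longrightarrow> p i \<in> s \<and> base_rk (p i) = i" using D(6) by metis
    define \<sigma> where "\<sigma> = cx (p 0)"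
    define \<tau> where "\<tau> = cy (p 0)"
    define E where "E = {i. i < n \<and> cx (p (Suc i)) \<noteq> cx (p i)}"
    have \<sigma>\<tau>: "\<sigma> < 2" "\<tau> < 2" using p[of 0] by (auto simp: \<sigma>_def \<tau>_def base_rk_def)
    have path: "p i = lattice_path \<sigma> \<tau> E i" if "i \<le> n" for i
      using that
    proof (induction i)
      case 0
      show ?case using \<sigma>\<tau> by (simp add: lattice_path_0 vertex_eq_encode \<sigma>_def \<tau>_def)
    next
      case (Suc i)
      have pi: "p i \<in> s" "p (Suc i) \<in> s" "base_rk (p (Suc i)) = Suc (base_rk (p i))"
        using p[of i] p[of "Suc i"] Suc.prems by auto
      have par: "even (cx (p i) + cy (p i)) = even (cx (p (Suc i)) + cy (p (Suc i)))"
        using ev pi by blast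
      have IH: "lattice_path \<sigma> \<tau> E i = p i" using Suc by simp
      \<comment> \<open>Constant parity means that the moving coordinate keeps its sign and hence
        grows by exactly 2.\<close>
      have step2: "b = a + 2" if "b div 2 = Suc (a div 2)" "even a = even b" for a b :: nat
        using that by presburger
      show ?case
      proof (rule vertex_eqI)
        from D(3)[OF pi] have "cx (p (Suc i)) = cx (p i) + 2 \<and> cy (p (Suc i)) = cy (p i) \<or>
            cx (p (Suc i)) = cx (p i) \<and> cy (p (Suc i)) = cy (p i) + 2"
          unfolding base_step_def using par step2 by (metis even_add)
        then show "cx (p (Suc i)) = cx (lattice_path \<sigma> \<tau> E (Suc i))"
            "cy (p (Suc i)) = cy (lattice_path \<sigma> \<tau> E (Suc i))"
          unfolding lattice_path_Suc IH using Suc.prems by (auto simp: E_def)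
      qed
    qed
    have sp: "s = lattice_path \<sigma> \<tau> E ` {..n}"
    proof (intro equalityI subsetI)
      fix v assume v: "v \<in> s"
      then have "v = p (base_rk v)" using p D(4,5) by metis
      then show "v \<in> lattice_path \<sigma> \<tau> E ` {..n}" using path D(5)[OF v] by (metis atMost_iff imageI)
    qed (use p path in auto)
    have E: "E \<subseteq> {..<n}" by (auto simp: E_def)
    have "card E = d"
    proof -
      have "p n \<in> base_verts d" using p D(1) by blast
      moreover have "E \<inter> {..<n} = E" using E by auto
      moreover have "card ({..<n} - E) = n - card E" using E by (simp add: card_Diff_subset finite_subset)
      \<comment> \<open>The end point lies in the grid, which allows at most \<open>d\<close> steps
        in the first and \<open>d - 1\<close> in the second coordinate; together they are
        \<open>2 * d - 1\<close> steps, so both bounds are attained.\<close>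
      ultimately have "card E < d + 1" "n - card E < d"
        using path[of n] by (auto simp: base_verts_def lattice_path_coords)
      then show ?thesis using d by (simp add: n_def)
    qed
    then have "(\<sigma>, \<tau>, E) \<in> X" using \<sigma>\<tau> E by (simp add: X_def)
    then show "s \<in> \<Psi> ` X" using sp by (intro image_eqI[of _ _ "(\<sigma>, \<tau>, E)"]) (auto simp: \<Psi>_def)
  qed
  moreover have "card X = 4 * (n choose d)" unfolding X_def by (simp add: card_cartesian_product n_subsets)
  ultimately show ?thesis using card_image[of \<Psi> X] by (simp add: n_def)
qed

text \<open>By absorption \<open>2 ^ t\<close> divides \<open>k\<close> times the coefficient; if
  the latter were odd, \<open>2 ^ t\<close> would divide \<open>k\<close>.\<close>

lemma even_binomial_power_2:
  assumes "0 < k" "k < 2 ^ t"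
  shows "even ((2 ^ t) choose k :: nat)"
proof (rule ccontr)
  assume "odd ((2 ^ t) choose k :: nat)"
  then have cop: "coprime (2 ^ t) ((2 ^ t) choose k :: nat)" by simp
  have "k * ((2 ^ t) choose k) = 2 ^ t * ((2 ^ t - 1) choose (k - 1))"
    using binomial_absorption[of "k - 1" "2 ^ t"] assms(1) by simp
  then have "2 ^ t dvd k * ((2 ^ t) choose k)" by simp
  then have "2 ^ t dvd k" using cop coprime_dvd_mult_left_iff by blast
  then show False using assms by (simp add: nat_dvd_not_less)
qed

text \<open>By Pascal's rule neighbours in row \<open>2 ^ t - 1\<close> add up to an even entry of
  row \<open>2 ^ t\<close>, so the parity of the first entry, 1, propagates along the row.\<close>

lemma odd_binomial_power_2_minus_1: "k < 2 ^ t \<Longrightarrow> odd ((2 ^ t - 1) choose k :: nat)"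
proof (induction k)
  case (Suc k)
  have "(2 ^ t) choose (Suc k) = ((2 ^ t - 1) choose k) + ((2 ^ t - 1) choose Suc k :: nat)"
    using binomial_Suc_Suc[of "2 ^ t - 1" k] by simp
  then show ?case using even_binomial_power_2[of "Suc k" t] Suc by (metis Suc_lessD even_add zero_less_Suc)
qed simp

lemma base_labelling:
  fixes W :: "'w::euclidean_space set"
  assumes d: "d = 2 ^ t" and W: "subspace W" "dim W = 2 * d - 1"
  obtains z :: "nat \<Rightarrow> 'w" where "odd_labelling (base_complex d) base_g base_h z"
    "generic_labelling (base_complex d) z" "z ` \<Union>(base_complex d) \<subseteq> W"
    "num_balanced (base_complex d) z mod 8 \<noteq> 0"
proof -
  define n where "n = 2 * d - 1"
  have d0: "0 < d" using d by simp
  obtain \<beta> :: "nat \<Rightarrow> 'w" where \<beta>: "\<And>j. \<beta> j \<in> W" "(\<Sum>j\<le>n. \<beta> j) = 0"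
    "\<And>c. (\<Sum>j\<le>n. c j *\<^sub>R \<beta> j) = 0 \<Longrightarrow> \<forall>j\<le>n. c j = c n"
    using ex_simplex_vectors[OF W(1), of n] W(2) unfolding n_def by blast
  \<comment> \<open>The product of the signs of the two coordinates, so that reversing either of
    them negates the label.\<close>
  define \<epsilon> :: "nat \<Rightarrow> real" where "\<epsilon> v = (if even (cx v + cy v) then 1 else -1)" for v
  define z where "z v = \<epsilon> v *\<^sub>R \<beta> (base_rk v)" for v
  interpret graded_complex n "base_complex d" base_g base_h base_rk
    unfolding n_def by (rule graded_complex_base[OF d0])
  have \<epsilon>: "\<epsilon> v = 1 \<or> \<epsilon> v = -1" for v by (simp add: \<epsilon>_def)
  have bal: "v \<in> s \<Longrightarrow> \<not> balanced z (s - {v})" "balanced z s \<longleftrightarrow> (\<forall>u\<in>s. \<forall>v\<in>s. \<epsilon> u = \<epsilon> v)"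
    if "s \<in> base_complex d" for s v
    using simplex_vectors_balanced[where \<epsilon> = \<epsilon>, OF \<beta>(3) \<beta>(2) rk_bij[OF that] \<epsilon>] unfolding z_def[abs_def]
    by simp_all
  show thesis
  proof
    show "odd_labelling (base_complex d) base_g base_h z"
      by (auto simp: odd_labelling_def z_def \<epsilon>_def)
    show "generic_labelling (base_complex d) z"
      unfolding generic_labelling_def using bal(1) by blast
    show "z ` \<Union>(base_complex d) \<subseteq> W" using \<beta>(1) W(1) by (auto simp: z_def subspace_scale)
    have "balanced z s \<longleftrightarrow> (\<forall>u\<in>s. \<forall>v\<in>s. even (cx u + cy u) = even (cx v + cy v))"
      if "s \<in> base_complex d" for s
      unfolding bal(2)[OF that] by (intro ball_cong refl) (auto simp: \<epsilon>_def)
    then have "num_balanced (base_complex d) z = 4 * ((2*d-1) choose d)"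
      unfolding num_balanced_def card_balanced_base[OF d0, symmetric] by (metis (no_types, lifting))
    \<comment> \<open>Here \<open>2 * d - 1\<close> is \<open>2 ^ Suc t - 1\<close>.\<close>
    moreover have "odd ((2*d-1) choose d)"
      using odd_binomial_power_2_minus_1[of d "Suc t"] d by simp
    ultimately show "num_balanced (base_complex d) z mod 8 \<noteq> 0" by (auto elim!: oddE)
  qed
qed

section \<open>Fine equivariant triangulations\<close>


text \<open>The positions lie in the ambient product and are projected to the spheres only later.
  The vectors \<open>a\<close> and \<open>b\<close> put each simplex, factor by factor, on an affine
  hyperplane off the origin. This passes to barycentres with the same \<open>c\<close> and bounds
  norms below by \<open>1 / c\<close>.\<close>

definition embedded ::
  "nat set set \<Rightarrow> (nat \<Rightarrow> nat) \<Rightarrow> (nat \<Rightarrow> nat) \<Rightarrow> (nat \<Rightarrow> 'a::euclidean_space \<times> 'b::euclidean_space) \<Rightarrow>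
     real \<Rightarrow> real \<Rightarrow> bool" where
  "embedded F g h pos c \<delta> \<longleftrightarrow>
     (\<forall>v\<in>\<Union>F. pos (g v) = g1 (pos v) \<and> pos (h v) = g2 (pos v)) \<and>
     (\<forall>s\<in>F. \<exists>a b. norm a \<le> c \<and> norm b \<le> c \<and> (\<forall>v\<in>s. fst (pos v) \<bullet> a = 1 \<and> snd (pos v) \<bullet> b = 1)) \<and>
     (\<forall>s\<in>F. \<forall>u\<in>s. \<forall>v\<in>s. dist (pos u) (pos v) \<le> \<delta>)"

definition barycenter :: "(nat \<Rightarrow> 'p::real_vector) \<Rightarrow> nat set \<Rightarrow> 'p" where
  "barycenter pos X = (1 / card X) *\<^sub>R (\<Sum>x\<in>X. pos x)"

lemma inner_barycenter:
  fixes pos :: "nat \<Rightarrow> 'p::real_inner"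
  assumes "finite X" "X \<noteq> {}" "\<And>x. x \<in> X \<Longrightarrow> pos x \<bullet> a = 1"
  shows "barycenter pos X \<bullet> a = 1"
  using assms by (simp add: barycenter_def inner_sum_left)

text \<open>The difference of the barycentres is the mean of \<open>pos x - pos y\<close> over all
  pairs. As \<open>X \<subseteq> Y\<close>, one pair in every \<open>card Y\<close> has
  \<open>x = y\<close> and vanishes; with \<open>l = card Y\<close> this leaves the factor
  \<open>(l - 1) / l\<close>.\<close>

lemma dist_barycenter_le:
  fixes pos :: "nat \<Rightarrow> 'p::real_normed_vector"
  assumes Y: "finite Y" "card Y \<le> n + 1" and X: "X \<subseteq> Y" "X \<noteq> {}"
    and \<delta>: "\<And>x y. x \<in> Y \<Longrightarrow> y \<in> Y \<Longrightarrow> dist (pos x) (pos y) \<le> \<delta>"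
  shows "dist (barycenter pos X) (barycenter pos Y) \<le> \<delta> * (real n / real (n + 1))"
proof -
  have finX: "finite X" and Y0: "Y \<noteq> {}" using X Y finite_subset by auto
  define k l where "k = real (card X)" and "l = real (card Y)"
  have kl: "k > 0" "l > 0" "l \<le> n + 1" unfolding k_def l_def using X Y finX Y0 by (auto simp: card_gt_0_iff)
  have \<delta>0: "\<delta> \<ge> 0" using \<delta> Y0 by (metis all_not_in_conv dist_self)
  have "(\<Sum>x\<in>X. \<Sum>y\<in>Y. pos x - pos y) = l *\<^sub>R (\<Sum>x\<in>X. pos x) - k *\<^sub>R (\<Sum>y\<in>Y. pos y)"
    by (simp add: sum_subtractf k_def l_def scaleR_sum_right sum_constant_scaleR)
  then have "(1 / (k * l)) *\<^sub>R (\<Sum>x\<in>X. \<Sum>y\<in>Y. pos x - pos y) = barycenter pos X - barycenter pos Y"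
    using kl by (simp add: barycenter_def scaleR_diff_right flip: k_def l_def)
  then have "dist (barycenter pos X) (barycenter pos Y) = (1 / (k * l)) * norm (\<Sum>x\<in>X. \<Sum>y\<in>Y. pos x - pos y)"
    using kl by (metis dist_norm norm_scaleR abs_of_pos mult_pos_pos zero_less_divide_1_iff)
  also have "norm (\<Sum>x\<in>X. \<Sum>y\<in>Y. pos x - pos y) \<le> (\<Sum>x\<in>X. (l - 1) * \<delta>)"
  proof (rule sum_norm_le)
    fix x assume x: "x \<in> X"
    have "(\<Sum>y\<in>Y. pos x - pos y) = (\<Sum>y\<in>Y - {x}. pos x - pos y)"
      using Y by (intro sum.mono_neutral_right) auto
    also have "norm \<dots> \<le> (\<Sum>y\<in>Y - {x}. \<delta>)"
      using \<delta> x X by (intro sum_norm_le) (auto simp: dist_norm)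
    also have "\<dots> = (l - 1) * \<delta>"
    proof -
      have "x \<in> Y" using x X by blast
      then have "card Y = Suc (card (Y - {x}))" using Y(1) by (metis card.remove)
      then show ?thesis by (simp add: l_def)
    qed
    finally show "norm (\<Sum>y\<in>Y. pos x - pos y) \<le> (l - 1) * \<delta>" .
  qed
  also have "(\<Sum>x\<in>X. (l - 1) * \<delta>) = k * ((l - 1) * \<delta>)" by (simp add: k_def)
  finally have "dist (barycenter pos X) (barycenter pos Y) \<le> (1 / (k * l)) * (k * ((l - 1) * \<delta>))"
    using kl by (simp add: mult_left_mono divide_right_mono)
  also have "\<dots> = \<delta> * ((l - 1) / l)" using kl by simp
  also have "\<dots> \<le> \<delta> * (real n / real (n + 1))"
    using kl by (intro mult_left_mono[OF _ \<delta>0]) (simp add: field_simps)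
  finally show ?thesis .
qed

context graded_complex
begin

text \<open>The hyperplane equations are affine, so \<open>c\<close> is kept. Two faces of a flag
  are nested, so \<open>dist_barycenter_le\<close> applies to their barycentres.\<close>

lemma embedded_sd:
  fixes pos :: "nat \<Rightarrow> 'a::euclidean_space \<times> 'b::euclidean_space"
  assumes "embedded F g h pos c \<delta>"
  shows "embedded (sd n F) (lift_map g) (lift_map h) (\<lambda>v. barycenter pos (set_decode v)) c (\<delta> * (real n / real (n + 1)))"
proof -
  have eqv: "pos (g v) = g1 (pos v)" "pos (h v) = g2 (pos v)" if "v \<in> \<Union>F" for v
    using assms that by (auto simp: embedded_def)
  have mesh: "dist (pos u) (pos v) \<le> \<delta>" if "s \<in> F" "u \<in> s" "v \<in> s" for s u v
    using assms that by (auto simp: embedded_def)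
  have lin: "linear (g1 :: 'a \<times> 'b \<Rightarrow> _)" "linear (g2 :: 'a \<times> 'b \<Rightarrow> _)"
    by (auto intro!: linearI simp: g1_def g2_def)
  have bary: "barycenter pos (g ` X) = g1 (barycenter pos X)" "barycenter pos (h ` X) = g2 (barycenter pos X)"
    if "X \<subseteq> \<Union>F" for X
    using that eqv by (auto simp: barycenter_def card_image inj_g inj_h sum.reindex linear_scale[OF lin(1)]
        linear_scale[OF lin(2)] linear_sum[OF lin(1)] linear_sum[OF lin(2)] subset_iff intro!: sum.cong)
  have sub: "set_decode v \<subseteq> \<Union>F" if "v \<in> \<Union>(sd n F)" for v
    using that sd_subset_verts sd_verts_iff by blast
  have nz: "\<exists>a b. norm a \<le> c \<and> norm b \<le> c \<and> (\<forall>v\<in>\<sigma>. fst (barycenter pos (set_decode v)) \<bullet> a = 1 \<and>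
      snd (barycenter pos (set_decode v)) \<bullet> b = 1)" if \<sigma>: "\<sigma> \<in> sd n F" for \<sigma>
  proof -
    obtain s where s: "s \<in> F" "\<forall>v\<in>\<sigma>. set_decode v \<subseteq> s" using sd_top[OF \<sigma>] by blast
    obtain a b where ab: "norm a \<le> c" "norm b \<le> c" "\<forall>v\<in>s. fst (pos v) \<bullet> a = 1 \<and> snd (pos v) \<bullet> b = 1"
      using bspec[OF conjunct1[OF conjunct2[OF assms[unfolded embedded_def]]] s(1)] by (elim exE conjE)
    have "fst (barycenter pos (set_decode v)) \<bullet> a = 1 \<and> snd (barycenter pos (set_decode v)) \<bullet> b = 1"
      if "v \<in> \<sigma>" for v
    proof -
      have ne: "set_decode v \<noteq> {}" using that \<sigma> sd_subset_verts sd_verts_iff by blast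
      have "fst (barycenter pos (set_decode v)) = barycenter (\<lambda>x. fst (pos x)) (set_decode v)"
        "snd (barycenter pos (set_decode v)) = barycenter (\<lambda>x. snd (pos x)) (set_decode v)"
        by (simp_all add: barycenter_def fst_sum snd_sum)
      then show ?thesis
        using ab(3) s(2) that ne
          inner_barycenter[of "set_decode v" "\<lambda>x. fst (pos x)" a] inner_barycenter[of "set_decode v" "\<lambda>x. snd (pos x)" b]
        by (auto simp: subset_iff)
    qed
    then show ?thesis using ab(1,2) by blast
  qed
  have small: "dist (barycenter pos (set_decode u)) (barycenter pos (set_decode v)) \<le> \<delta> * (real n / real (n + 1))"
    if \<sigma>: "\<sigma> \<in> sd n F" "u \<in> \<sigma>" "v \<in> \<sigma>" for \<sigma> u v
  proof -
    have le: "dist (barycenter pos (set_decode u)) (barycenter pos (set_decode v)) \<le> \<delta> * (real n / real (n + 1))"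
      if uv: "u \<in> \<sigma>" "v \<in> \<sigma>" "sd_rk u \<le> sd_rk v" for u v
    proof (rule dist_barycenter_le)
      show "set_decode u \<subseteq> set_decode v" by (rule sd_nested[OF \<sigma>(1) uv])
      have verts: "u \<in> sd_verts F" "v \<in> sd_verts F" using uv \<sigma>(1) sd_subset_verts by auto
      then show "set_decode u \<noteq> {}" using sd_verts_iff by blast
      obtain s where s: "s \<in> F" "set_decode v \<subseteq> s" using verts sd_verts_iff by blast
      show "card (set_decode v) \<le> n + 1" using card_mono[OF finite_simplex[OF s(1)] s(2)] card_simplex[OF s(1)] by simp
      show "dist (pos x) (pos y) \<le> \<delta>" if "x \<in> set_decode v" "y \<in> set_decode v" for x y
        using mesh[OF s(1)] that s(2) by blast
    qed simp
    show ?thesis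
      using le[OF \<sigma>(2,3)] le[OF \<sigma>(3,2)] by (cases "sd_rk u \<le> sd_rk v") (auto simp: dist_commute)
  qed
  show ?thesis
    unfolding embedded_def set_decode_lift_map
    by (intro conjI ballI bary[OF sub] nz small)
qed

end

lemma base_monotone:
  assumes "s \<in> base_complex d" "u \<in> s" "w \<in> s" "base_rk u \<le> base_rk w"
  shows "cx u div 2 \<le> cx w div 2 \<and> (cx u div 2 = cx w div 2 \<longrightarrow> cx u = cx w) \<and>
         cy u div 2 \<le> cy w div 2 \<and> (cy u div 2 = cy w div 2 \<longrightarrow> cy u = cy w)"
proof -
  note D = graded_chainsD[OF assms(1)[unfolded base_complex_def]]
  have "cx u div 2 \<le> cx w div 2 \<and> (cx u div 2 = cx w div 2 \<longrightarrow> cx u = cx w) \<and>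
         cy u div 2 \<le> cy w div 2 \<and> (cy u div 2 = cy w div 2 \<longrightarrow> cy u = cy w)"
    if "w \<in> s" "base_rk w = base_rk u + k" for w k
    using that
  proof (induction k arbitrary: w)
    case 0
    then have "u = w" using D(4)[OF assms(2)] by simp
    then show ?case by simp
  next
    case (Suc k)
    have "base_rk w \<le> 2 * d - 1" using D(5) Suc.prems by blast
    then obtain x where x: "x \<in> s" "base_rk x = base_rk u + k"
      using D(6)[of "base_rk u + k"] Suc.prems by auto
    then have "base_step x w" using D(3)[of x w] Suc.prems by simp
    then show ?case using Suc.IH[OF x] unfolding base_step_def by (elim disjE conjE) simp_all
  qed
  from this[OF assms(3), of "base_rk w - base_rk u"] show ?thesis using assms(4) by simp
qed

lemma base_sign_unique:
  assumes "s \<in> base_complex d" "u \<in> s" "w \<in> s"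
  shows "cx u div 2 = cx w div 2 \<Longrightarrow> cx u = cx w" "cy u div 2 = cy w div 2 \<Longrightarrow> cy u = cy w"
  using base_monotone[OF assms] base_monotone[OF assms(1,3,2)] by (metis nle_le)+

text \<open>The sum of the axes with the signs found in \<open>s\<close> works, since each axis
  occurs in \<open>s\<close> with one sign only. The triangle inequality bounds its norm by the
  number of axes.\<close>

lemma ex_sign_functional:
  fixes e :: "nat \<Rightarrow> 'p::euclidean_space"
  assumes e: "bij_betw e {..<k} (Basis :: 'p set)" and s: "\<And>v. v \<in> s \<Longrightarrow> p v div 2 < k"
    and uniq: "\<And>u v. u \<in> s \<Longrightarrow> v \<in> s \<Longrightarrow> p u div 2 = p v div 2 \<Longrightarrow> p u = p v"
  shows "\<exists>a. norm a \<le> real k \<and> (\<forall>v\<in>s. ((-1) ^ p v *\<^sub>R e (p v div 2)) \<bullet> a = 1)"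
proof -
  \<comment> \<open>On an axis that does not occur in \<open>s\<close> the sign is
    arbitrary.\<close>
  define q where "q j = p (SOME v. v \<in> s \<and> p v div 2 = j)" for j
  have q: "q (p v div 2) = p v" if "v \<in> s" for v
    unfolding q_def by (rule someI2[of _ v]) (use that uniq in auto)
  define a :: 'p where "a = (\<Sum>j<k. (-1) ^ q j *\<^sub>R e j)"
  have eB: "e j \<in> Basis" if "j < k" for j using e that by (auto simp: bij_betw_def)
  have "norm a \<le> (\<Sum>j<k. 1)"
    unfolding a_def using eB by (intro sum_norm_le) (auto simp: power_abs)
  moreover have "((-1) ^ p v *\<^sub>R e (p v div 2)) \<bullet> a = 1" if "v \<in> s" for v
  proof -
    have i: "p v div 2 < k" using s that .
    have "e (p v div 2) \<bullet> a = (\<Sum>j<k. (-1) ^ q j * (e (p v div 2) \<bullet> e j))"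
      by (simp add: a_def inner_sum_right)
    also have "\<dots> = (\<Sum>j<k. if j = p v div 2 then (-1) ^ q j else 0)"
    proof (rule sum.cong)
      fix j assume "j \<in> {..<k}"
      moreover have "e (p v div 2) = e j \<longleftrightarrow> j = p v div 2"
        using e i calculation by (auto simp: bij_betw_def inj_on_def)
      ultimately show "(-1) ^ q j * (e (p v div 2) \<bullet> e j) = (if j = p v div 2 then (-1) ^ q j else 0)"
        using eB i by (simp add: inner_Basis)
    qed simp
    also have "\<dots> = (-1) ^ p v" using i q[OF that] by simp
    finally show ?thesis by (simp flip: power_add mult_2)
  qed
  ultimately show ?thesis by auto
qed

text \<open>The constant \<open>real d + 1\<close> is the dimension of the larger factor, that is,
  the bound from \<open>ex_sign_functional\<close>.\<close>

lemma ex_base_embedding: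
  assumes d: "0 < d" and dim: "DIM('a::euclidean_space) = d + 1" "DIM('b::euclidean_space) = d"
  shows "\<exists>(pos :: nat \<Rightarrow> 'a \<times> 'b) \<delta>. embedded (base_complex d) base_g base_h pos (real d + 1) \<delta>"
proof -
  obtain e :: "nat \<Rightarrow> 'a" where e: "bij_betw e {..<d+1} Basis"
    using ex_bij_betw_nat_finite[of "Basis :: 'a set"] dim by (auto simp: atLeast0LessThan)
  obtain f :: "nat \<Rightarrow> 'b" where f: "bij_betw f {..<d} Basis"
    using ex_bij_betw_nat_finite[of "Basis :: 'b set"] dim by (auto simp: atLeast0LessThan)
  define pos where "pos v = ((-1) ^ cx v *\<^sub>R e (cx v div 2), (-1) ^ cy v *\<^sub>R f (cy v div 2))" for v
  interpret graded_complex "2 * d - 1" "base_complex d" base_g base_h base_rk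
    by (rule graded_complex_base[OF d])
  have sgn: "(-1::real) ^ flip_sign a = - ((-1) ^ a)" for a by (simp add: uminus_power_if)
  have eqv: "pos (base_g v) = g1 (pos v)" "pos (base_h v) = g2 (pos v)" for v
    by (simp_all add: pos_def g1_def g2_def sgn)
  have nz: "\<exists>a b. norm a \<le> real d + 1 \<and> norm b \<le> real d + 1 \<and>
      (\<forall>v\<in>s. fst (pos v) \<bullet> a = 1 \<and> snd (pos v) \<bullet> b = 1)" if s: "s \<in> base_complex d" for s
  proof -
    have bd: "cx v div 2 < d + 1" "cy v div 2 < d" if "v \<in> s" for v
      using graded_chainsD(1)[OF s[unfolded base_complex_def]] that by (auto simp: base_verts_def)
    have "\<exists>a. norm a \<le> real (d + 1) \<and> (\<forall>v\<in>s. ((-1) ^ cx v *\<^sub>R e (cx v div 2)) \<bullet> a = 1)"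
      by (rule ex_sign_functional[OF e]) (erule bd(1), rule base_sign_unique(1)[OF s])
    then obtain a where a: "norm a \<le> real (d + 1)" "\<forall>v\<in>s. ((-1) ^ cx v *\<^sub>R e (cx v div 2)) \<bullet> a = 1" by (elim exE conjE)
    have "\<exists>b. norm b \<le> real d \<and> (\<forall>v\<in>s. ((-1) ^ cy v *\<^sub>R f (cy v div 2)) \<bullet> b = 1)"
      by (rule ex_sign_functional[OF f]) (erule bd(2), rule base_sign_unique(2)[OF s])
    then obtain b where b: "norm b \<le> real d" "\<forall>v\<in>s. ((-1) ^ cy v *\<^sub>R f (cy v div 2)) \<bullet> b = 1" by (elim exE conjE)
    have "\<forall>v\<in>s. fst (pos v) \<bullet> a = 1 \<and> snd (pos v) \<bullet> b = 1" using a(2) b(2) by (simp add: pos_def)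
    moreover have "norm a \<le> real d + 1" "norm b \<le> real d + 1" using a(1) b(1) by auto
    ultimately show ?thesis by blast
  qed
  have "\<exists>\<delta>. \<forall>s\<in>base_complex d. \<forall>u\<in>s. \<forall>v\<in>s. dist (pos u) (pos v) \<le> \<delta>"
  proof -
    have "bounded (pos ` \<Union>(base_complex d))" using finite_verts by (intro finite_imp_bounded finite_imageI)
    then obtain \<delta> where "\<forall>x\<in>pos ` \<Union>(base_complex d). \<forall>y\<in>pos ` \<Union>(base_complex d). dist x y \<le> \<delta>"
      by (auto simp: bounded_two_points)
    then show ?thesis by blast
  qed
  then obtain \<delta> where \<delta>: "\<forall>s\<in>base_complex d. \<forall>u\<in>s. \<forall>v\<in>s. dist (pos u) (pos v) \<le> \<delta>" ..
  show ?thesis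
    unfolding embedded_def by (intro exI[of _ pos] exI[of _ \<delta>] conjI ballI eqv nz \<delta>[rule_format])
qed

lemma embedded_mono: "embedded F g h pos c \<delta> \<Longrightarrow> \<delta> \<le> \<delta>' \<Longrightarrow> embedded F g h pos c \<delta>'"
  unfolding embedded_def by (meson order_trans)

lemma ex_fine_complex:
  fixes W :: "'w::euclidean_space set"
  assumes d: "d = 2 ^ t" and dim: "DIM('a::euclidean_space) = d + 1" "DIM('b::euclidean_space) = d"
    and W: "subspace W" "dim W = 2 * d - 1" and "\<delta> > 0"
  shows "\<exists>F g h rk (pos :: nat \<Rightarrow> 'a \<times> 'b). graded_complex (2 * d - 1) F g h rk \<and>
           embedded F g h pos (real d + 1) \<delta> \<and>
           (\<forall>y. odd_labelling F g h y \<longrightarrow> y ` \<Union>F \<subseteq> W \<longrightarrow> (\<exists>s\<in>F. balanced y s))"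
proof -
  define n where "n = 2 * d - 1"
  have d0: "0 < d" using d by simp
  \<comment> \<open>The labelling \<open>z\<close> is carried through the subdivisions, because its
    count is what forces every odd labelling of the fine complex to have a balanced simplex.\<close>
  define good where "good \<epsilon> \<longleftrightarrow> (\<exists>F g h rk (pos :: nat \<Rightarrow> 'a \<times> 'b) (z :: nat \<Rightarrow> 'w).
      graded_complex n F g h rk \<and> embedded F g h pos (real d + 1) \<epsilon> \<and>
      odd_labelling F g h z \<and> generic_labelling F z \<and> z ` \<Union>F \<subseteq> W \<and> num_balanced F z mod 8 \<noteq> 0)" for \<epsilon>
  obtain pos0 :: "nat \<Rightarrow> 'a \<times> 'b" and \<delta>0 where
      "embedded (base_complex d) base_g base_h pos0 (real d + 1) \<delta>0"
    using ex_base_embedding[OF d0 dim] by blast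
  then have "good \<delta>0"
    unfolding good_def n_def using graded_complex_base[OF d0] base_labelling[OF d W] by metis
  have step: "good (\<epsilon> * (real n / real (n + 1)))" if "good \<epsilon>" for \<epsilon>
  proof -
    obtain F g h rk and pos :: "nat \<Rightarrow> 'a \<times> 'b" and z :: "nat \<Rightarrow> 'w" where *: "graded_complex n F g h rk"
      "embedded F g h pos (real d + 1) \<epsilon>" "odd_labelling F g h z" "generic_labelling F z" "z ` \<Union>F \<subseteq> W"
      "num_balanced F z mod 8 \<noteq> 0"
      using \<open>good \<epsilon>\<close> unfolding good_def by (elim exE conjE)
    interpret graded_complex n F g h rk by fact
    show ?thesis
      unfolding good_def
      using graded_complex_sd embedded_sd[OF *(2)] sd_labelling[OF *(3,4,5)] *(6) by metis
  qed
  have iter: "good (\<delta>0 * (real n / real (n + 1)) ^ k)" for k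
  proof (induction k)
    case (Suc k)
    then show ?case using step[of "\<delta>0 * (real n / real (n + 1)) ^ k"] by (simp only: power_Suc2 mult.assoc)
  qed (simp add: \<open>good \<delta>0\<close>)
  have "(\<lambda>k. \<delta>0 * (real n / real (n + 1)) ^ k) \<longlonglongrightarrow> \<delta>0 * 0"
    by (intro tendsto_intros LIMSEQ_realpow_zero) auto
  then have "\<forall>\<^sub>F k in sequentially. \<delta>0 * (real n / real (n + 1)) ^ k < \<delta>"
    using \<open>\<delta> > 0\<close> by (auto intro: order_tendstoD(2))
  then obtain k where k: "\<delta>0 * (real n / real (n + 1)) ^ k \<le> \<delta>"
    by (meson eventually_happens' less_imp_le sequentially_bot)
  obtain F g h rk and pos :: "nat \<Rightarrow> 'a \<times> 'b" and z :: "nat \<Rightarrow> 'w" where *: "graded_complex n F g h rk"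
      "embedded F g h pos (real d + 1) (\<delta>0 * (real n / real (n + 1)) ^ k)" "odd_labelling F g h z"
      "generic_labelling F z" "z ` \<Union>F \<subseteq> W" "num_balanced F z mod 8 \<noteq> 0"
    using iter[of k] unfolding good_def by (elim exE conjE)
  have "\<exists>s\<in>F. balanced y s" if "odd_labelling F g h y" "y ` \<Union>F \<subseteq> W" for y
    using graded_complex.exists_balanced_simplex[OF *(1) W(1) _ that *(3,4,5,6)] W(2) by (simp add: n_def)
  then show ?thesis using *(1) embedded_mono[OF *(2) k] unfolding n_def by blast
qed

section \<open>Rainbow labels on the product of spheres\<close>


text \<open>A choice is made at one representative of each orbit and transported, with the sign
  reversed if an odd number of generators leads there. Freeness of the action makes this parity well
  defined.\<close>

lemma (in graded_complex) ex_equivariant_choice: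
  assumes ex: "\<And>v. v \<in> \<Union>F \<Longrightarrow> \<exists>i \<sigma>. P v i \<sigma>"
    and Pg: "\<And>v i \<sigma>. v \<in> \<Union>F \<Longrightarrow> P v i \<sigma> \<Longrightarrow> P (g v) i (\<not> \<sigma>)"
    and Ph: "\<And>v i \<sigma>. v \<in> \<Union>F \<Longrightarrow> P v i \<sigma> \<Longrightarrow> P (h v) i (\<not> \<sigma>)"
  shows "\<exists>I \<Sigma>. \<forall>v\<in>\<Union>F. P v (I v) (\<Sigma> v) \<and> I (g v) = I v \<and> I (h v) = I v \<and>
           \<Sigma> (g v) = (\<not> \<Sigma> v) \<and> \<Sigma> (h v) = (\<not> \<Sigma> v)"
proof -
  obtain i0 \<sigma>0 where P0: "\<And>v. v \<in> \<Union>F \<Longrightarrow> P v (i0 v) (\<sigma>0 v)" using ex by metis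
  define r where "r v = Min {v, g v, h v, g (h v)}" for v
  have gh': "h (g v) = g (h v)" for v by (simp add: gh)
  have orb: "{g v, g (g v), h (g v), g (h (g v))} = {v, g v, h v, g (h v)}"
    "{h v, g (h v), h (h v), g (h (h v))} = {v, g v, h v, g (h v)}" for v
    by (auto simp: gh')
  have rg: "r (g v) = r v" and rh: "r (h v) = r v" for v unfolding r_def orb by (rule refl)+
  have rmem: "r v \<in> {v, g v, h v, g (h v)}" for v unfolding r_def by (rule Min_in) auto
  have vr: "v = r v \<or> v = g (r v) \<or> v = h (r v) \<or> v = g (h (r v))" for v
    using rmem[of v] by (elim insertE emptyE) (simp_all add: gh')
  have rF: "r v \<in> \<Union>F" if "v \<in> \<Union>F" for v
    using rmem[of v] that g_verts[OF that] h_verts[OF that] g_verts[OF h_verts[OF that]]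
    by (elim insertE emptyE) (simp_all del: Union_iff)
  \<comment> \<open>\<open>pos v\<close> means that an even number of generators leads from the
    representative \<open>r v\<close> to \<open>v\<close>; the transported sign is then
    \<open>\<sigma>0 (r v) = pos v\<close>.\<close>
  define pos where "pos v \<longleftrightarrow> v = r v \<or> v = g (h (r v))" for v
  have pos_flip: "pos (g v) \<longleftrightarrow> \<not> pos v" "pos (h v) \<longleftrightarrow> \<not> pos v" if v: "v \<in> \<Union>F" for v
  proof -
    define w where "w = r v"
    note ne = orbit_distinct[OF rF[OF v], folded w_def]
    have inj: "g a = g b \<longleftrightarrow> a = b" "h a = h b \<longleftrightarrow> a = b" for a b by (metis gg, metis hh)
    have eqs: "pos v \<longleftrightarrow> v = w \<or> v = g (h w)" "pos (g v) \<longleftrightarrow> g v = w \<or> g v = g (h w)"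
        "pos (h v) \<longleftrightarrow> h v = w \<or> h v = g (h w)"
      by (simp_all only: pos_def rg rh w_def)
    from vr[of v, folded w_def] consider "v = w" | "v = g w" | "v = h w" | "v = g (h w)" by blast
    then have "(pos (g v) \<longleftrightarrow> \<not> pos v) \<and> (pos (h v) \<longleftrightarrow> \<not> pos v)"
      unfolding eqs by cases (simp_all only: inj gg hh gh' ne ne[symmetric] simp_thms)
    then show "pos (g v) \<longleftrightarrow> \<not> pos v" "pos (h v) \<longleftrightarrow> \<not> pos v" by simp_all
  qed
  have "P v (i0 (r v)) (\<sigma>0 (r v) = pos v)" if v: "v \<in> \<Union>F" for v
  proof -
    note F = rF[OF v]
    note ne = orbit_distinct[OF F]
    note Pr = P0[OF F]
    have 1: "P (g (r v)) (i0 (r v)) (\<not> \<sigma>0 (r v))" "P (h (r v)) (i0 (r v)) (\<not> \<sigma>0 (r v))"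
      using Pg[OF F Pr] Ph[OF F Pr] by auto
    have 2: "P (g (h (r v))) (i0 (r v)) (\<sigma>0 (r v))" using Pg[OF h_verts[OF F] 1(2)] by simp
    from vr[of v] consider "v = r v" | "v = g (r v)" | "v = h (r v)" | "v = g (h (r v))" by blast
    then show ?thesis
    proof cases
      case 1
      then have "pos v" by (simp add: pos_def)
      then show ?thesis using Pr 1 by simp
    next
      case 2
      then have "\<not> pos v" using ne unfolding pos_def by metis
      then show ?thesis using \<open>P (g (r v)) _ _\<close> 2 by simp
    next
      case 3
      then have "\<not> pos v" using ne unfolding pos_def by metis
      then show ?thesis using \<open>P (h (r v)) _ _\<close> 3 by simp
    next
      case 4
      then have "pos v" by (simp add: pos_def)
      then show ?thesis using \<open>P (g (h (r v))) _ _\<close> 4 by simp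
    qed
  qed
  then show ?thesis
    using pos_flip rg rh by (intro exI[of _ "\<lambda>v. i0 (r v)"] exI[of _ "\<lambda>v. \<sigma>0 (r v) = pos v"]) auto
qed

text \<open>\<open>True\<close> is the label sign plus. The two cases are the unions of the images
  of \<open>X\<close> under the two cosets of \<open>{1, g1 g2}\<close>.\<close>

definition signed :: "bool \<Rightarrow> ('a::real_vector \<times> 'b::real_vector) set \<Rightarrow> ('a \<times> 'b) set" where
  "signed \<sigma> X = (if \<sigma> then X \<union> (g1 \<circ> g2) ` X else g1 ` X \<union> g2 ` X)"

lemma g1_g1 [simp]: "g1 (g1 p) = p" and g2_g2 [simp]: "g2 (g2 p) = p" and g2_g1: "g2 (g1 p) = g1 (g2 p)"
  by (simp_all add: g1_def g2_def)

lemma signed_flip: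
  assumes "p \<in> signed \<sigma> X"
  shows "g1 p \<in> signed (\<not> \<sigma>) X" "g2 p \<in> signed (\<not> \<sigma>) X"
  using assms unfolding signed_def by (auto simp: g2_g1 split: if_splits)

lemma signed_cover: "G_orbit X = signed True X \<union> signed False X"
  by (auto simp: G_orbit_def signed_def)

text \<open>Used for two sets of the same index and different colours, this keeps an index from
  occurring with both signs. A coincidence such as \<open>g1 (g2 x) = g1 y\<close> reduces to
  \<open>y = g2 x\<close>.\<close>

lemma signed_disjoint:
  assumes "X \<inter> g1 ` Y = {}" "X \<inter> g2 ` Y = {}" "Y \<inter> g1 ` X = {}" "Y \<inter> g2 ` X = {}"
  shows "signed True X \<inter> signed False Y = {}"
proof -
  have ne: "x \<noteq> g1 y" "x \<noteq> g2 y" "y \<noteq> g1 x" "y \<noteq> g2 x" if "x \<in> X" "y \<in> Y" for x y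
    using assms that by blast+
  have "g1 (g2 x) \<noteq> g1 y" "g1 (g2 x) \<noteq> g2 y" if "x \<in> X" "y \<in> Y" for x y
    using ne(4)[OF that] ne(3)[OF that] g1_g1 g2_g2 g2_g1 by metis+
  then show ?thesis using ne(1,2) unfolding signed_def if_True if_False o_def by blast
qed

lemma compact_signed:
  fixes X :: "('a::euclidean_space \<times> 'b::euclidean_space) set"
  assumes "compact X"
  shows "compact (signed \<sigma> X)"
proof -
  have c: "continuous_on S (g1 :: 'a \<times> 'b \<Rightarrow> _)" "continuous_on S (g2 :: 'a \<times> 'b \<Rightarrow> _)"
    "continuous_on S (\<lambda>p :: 'a \<times> 'b. g1 (g2 p))" for S
    unfolding g1_def g2_def by (auto intro!: continuous_intros)
  show ?thesis
    unfolding signed_def using assms c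
    by (auto intro!: compact_Un compact_continuous_image simp: o_def)
qed

text \<open>The points chosen in \<open>K j0\<close> have a convergent subsequence, and those chosen
  in the other sets are dragged to the same limit.\<close>

lemma compact_family_common_point:
  fixes K :: "'i \<Rightarrow> 'p::metric_space set"
  assumes K: "\<And>j. j \<in> J \<Longrightarrow> compact (K j)" and j0: "j0 \<in> J"
    and close: "\<And>\<delta>. \<delta> > 0 \<Longrightarrow> \<exists>q. (\<forall>j\<in>J. q j \<in> K j) \<and> (\<forall>j\<in>J. \<forall>k\<in>J. dist (q j) (q k) < \<delta>)"
  shows "\<exists>p. \<forall>j\<in>J. p \<in> K j"
proof -
  have "\<exists>q. \<forall>n. (\<forall>j\<in>J. q n j \<in> K j) \<and> (\<forall>j\<in>J. \<forall>k\<in>J. dist (q n j) (q n k) < inverse (Suc n))"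
    by (intro choice allI close) simp
  then obtain q where q: "\<And>n j. j \<in> J \<Longrightarrow> q n j \<in> K j"
    "\<And>n j k. j \<in> J \<Longrightarrow> k \<in> J \<Longrightarrow> dist (q n j) (q n k) < inverse (Suc n)"
    by blast
  obtain p r where r: "strict_mono r" "((\<lambda>n. q n j0) \<circ> r) \<longlonglongrightarrow> p"
    using K[OF j0] q(1)[OF j0] unfolding compact_def by metis
  have "p \<in> K j" if j: "j \<in> J" for j
  proof -
    have lim0: "(\<lambda>n. inverse (real (Suc (r n)))) \<longlonglongrightarrow> 0"
      using LIMSEQ_subseq_LIMSEQ[OF LIMSEQ_inverse_real_of_nat r(1)] by (simp add: o_def)
    have "(\<lambda>n. dist (q (r n) j) (q (r n) j0)) \<longlonglongrightarrow> 0"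
      by (rule tendsto_sandwich[OF _ _ tendsto_const lim0])
        (use q(2)[OF j j0] in \<open>auto intro!: always_eventually less_imp_le\<close>)
    moreover have "(\<lambda>n. dist (q (r n) j0) p) \<longlonglongrightarrow> 0" using r(2) by (simp add: o_def tendsto_dist_iff[symmetric])
    ultimately have "(\<lambda>n. dist (q (r n) j) (q (r n) j0) + dist (q (r n) j0) p) \<longlonglongrightarrow> 0"
      using tendsto_add by fastforce
    then have "(\<lambda>n. dist (q (r n) j) p) \<longlonglongrightarrow> 0"
      by (rule Lim_null_comparison[rotated]) (auto intro!: always_eventually dist_triangle)
    then have "(\<lambda>n. q (r n) j) \<longlonglongrightarrow> p" by (rule tendsto_dist_iff[THEN iffD2])
    then show ?thesis
      by (rule closed_sequentially[OF compact_imp_closed[OF K[OF j]] q(1)[OF j]])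
  qed
  then show ?thesis by blast
qed

section \<open>Projection to the product of spheres\<close>

lemma norm_sgn_diff_le:
  fixes a b :: "'p::real_normed_vector"
  assumes "a \<noteq> 0"
  shows "norm (sgn a - sgn b) \<le> 2 * norm (a - b) / norm a"
proof (cases "b = 0")
  case True
  then show ?thesis using assms by (simp add: norm_sgn)
next
  case False
  \<comment> \<open>The first summand compares the vectors at the common scale
    \<open>1 / norm a\<close>, the second the two scales; each has norm at most
    \<open>norm (a - b) / norm a\<close>.\<close>
  have "sgn a - sgn b = (1 / norm a) *\<^sub>R (a - b) + ((norm b - norm a) / (norm a * norm b)) *\<^sub>R b"
  proof -
    have "(norm b - norm a) / (norm a * norm b) = 1 / norm a - 1 / norm b"
      using assms False by (simp add: diff_divide_distrib)
    then show ?thesis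
      by (simp add: sgn_div_norm scaleR_diff_left scaleR_diff_right inverse_eq_divide)
  qed
  also have "norm \<dots> \<le> norm ((1 / norm a) *\<^sub>R (a - b)) + norm (((norm b - norm a) / (norm a * norm b)) *\<^sub>R b)"
    by (rule norm_triangle_ineq)
  also have "\<dots> = (norm (a - b) + \<bar>norm b - norm a\<bar>) / norm a"
    using assms False by (simp add: add_divide_distrib abs_mult)
  also have "\<dots> \<le> (norm (a - b) + norm (a - b)) / norm a"
    using norm_triangle_ineq3[of b a] by (intro divide_right_mono add_left_mono) (auto simp: norm_minus_commute)
  finally show ?thesis by simp
qed

definition sphere_point :: "'a::real_normed_vector \<times> 'b::real_normed_vector \<Rightarrow> 'a \<times> 'b" where
  "sphere_point p = (sgn (fst p), sgn (snd p))"

lemma sphere_point_equivariant: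
  "sphere_point (g1 p) = g1 (sphere_point p)" "sphere_point (g2 p) = g2 (sphere_point p)"
  by (simp_all add: sphere_point_def g1_def g2_def sgn_minus)

lemma inverse_le_norm:
  fixes x a :: "'p::real_inner"
  assumes "x \<bullet> a = 1" "norm a \<le> c" "c > 0"
  shows "x \<noteq> 0" "1 / c \<le> norm x"
proof -
  show "x \<noteq> 0" using assms(1) by auto
  have "1 \<le> norm x * norm a" using norm_cauchy_schwarz[of x a] assms(1) by simp
  also have "\<dots> \<le> norm x * c" using assms(2) by (intro mult_left_mono) auto
  finally show "1 / c \<le> norm x" using assms(3) by (simp add: field_simps)
qed

text \<open>Each factor contributes \<open>2 * c * \<delta>\<close>: the 2 comes from
  \<open>norm_sgn_diff_le\<close>, and \<open>c\<close> bounds the inverse of the norm.\<close>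

lemma embedded_sphere_point:
  fixes pos :: "nat \<Rightarrow> 'a::euclidean_space \<times> 'b::euclidean_space"
  assumes emb: "embedded F g h pos c \<delta>" and c: "c > 0" and s: "s \<in> F" "u \<in> s" "v \<in> s"
  shows "sphere_point (pos u) \<in> sphere_prod" "dist (sphere_point (pos u)) (sphere_point (pos v)) \<le> 4 * c * \<delta>"
proof -
  obtain a b where ab: "norm a \<le> c" "norm b \<le> c" "\<forall>v\<in>s. fst (pos v) \<bullet> a = 1 \<and> snd (pos v) \<bullet> b = 1"
    using bspec[OF conjunct1[OF conjunct2[OF emb[unfolded embedded_def]]] s(1)] by (elim exE conjE)
  have u: "fst (pos u) \<noteq> 0" "1 / c \<le> norm (fst (pos u))" "snd (pos u) \<noteq> 0" "1 / c \<le> norm (snd (pos u))"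
    using inverse_le_norm[of "fst (pos u)" a c] inverse_le_norm[of "snd (pos u)" b c] ab s(2) c by auto
  then show "sphere_point (pos u) \<in> sphere_prod"
    by (simp add: sphere_point_def sphere_prod_def norm_sgn)
  have d: "dist (pos u) (pos v) \<le> \<delta>" using emb s by (auto simp: embedded_def)
  have bound: "dist (sgn p) (sgn q) \<le> 2 * c * \<delta>"
    if "p \<noteq> 0" "1 / c \<le> norm p" "dist p q \<le> \<delta>" for p q :: "'q::real_normed_vector"
  proof -
    have "dist (sgn p) (sgn q) \<le> (2 * norm (p - q)) * (1 / norm p)"
      using norm_sgn_diff_le[OF that(1), of q] by (simp add: dist_norm)
    also have "\<dots> \<le> (2 * \<delta>) * c"
    proof (rule mult_mono)
      show "1 / norm p \<le> c" using that(1,2) c by (simp add: field_simps)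
      have "0 \<le> \<delta>" using that(3) zero_le_dist order_trans by blast
      then show "0 \<le> 2 * \<delta>" by simp
    qed (use that(3) in \<open>auto simp: dist_norm\<close>)
    finally show ?thesis by (simp add: mult_ac)
  qed
  have "dist (sphere_point (pos u)) (sphere_point (pos v)) \<le>
      dist (sgn (fst (pos u))) (sgn (fst (pos v))) + dist (sgn (snd (pos u))) (sgn (snd (pos v)))"
    unfolding sphere_point_def dist_Pair_Pair by (rule sqrt_sum_squares_le_sum) auto
  also have "\<dots> \<le> 2 * c * \<delta> + 2 * c * \<delta>"
    using d u dist_fst_le[of "pos u" "pos v"] dist_snd_le[of "pos u" "pos v"]
    by (intro add_mono bound) auto
  finally show "dist (sphere_point (pos u)) (sphere_point (pos v)) \<le> 4 * c * \<delta>" by (simp add: algebra_simps)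
qed


lemma ex_close_rainbow_labels:
  fixes V :: "'c::euclidean_space set" and x :: "nat \<Rightarrow> 'c"
    and A :: "nat \<Rightarrow> nat \<Rightarrow> ('a::euclidean_space \<times> 'b::euclidean_space) set"
  assumes d: "d = 2 ^ t" and dim: "DIM('a) = d + 1" "DIM('b) = d"
    and V: "subspace V" "dim V = 2 * d - 2" "x ` {1..m} \<subseteq> V"
    and cover: "\<And>j. j \<in> {1..2*d} \<Longrightarrow> (\<Union>i\<in>{1..m}. G_orbit (A i j)) = sphere_prod"
    and "\<delta> > 0"
  shows "\<exists>\<iota> \<sigma> q. (\<forall>j\<in>{1..2*d}. \<iota> j \<in> {1..m} \<and> q j \<in> signed (\<sigma> j) (A (\<iota> j) j)) \<and>
           (\<forall>j\<in>{1..2*d}. \<forall>k\<in>{1..2*d}. dist (q j) (q k) < \<delta>) \<and>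
           balanced (\<lambda>j. (if \<sigma> j then 1 else - 1) *\<^sub>R (x (\<iota> j), 1 :: real)) {1..2*d}"
proof -
  define c where "c = real d + 1"
  have c: "c > 0" by (simp add: c_def)
  have d0: "d > 0" using d by simp
  \<comment> \<open>The extra coordinate raises the dimension from \<open>2 * d - 2\<close> to
    \<open>2 * d - 1\<close>, the dimension of the complex.\<close>
  define W where "W = V \<times> (UNIV :: real set)"
  have W: "subspace W" "dim W = 2 * d - 1"
    using V d0 by (auto simp: W_def subspace_Times dim_Times)
  \<comment> \<open>The 5 makes the projected mesh \<open>4 * c * \<epsilon>\<close> strictly
    smaller than \<delta>.\<close>
  define \<epsilon> where "\<epsilon> = \<delta> / (5 * c)"
  have \<epsilon>: "\<epsilon> > 0" "4 * c * \<epsilon> < \<delta>" using c \<open>\<delta> > 0\<close> by (auto simp: \<epsilon>_def field_simps)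
  obtain F g h rk and pos :: "nat \<Rightarrow> 'a \<times> 'b" where "graded_complex (2 * d - 1) F g h rk"
      and emb: "embedded F g h pos c \<epsilon>"
      and bal: "\<forall>y. odd_labelling F g h y \<longrightarrow> y ` \<Union>F \<subseteq> W \<longrightarrow> (\<exists>s\<in>F. balanced y s)"
    using ex_fine_complex[where ?'a = 'a and ?'b = 'b, OF d dim W \<epsilon>(1)] unfolding c_def by (elim exE conjE)
  interpret graded_complex "2 * d - 1" F g h rk by fact
  \<comment> \<open>Ranks begin at 0 and colours at 1, hence \<open>rk v + 1\<close>.\<close>
  define P where "P v i \<sigma> \<longleftrightarrow> i \<in> {1..m} \<and> sphere_point (pos v) \<in> signed \<sigma> (A i (rk v + 1))" for v i \<sigma>
  have eqv: "pos (g v) = g1 (pos v)" "pos (h v) = g2 (pos v)" if "v \<in> \<Union>F" for v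
    using conjunct1[OF emb[unfolded embedded_def]] that by auto
  have "\<exists>I \<Sigma>. \<forall>v\<in>\<Union>F. P v (I v) (\<Sigma> v) \<and> I (g v) = I v \<and> I (h v) = I v \<and>
           \<Sigma> (g v) = (\<not> \<Sigma> v) \<and> \<Sigma> (h v) = (\<not> \<Sigma> v)"
  proof (rule ex_equivariant_choice)
    fix v assume "v \<in> \<Union>F"
    then obtain s where s: "s \<in> F" "v \<in> s" by blast
    then have "rk v \<le> 2 * d - 1" using rk_bij by (auto simp: bij_betw_def)
    then have "rk v + 1 \<in> {1..2*d}" using d0 by simp
    moreover have "sphere_point (pos v) \<in> sphere_prod"
      by (rule embedded_sphere_point(1)[OF emb c s(1) s(2) s(2)])
    ultimately obtain i where "i \<in> {1..m}" "sphere_point (pos v) \<in> G_orbit (A i (rk v + 1))"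
      using cover by blast
    then show "\<exists>i \<sigma>. P v i \<sigma>" unfolding P_def signed_cover by blast
  next
    fix v i \<sigma> assume v: "v \<in> \<Union>F" "P v i \<sigma>"
    then show "P (g v) i (\<not> \<sigma>)" "P (h v) i (\<not> \<sigma>)"
      using signed_flip unfolding P_def rk_g rk_h eqv[OF v(1)] sphere_point_equivariant by blast+
  qed
  then obtain I \<Sigma> where I: "\<And>v. v \<in> \<Union>F \<Longrightarrow> P v (I v) (\<Sigma> v)"
      "\<And>v. v \<in> \<Union>F \<Longrightarrow> I (g v) = I v \<and> I (h v) = I v \<and> \<Sigma> (g v) = (\<not> \<Sigma> v) \<and> \<Sigma> (h v) = (\<not> \<Sigma> v)"
    by metis
  define y where "y v = (if \<Sigma> v then 1 else - 1) *\<^sub>R (x (I v), 1 :: real)" for v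
  have yodd: "odd_labelling F g h y" unfolding odd_labelling_def y_def using I(2) by auto
  have yW: "y ` \<Union>F \<subseteq> W"
  proof (rule image_subsetI)
    fix v assume "v \<in> \<Union>F"
    then have "I v \<in> {1..m}" using I(1) unfolding P_def by blast
    then have "x (I v) \<in> V" using V(3) by blast
    then have "(x (I v), 1) \<in> W" by (simp add: W_def)
    then show "y v \<in> W" unfolding y_def using W(1) subspace_scale by blast
  qed
  obtain s where s: "s \<in> F" "balanced y s" using bal[rule_format, OF yodd yW] ..
  \<comment> \<open>Indexing the simplex by colours gives families over a set that does not depend
    on \<delta>, as the passage to the limit requires.\<close>
  define p where "p j = the_inv_into s rk (j - 1)" for j
  note bij = rk_bij[OF s(1)]
  have p: "p j \<in> s" "rk (p j) + 1 = j" if "j \<in> {1..2*d}" for j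
  proof -
    have "j - 1 \<in> rk ` s" using bij that by (auto simp: bij_betw_def)
    then show "p j \<in> s" "rk (p j) + 1 = j"
      using bij that the_inv_into_into[of rk s "j - 1" s] f_the_inv_into_f[of rk s "j - 1"]
      by (auto simp: p_def bij_betw_def)
  qed
  have inj: "inj_on p {1..2*d}" using p(2) by (metis inj_onI)
  have "p ` {1..2*d} \<subseteq> s" using p(1) by blast
  moreover have "card (p ` {1..2*d}) = card s" using card_image[OF inj] card_simplex[OF s(1)] d0 by simp
  ultimately have "p ` {1..2*d} = s" using finite_simplex[OF s(1)] by (simp add: card_subset_eq)
  then have "balanced (\<lambda>j. y (p j)) {1..2*d}" using balanced_image_iff[OF _ inj, of y] s(2) by simp
  moreover have "\<forall>j\<in>{1..2*d}. I (p j) \<in> {1..m} \<and> sphere_point (pos (p j)) \<in> signed (\<Sigma> (p j)) (A (I (p j)) j)"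
  proof
    fix j assume j: "j \<in> {1..2*d}"
    have "p j \<in> \<Union>F" using p(1)[OF j] s(1) by blast
    then have "P (p j) (I (p j)) (\<Sigma> (p j))" by (rule I(1))
    then show "I (p j) \<in> {1..m} \<and> sphere_point (pos (p j)) \<in> signed (\<Sigma> (p j)) (A (I (p j)) j)"
      unfolding P_def p(2)[OF j] .
  qed
  moreover have "\<forall>j\<in>{1..2*d}. \<forall>k\<in>{1..2*d}. dist (sphere_point (pos (p j))) (sphere_point (pos (p k))) < \<delta>"
    using embedded_sphere_point(2)[OF emb c s(1) p(1) p(1)] \<epsilon>(2) order_le_less_trans by blast
  ultimately show ?thesis
    unfolding y_def
    by (intro exI[of _ "\<lambda>j. I (p j)"] exI[of _ "\<lambda>j. \<Sigma> (p j)"] exI[of _ "\<lambda>j. sphere_point (pos (p j))"] conjI)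
qed

section \<open>Passage to the limit and the partition\<close>

lemma uniform_finite_choice:
  fixes Q :: "'t \<Rightarrow> real \<Rightarrow> bool"
  assumes "finite D" and ex: "\<And>\<delta>. \<delta> > 0 \<Longrightarrow> \<exists>x\<in>D. Q x \<delta>"
    and mono: "\<And>x \<delta> \<delta>'. Q x \<delta> \<Longrightarrow> \<delta> \<le> \<delta>' \<Longrightarrow> Q x \<delta>'"
  shows "\<exists>x\<in>D. \<forall>\<delta>>0. Q x \<delta>"
proof (rule ccontr)
  assume "\<not> (\<exists>x\<in>D. \<forall>\<delta>>0. Q x \<delta>)"
  then obtain e where e: "\<And>x. x \<in> D \<Longrightarrow> e x > 0 \<and> \<not> Q x (e x)" by metis
  \<comment> \<open>If every candidate failed at some scale, then by monotonicity all of them would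
    fail at the least of these scales.\<close>
  define \<delta> where "\<delta> = Min (insert 1 (e ` D))"
  have "\<delta> > 0" unfolding \<delta>_def using assms(1) e by auto
  then obtain x where x: "x \<in> D" "Q x \<delta>" using ex by blast
  have "\<delta> \<le> e x" unfolding \<delta>_def using assms(1) x(1) by (intro Min_le) auto
  then show False using mono[OF x(2)] e[OF x(1)] by blast
qed

text \<open>The last coordinate of the relation gives both signs the same total weight
  \<open>C\<close>; division by \<open>C\<close> turns the other coordinates into an equality of two
  convex combinations.\<close>

lemma balanced_signs_hulls_meet:
  fixes x :: "'i \<Rightarrow> 'c::real_vector"
  assumes fin: "finite J" and bal: "balanced (\<lambda>j. (if \<sigma> j then 1 else - 1) *\<^sub>R (x (\<iota> j), 1 :: real)) J"
  shows "convex hull (x ` \<iota> ` {j\<in>J. \<not> \<sigma> j}) \<inter> convex hull (x ` \<iota> ` {j\<in>J. \<sigma> j}) \<noteq> {}"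
proof -
  obtain c u where c: "\<forall>j\<in>J. 0 \<le> c j" "u \<in> J" "c u \<noteq> 0"
      "(\<Sum>j\<in>J. c j *\<^sub>R ((if \<sigma> j then 1 else - 1) *\<^sub>R (x (\<iota> j), 1 :: real))) = 0"
    using bal unfolding balanced_def by blast
  define T where "T = {j\<in>J. \<sigma> j}"
  define S where "S = {j\<in>J. \<not> \<sigma> j}"
  have ST: "finite S" "finite T" "S \<inter> T = {}" "J = S \<union> T" using fin by (auto simp: S_def T_def)
  have "(\<Sum>j\<in>S. c j *\<^sub>R (x (\<iota> j), 1 :: real)) = (\<Sum>j\<in>T. c j *\<^sub>R (x (\<iota> j), 1))"
  proof -
    have "(\<Sum>j\<in>S. c j *\<^sub>R ((if \<sigma> j then 1 else - 1) *\<^sub>R (x (\<iota> j), 1 :: real))) =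
        - (\<Sum>j\<in>S. c j *\<^sub>R (x (\<iota> j), 1))"
      unfolding sum_negf[symmetric] by (intro sum.cong) (auto simp: S_def)
    moreover have "(\<Sum>j\<in>T. c j *\<^sub>R ((if \<sigma> j then 1 else - 1) *\<^sub>R (x (\<iota> j), 1 :: real))) =
        (\<Sum>j\<in>T. c j *\<^sub>R (x (\<iota> j), 1))"
      by (intro sum.cong) (auto simp: T_def)
    ultimately show ?thesis using c(4) unfolding ST(4) sum.union_disjoint[OF ST(1,2,3)] by simp
  qed
  then have eq: "(\<Sum>j\<in>S. c j *\<^sub>R x (\<iota> j)) = (\<Sum>j\<in>T. c j *\<^sub>R x (\<iota> j))" "(\<Sum>j\<in>S. c j) = (\<Sum>j\<in>T. c j)"
    by (auto simp: prod_eq_iff fst_sum snd_sum)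
  define C where "C = (\<Sum>j\<in>S. c j)"
  have nonneg: "\<And>j. j \<in> S \<Longrightarrow> 0 \<le> c j" "\<And>j. j \<in> T \<Longrightarrow> 0 \<le> c j" using c(1) ST(4) by auto
  have "(\<Sum>j\<in>S. c j) + (\<Sum>j\<in>T. c j) = (\<Sum>j\<in>J. c j)" unfolding ST(4) using sum.union_disjoint[OF ST(1,2,3), of c] by simp
  also have "\<dots> > 0" using c(1,2,3) fin by (intro sum_pos2[of J u]) force+
  finally have C: "C > 0" using eq(2) by (simp add: C_def)
  have hull: "(1 / C) *\<^sub>R (\<Sum>j\<in>X. c j *\<^sub>R x (\<iota> j)) \<in> convex hull (x ` \<iota> ` X)"
    if X: "finite X" "\<And>j. j \<in> X \<Longrightarrow> 0 \<le> c j" "(\<Sum>j\<in>X. c j) = C" for X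
  proof -
    have "(\<Sum>j\<in>X. (c j / C) *\<^sub>R x (\<iota> j)) \<in> convex hull (x ` \<iota> ` X)"
    proof (rule convex_sum[OF X(1) convex_convex_hull])
      show "(\<Sum>j\<in>X. c j / C) = 1" using X(3) C by (simp flip: sum_divide_distrib)
      show "0 \<le> c j / C" if "j \<in> X" for j using X(2)[OF that] C by simp
      show "x (\<iota> j) \<in> convex hull (x ` \<iota> ` X)" if "j \<in> X" for j using that by (intro hull_inc) simp
    qed
    then show ?thesis by (simp add: scaleR_sum_right)
  qed
  have "(1 / C) *\<^sub>R (\<Sum>j\<in>S. c j *\<^sub>R x (\<iota> j)) \<in> convex hull (x ` \<iota> ` S)"
    by (rule hull[OF ST(1) nonneg(1)]) (simp_all add: C_def)
  moreover have "(1 / C) *\<^sub>R (\<Sum>j\<in>S. c j *\<^sub>R x (\<iota> j)) \<in> convex hull (x ` \<iota> ` T)"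
    unfolding eq(1) by (rule hull[OF ST(2) nonneg(2)]) (simp_all add: C_def eq(2))
  ultimately show ?thesis unfolding S_def T_def by blast
qed

theorem theorem6p4:
  fixes t d m :: nat
    and V :: "'c::euclidean_space set"
    and x :: "nat \<Rightarrow> 'c"
    and A :: "nat \<Rightarrow> nat \<Rightarrow> ('a::euclidean_space \<times> 'b::euclidean_space) set"
  assumes "d = 2 ^ t"
    and "DIM('a) = d + 1" and "DIM('b) = d"
    and "subspace V" and "dim V = 2 * d - 2"
    and "m > 0"
    and "x ` {1..m} \<subseteq> V" and "inj_on x {1..m}"
    and "\<And>i j. i \<in> {1..m} \<Longrightarrow> j \<in> {1..2*d} \<Longrightarrow>
           closedin (top_of_set sphere_prod) (A i j)"
    and "\<And>i j k. i \<in> {1..m} \<Longrightarrow> j \<in> {1..2*d} \<Longrightarrow> k \<in> {1..2*d} \<Longrightarrow> j \<noteq> k \<Longrightarrow>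
           A i j \<inter> g1 ` A i k = {} \<and> A i j \<inter> g2 ` A i k = {}"
    and "\<And>j. j \<in> {1..2*d} \<Longrightarrow> (\<Union>i\<in>{1..m}. G_orbit (A i j)) = sphere_prod"
  shows "\<exists>S T \<alpha> \<beta> \<pi>.
           S \<subseteq> {1..m} \<and> T \<subseteq> {1..m} \<and> S \<inter> T = {} \<and>
           \<alpha> \<in> S \<rightarrow> {g1, g2} \<and> \<beta> \<in> T \<rightarrow> {id, g1 \<circ> g2} \<and>
           \<pi> \<in> S \<union> T \<rightarrow> {1..2*d} \<and> inj_on \<pi> (S \<union> T) \<and>
           convex hull (x ` S) \<inter> convex hull (x ` T) \<noteq> {} \<and>
           (\<Inter>i\<in>S. \<alpha> i ` A i (\<pi> i)) \<inter> (\<Inter>i\<in>T. \<beta> i ` A i (\<pi> i)) \<noteq> {}"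
proof -
  define J where "J = {1..2*d}"
  have d0: "d > 0" using assms(1) by simp
  have J: "finite J" "1 \<in> J" using d0 by (auto simp: J_def)
  \<comment> \<open>Indices and signs form a finite set of extensional functions on
    \<open>J\<close>, so one pair of them serves for all \<delta>.\<close>
  define D where "D = (J \<rightarrow>\<^sub>E {1..m}) \<times> (J \<rightarrow>\<^sub>E (UNIV :: bool set))"
  have "finite D" unfolding D_def using J(1) by (intro finite_SigmaI finite_PiE) auto
  define Q where "Q = (\<lambda>(\<iota>, \<sigma>) \<delta>. \<exists>q. (\<forall>j\<in>J. q j \<in> signed (\<sigma> j) (A (\<iota> j) j)) \<and>
      (\<forall>j\<in>J. \<forall>k\<in>J. dist (q j) (q k) < \<delta>) \<and>
      balanced (\<lambda>j. (if \<sigma> j then 1 else - 1) *\<^sub>R (x (\<iota> j), 1 :: real)) J)"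
  have "\<exists>w\<in>D. Q w \<delta>" if "\<delta> > 0" for \<delta>
  proof -
    have "\<exists>\<iota> \<sigma> q. (\<forall>j\<in>J. \<iota> j \<in> {1..m} \<and> q j \<in> signed (\<sigma> j) (A (\<iota> j) j)) \<and>
        (\<forall>j\<in>J. \<forall>k\<in>J. dist (q j) (q k) < \<delta>) \<and>
        balanced (\<lambda>j. (if \<sigma> j then 1 else - 1) *\<^sub>R (x (\<iota> j), 1 :: real)) J"
      unfolding J_def by (rule ex_close_rainbow_labels[OF assms(1-5,7) _ \<open>\<delta> > 0\<close>]) (rule assms(11))
    then obtain \<iota> \<sigma> q where *: "\<forall>j\<in>J. \<iota> j \<in> {1..m} \<and> q j \<in> signed (\<sigma> j) (A (\<iota> j) j)"
        "\<forall>j\<in>J. \<forall>k\<in>J. dist (q j) (q k) < \<delta>"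
        "balanced (\<lambda>j. (if \<sigma> j then 1 else - 1) *\<^sub>R (x (\<iota> j), 1 :: real)) J"
      by (elim exE conjE)
    have "balanced (\<lambda>j. (if restrict \<sigma> J j then 1 else - 1) *\<^sub>R (x (restrict \<iota> J j), 1 :: real)) J"
      using *(3) by (subst balanced_cong) auto
    then have "Q (restrict \<iota> J, restrict \<sigma> J) \<delta>"
      unfolding Q_def prod.case using *(1,2) by (intro exI[of _ q] conjI) auto
    moreover have "(restrict \<iota> J, restrict \<sigma> J) \<in> D" using *(1) by (auto simp: D_def)
    ultimately show ?thesis by blast
  qed
  moreover have "Q w \<delta>'" if "Q w \<delta>" "\<delta> \<le> \<delta>'" for w \<delta> \<delta>'
  proof -
    obtain \<iota> \<sigma> where w: "w = (\<iota>, \<sigma>)" by (rule prod.exhaust)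
    show ?thesis using that unfolding Q_def w prod.case by (meson order_less_le_trans)
  qed
  ultimately have "\<exists>w\<in>D. \<forall>\<delta>>0. Q w \<delta>" by (rule uniform_finite_choice[OF \<open>finite D\<close>])
  then obtain \<iota> \<sigma> where \<iota>\<sigma>: "(\<iota>, \<sigma>) \<in> D" and Q: "\<And>\<delta>. \<delta> > 0 \<Longrightarrow> Q (\<iota>, \<sigma>) \<delta>" by force
  have \<iota>: "\<iota> j \<in> {1..m}" if "j \<in> J" for j using \<iota>\<sigma> that by (auto simp: D_def PiE_def Pi_def)
  have bal: "balanced (\<lambda>j. (if \<sigma> j then 1 else - 1) *\<^sub>R (x (\<iota> j), 1 :: real)) J"
    using Q[OF zero_less_one] unfolding Q_def prod.case by (elim exE conjE)
  have cpt: "compact (A i j)" if "i \<in> {1..m}" "j \<in> J" for i j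
  proof (rule closedin_compact[OF _ assms(9)])
    show "compact (sphere_prod :: ('a \<times> 'b) set)"
      unfolding sphere_prod_def by (intro compact_Times compact_sphere)
  qed (use that in \<open>auto simp: J_def\<close>)
  have "\<exists>p. \<forall>j\<in>J. p \<in> signed (\<sigma> j) (A (\<iota> j) j)"
  proof (rule compact_family_common_point[OF _ J(2)])
    show "compact (signed (\<sigma> j) (A (\<iota> j) j))" if "j \<in> J" for j
      using cpt[OF \<iota>[OF that] that] by (rule compact_signed)
    show "\<exists>q. (\<forall>j\<in>J. q j \<in> signed (\<sigma> j) (A (\<iota> j) j)) \<and> (\<forall>j\<in>J. \<forall>k\<in>J. dist (q j) (q k) < \<delta>)"
      if "\<delta> > 0" for \<delta>
      using Q[OF that] unfolding Q_def prod.case by blast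
  qed
  then obtain p where p: "\<And>j. j \<in> J \<Longrightarrow> p \<in> signed (\<sigma> j) (A (\<iota> j) j)" by blast
  define S where "S = \<iota> ` {j\<in>J. \<not> \<sigma> j}"
  define T where "T = \<iota> ` {j\<in>J. \<sigma> j}"
  have sub: "S \<subseteq> {1..m}" "T \<subseteq> {1..m}" using \<iota> by (auto simp: S_def T_def)
  \<comment> \<open>An index occurring with both signs would put \<open>p\<close> into oppositely
    signed sets of two different colours, against \<open>signed_disjoint\<close>.\<close>
  have "\<iota> j \<noteq> \<iota> k" if jk: "j \<in> J" "k \<in> J" "\<sigma> j" "\<not> \<sigma> k" for j k
  proof
    assume eq: "\<iota> j = \<iota> k"
    have "j \<noteq> k" using jk by auto
    then have "signed True (A (\<iota> j) j) \<inter> signed False (A (\<iota> j) k) = {}"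
      using assms(10)[OF \<iota>[OF jk(1)], of j k] assms(10)[OF \<iota>[OF jk(1)], of k j] jk(1,2)
      by (intro signed_disjoint) (auto simp: J_def)
    then show False using p[OF jk(1)] p[OF jk(2)] jk(3,4) eq by auto
  qed
  then have disj: "S \<inter> T = {}" unfolding S_def T_def by force
  \<comment> \<open>Several colours may yield the same index, and one of them is selected. As
    \<iota> inverts \<pi>, injectivity follows.\<close>
  define \<pi> where "\<pi> i = (SOME j. j \<in> J \<and> \<iota> j = i)" for i
  have \<pi>: "\<pi> i \<in> J \<and> \<iota> (\<pi> i) = i" if "i \<in> S \<union> T" for i
    unfolding \<pi>_def by (rule someI_ex) (use that in \<open>auto simp: S_def T_def\<close>)
  have \<sigma>S: "\<not> \<sigma> (\<pi> i)" if "i \<in> S" for i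
  proof
    assume "\<sigma> (\<pi> i)"
    then have "\<iota> (\<pi> i) \<in> T" unfolding T_def using \<pi>[of i] that by blast
    then show False using \<pi>[of i] that disj by auto
  qed
  have \<sigma>T: "\<sigma> (\<pi> i)" if "i \<in> T" for i
  proof (rule ccontr)
    assume "\<not> \<sigma> (\<pi> i)"
    then have "\<iota> (\<pi> i) \<in> S" unfolding S_def using \<pi>[of i] that by blast
    then show False using \<pi>[of i] that disj by auto
  qed
  have "\<exists>a\<in>{g1, g2}. p \<in> a ` A i (\<pi> i)" if "i \<in> S" for i
    using p[of "\<pi> i"] \<pi>[of i] \<sigma>S[OF that] that unfolding signed_def by auto
  then obtain \<alpha> where \<alpha>: "\<And>i. i \<in> S \<Longrightarrow> \<alpha> i \<in> {g1, g2} \<and> p \<in> \<alpha> i ` A i (\<pi> i)" by metis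
  have "\<exists>b\<in>{id, g1 \<circ> g2}. p \<in> b ` A i (\<pi> i)" if "i \<in> T" for i
    using p[of "\<pi> i"] \<pi>[of i] \<sigma>T[OF that] that unfolding signed_def by auto
  then obtain \<beta> where \<beta>: "\<And>i. i \<in> T \<Longrightarrow> \<beta> i \<in> {id, g1 \<circ> g2} \<and> p \<in> \<beta> i ` A i (\<pi> i)" by metis
  have hulls: "convex hull (x ` S) \<inter> convex hull (x ` T) \<noteq> {}"
    unfolding S_def T_def by (rule balanced_signs_hulls_meet[where \<sigma> = \<sigma> and x = x and \<iota> = \<iota>, OF J(1) bal])
  have "p \<in> (\<Inter>i\<in>S. \<alpha> i ` A i (\<pi> i)) \<inter> (\<Inter>i\<in>T. \<beta> i ` A i (\<pi> i))" using \<alpha> \<beta> by blast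
  then have common: "(\<Inter>i\<in>S. \<alpha> i ` A i (\<pi> i)) \<inter> (\<Inter>i\<in>T. \<beta> i ` A i (\<pi> i)) \<noteq> {}"
    unfolding ex_in_conv[symmetric] by (rule exI)
  have inj: "inj_on \<pi> (S \<union> T)" using \<pi> by (metis inj_onI)
  have maps: "\<alpha> \<in> S \<rightarrow> {g1, g2}" "\<beta> \<in> T \<rightarrow> {id, g1 \<circ> g2}" "\<pi> \<in> S \<union> T \<rightarrow> {1..2*d}"
    using \<alpha> \<beta> \<pi> unfolding J_def by blast+
  show ?thesis
    by (rule exI[of _ S], rule exI[of _ T], rule exI[of _ \<alpha>], rule exI[of _ \<beta>], rule exI[of _ \<pi>])
      (intro conjI; fact)
qed

end
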